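(* Let $n\ge 2$, let $(M^n,g)$ be a connected Riemannian manifold, let $B\subset\mathbb R^2$ be an open subset with natural coordinates $(\rho,s)$, and let $g_B$ be a Lorentzian metric on $B$ for which there are two lightlike vector fields $\xi,\eta\in\mathfrak X(B)$ with $g_B(\xi,\eta)=-1$. Let $\varphi\in C^\infty(B)$ with $\varphi>0$, and equip $\widetilde M^{n+2}=B\times M$ with the Lorentzian warped metric $\widetilde g=\pi_B^*(g_B)+\varphi(\rho,s)^2\,\pi_M^*(g)$, where $\pi_B,\pi_M$ are the projections onto $B$ and $M$. Assume there is $(\rho_0,s_0)\in B$ with $\varphi(\rho_0,s_0)=1$, and let $\Psi\colon M\to\widetilde M$ be the spacelike immersion $\Psi(x)=(\rho_0,s_0,x)$, which satisfies $\Psi^*(\widetilde g)=g$. Let $(\mathcal T,\mathcal T^1,\widetilde g,\widetilde\nabla)$ be the associated tractor to the pair $(\Psi,\xi)$, where $\xi$ also denotes the lightlike normal vector field along $\Psi$ given by the lift of $\xi$ to $\widetilde M$. Assume $\xi_{(\rho_0,s_0)}\varphi\neq0$. Then $(\mathcal T,\mathcal T^1,\widetilde g,\widetilde\nabla)$ is always standard for (the conformal class of) $g$, and the tractor connection $\widetilde\nabla$ is normal if and only if $(M,g)$ is an Einstein manifold with $\mathrm{Ric}=\Lambda\,g$. In such a case, we have $$\Lambda=(n-1)\|\mathbf H\|^2=(n-1)\|\nabla\varphi(\rho_0,s_0)\|^2,$$ where $\mathbf H$ is the mean curvature vector field of $\Psi$ and $\nabla\varphi$ is the gradient of $\varphi$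 in $(B,g_B)$.
   Context: Squared norms are $\|\mathbf H\|^2=\widetilde g(\mathbf H,\mathbf H)$ and $\|\nabla\varphi\|^2=g_B(\nabla\varphi,\nabla\varphi)$ (of any sign). A vector field is lightlike if it is nowhere zero and has zero square. Notation: $\xi_{(\rho_0,s_0)}\varphi$ is the derivative of $\varphi$ in the direction $\xi$ at $(\rho_0,s_0)$; vector fields on $B$ are identified with their lifts to $B\times M$. For a spacelike immersion $\Psi$ (one whose induced metric $g$ is Riemannian), $\widetilde\nabla$ denotes the Levi-Civita connection of $\widetilde g$ and also the induced (pull-back) connection on $\Psi^*(T\widetilde M)$; with $\nabla$ the Levi-Civita connection of $g$ and $\nabla^\perp$ the normal connection, $\widetilde\nabla_XY=\nabla_XY+\mathrm{II}(X,Y)$ and $\widetilde\nabla_X\zeta=-A_\zeta X+\nabla^\perp_X\zeta$ for $X,Y\in\mathfrak X(M)$ and normal $\zeta$. The mean curvature vector field is $\mathbf H=\frac1n\mathrm{trace}_g\mathrm{II}$. Curvature convention: $R(X,Y)Z=\nabla_X\nabla_YZ-\nabla_Y\nabla_XZ-\nabla_{[X,Y]}Z$ (likewise for other connections), and $\mathrm{Ric}(X,Y)=\sum_i g(R(E_i,X)Y,E_i)$ is the Ricci tensor of $g$, with $(E_i)$ a local $g$-orthonormal frame. A tractor conformal bundle on $M$ is a rank $n+2$ real vector bundle $\mathcal T\to M$ with a bundle metric $h$ of signature $(n+1,1)$ and a distinguished lightlike line subbundle $\mathcal T^1$. A tractor connection is a linear connection $\nabla^{\mathcal T}$ with $\nabla^{\mathcal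 T}h=0$ such that for nonvanishing local sections $\sigma$ of $\mathcal T^1$ the map $\beta_\sigma\colon TM\to(\mathcal T^1)^\perp/\mathcal T^1$, $\beta_\sigma(X)=\nabla^{\mathcal T}_X\sigma+\mathcal T^1$, is a vector bundle isomorphism. Then $h^\sigma(X,Y)=h(\beta_\sigma(X),\beta_\sigma(Y))$ is a Riemannian metric whose conformal class does not depend on $\sigma$; the tractor bundle with connection is called standard for a conformal structure $c$ if this class is $c$. The associated tractor to $(\Psi,\xi)$ is $\mathcal T=\Psi^*(T\widetilde M)$ with bundle metric $\widetilde g$, $\mathcal T^1=\mathrm{Span}(\xi)$ and the induced connection $\widetilde\nabla$. Normality: a tractor connection $\nabla^{\mathcal T}$ with curvature $R^{\mathcal T}$ is normal if (i) $R^{\mathcal T}(X,Y)\sigma\in\Gamma(\mathcal T^1)$ for all $X,Y\in\mathfrak X(M)$, $\sigma\in\Gamma(\mathcal T^1)$, so that $R^{\mathcal T}(X,Y)$ induces an endomorphism of $(\mathcal T^1)^\perp/\mathcal T^1$; and (ii) $\sum_{i=1}^n h\big(R^{\mathcal T}(E_i,X)\beta_\sigma(Y),\beta_\sigma(E_i)\big)=0$ for all $X,Y\in\mathfrak X(M)$, where $(E_1,\dots,E_n)$ is a local orthonormal frame for $h^\sigma$ (independent of the choice of nonvanishing $\sigma$). These conditions are used as the meaning of normality for all $n\ge 2$.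
   Formalization: The stated value of Λ is made part of the equivalence: normal iff Ric = Λg with Λ = (n−1)‖H‖² = (n−1)‖∇φ(ρ0,s0)‖². With arbitrary Λ the converse fails, e.g. g_B = −2dρds, ξ = ∂_ρ, φ = 1+ρ, (ρ0,s0) = (0,0), M a round sphere. *)

theory Defs
  imports "HOL-Analysis.Analysis" "HOL-Library.Function_Algebras"
begin

text \<open>Tangent vectors are derivations, i.e. functions, so function spaces have to be real vector
  spaces (pointwise operations) for \<^const>\<open>span\<close>, \<^const>\<open>subspace\<close>, \<^const>\<open>dim\<close> to apply to them.\<close>

instantiation "fun" :: (type, real_vector) real_vector
begin
definition scaleR_fun :: "real \<Rightarrow> ('a \<Rightarrow> 'b) \<Rightarrow> 'a \<Rightarrow> 'b"
  where "scaleR_fun a f = (\<lambda>x. a *\<^sub>R f x)"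
instance
  by standard (simp_all add: scaleR_fun_def fun_eq_iff scaleR_add_right scaleR_add_left)
end


section \<open>Smooth manifolds\<close>

text \<open>On an open set of a Euclidean space: \<open>C\<^sup>k\<close> in the sense of iterated directional derivatives.\<close>

primrec Ck_on :: "nat \<Rightarrow> 'a::real_normed_vector set \<Rightarrow> ('a \<Rightarrow> 'b::real_normed_vector) \<Rightarrow> bool" where
  "Ck_on 0 S f \<longleftrightarrow> continuous_on S f"
| "Ck_on (Suc k) S f \<longleftrightarrow>
     (\<forall>x\<in>S. f differentiable (at x)) \<and> (\<forall>v. Ck_on k S (\<lambda>x. frechet_derivative f (at x) v))"

definition smooth_on :: "'a::real_normed_vector set \<Rightarrow> ('a \<Rightarrow> 'b::real_normed_vector) \<Rightarrow> bool" where
  "smooth_on S f \<longleftrightarrow> (\<forall>k. Ck_on k S f)"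

text \<open>A chart is a domain together with a coordinate map, whose values off the domain are
  irrelevant. A manifold is given by a smooth atlas, which need not be maximal; its underlying set
  is the open set \<open>points A\<close>. Its dimension is that of the model space \<open>'e\<close>.\<close>

type_synonym ('m, 'e) chart = "'m set \<times> ('m \<Rightarrow> 'e)"

definition points :: "('m, 'e) chart set \<Rightarrow> 'm set" where
  "points A = (\<Union>(U, c)\<in>A. U)"

definition smooth_atlas ::
    "('m::{t2_space,second_countable_topology}, 'e::euclidean_space) chart set \<Rightarrow> bool" where
  "smooth_atlas A \<longleftrightarrow>
     (\<forall>(U, c)\<in>A. open U \<and> open (c ` U) \<and> homeomorphism U (c ` U) c (inv_into U c)) \<and>
     (\<forall>(U, c)\<in>A. \<forall>(V, d)\<in>A. smooth_on (c ` (U \<inter> V)) (d \<circ> inv_into U c))"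

definition open_atlas :: "'e::euclidean_space set \<Rightarrow> ('e, 'e) chart set" where
  "open_atlas B = {(B, \<lambda>x. x)}"

definition prod_atlas :: "('a, 'e) chart set \<Rightarrow> ('b, 'f) chart set \<Rightarrow> ('a \<times> 'b, 'e \<times> 'f) chart set" where
  "prod_atlas A1 A2 = {(U \<times> V, \<lambda>(x, y). (c x, d y)) |U c V d. (U, c) \<in> A1 \<and> (V, d) \<in> A2}"

definition smooth_fun ::
    "('m::topological_space, 'e::euclidean_space) chart set \<Rightarrow> 'm set \<Rightarrow> ('m \<Rightarrow> real) \<Rightarrow> bool" where
  "smooth_fun A U f \<longleftrightarrow> open U \<and> U \<subseteq> points A \<and>
     (\<forall>(V, c)\<in>A. smooth_on (c ` (U \<inter> V)) (f \<circ> inv_into V c))"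

definition smooth_near ::
    "('m::topological_space, 'e::euclidean_space) chart set \<Rightarrow> 'm \<Rightarrow> ('m \<Rightarrow> real) \<Rightarrow> bool" where
  "smooth_near A p f \<longleftrightarrow> (\<exists>U. p \<in> U \<and> smooth_fun A U f)"


subsection \<open>Tangent vectors, vector fields\<close>

text \<open>Tangent vectors at \<open>p\<close> are the derivations on functions that are smooth near \<open>p\<close>. That
  \<open>v f\<close> depends only on the germ of \<open>f\<close> follows from the Leibniz rule: if \<open>f = 0\<close> near \<open>p\<close>, then
  \<open>f = k f\<close> for the function \<open>k\<close> that is \<open>0\<close> near \<open>p\<close> and \<open>1\<close> elsewhere. The value \<open>0\<close> at all
  remaining functions makes equality of tangent vectors the intended one.\<close>

type_synonym 'm tvec = "('m \<Rightarrow> real) \<Rightarrow> real"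

definition tangent_space ::
    "('m::topological_space, 'e::euclidean_space) chart set \<Rightarrow> 'm \<Rightarrow> 'm tvec set" where
  "tangent_space A p = {v.
     (\<forall>f g. smooth_near A p f \<longrightarrow> smooth_near A p g \<longrightarrow>
        v (\<lambda>x. f x + g x) = v f + v g \<and>
        v (\<lambda>x. f x * g x) = f p * v g + g p * v f) \<and>
     (\<forall>f a. smooth_near A p f \<longrightarrow> v (\<lambda>x. a * f x) = a * v f) \<and>
     (\<forall>f. \<not> smooth_near A p f \<longrightarrow> v f = 0)}"

text \<open>The differential at \<open>p\<close> of a smooth map \<open>F\<close> into the manifold with atlas \<open>A'\<close>.\<close>

definition differential ::
    "('n::topological_space, 'f::euclidean_space) chart set \<Rightarrow> ('m \<Rightarrow> 'n) \<Rightarrow> 'm \<Rightarrow> 'm tvec \<Rightarrow> 'n tvec" where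
  "differential A' F p v = (\<lambda>f. if smooth_near A' (F p) f then v (f \<circ> F) else 0)"

text \<open>Smooth vector fields along a map \<open>F\<close>, over an open set \<open>U\<close>.\<close>

definition smooth_along ::
    "('m::topological_space, 'e::euclidean_space) chart set \<Rightarrow> ('n::topological_space, 'f::euclidean_space) chart set
      \<Rightarrow> ('m \<Rightarrow> 'n) \<Rightarrow> 'm set \<Rightarrow> ('m \<Rightarrow> 'n tvec) \<Rightarrow> bool" where
  "smooth_along A A' F U s \<longleftrightarrow> open U \<and> U \<subseteq> points A \<and>
     (\<forall>x\<in>U. s x \<in> tangent_space A' (F x)) \<and>
     (\<forall>W f. smooth_fun A' W f \<longrightarrow> smooth_fun A (U \<inter> F -` W) (\<lambda>x. s x f))"

abbreviation vector_field ::
    "('m::topological_space, 'e::euclidean_space) chart set \<Rightarrow> 'm set \<Rightarrow> ('m \<Rightarrow> 'm tvec) \<Rightarrow> bool" where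
  "vector_field A \<equiv> smooth_along A A (\<lambda>x. x)"

definition lie_bracket ::
    "('m::topological_space, 'e::euclidean_space) chart set \<Rightarrow> ('m \<Rightarrow> 'm tvec) \<Rightarrow> ('m \<Rightarrow> 'm tvec) \<Rightarrow> 'm \<Rightarrow> 'm tvec" where
  "lie_bracket A X Y p =
     (\<lambda>f. if smooth_near A p f then X p (\<lambda>q. Y q f) - Y p (\<lambda>q. X q f) else 0)"


section \<open>Vector bundles, bundle metrics, connections\<close>

text \<open>A vector bundle is given by its fibres, subspaces of a fixed real vector space, and by its
  sheaf of smooth sections: \<open>sec V U s\<close> says that \<open>s\<close> is a smooth section over the open set \<open>U\<close>.\<close>

record ('m, 'v) vbundle =
  fib :: "'m \<Rightarrow> 'v set"
  sec :: "'m set \<Rightarrow> ('m \<Rightarrow> 'v) \<Rightarrow> bool"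

definition vector_bundle ::
    "('m::topological_space, 'e::euclidean_space) chart set \<Rightarrow> nat \<Rightarrow> ('m, 'v::real_vector) vbundle \<Rightarrow> bool" where
  "vector_bundle A r V \<longleftrightarrow>
     (\<forall>x\<in>points A. subspace (fib V x) \<and> dim (fib V x) = r) \<and>
     (\<forall>U s. sec V U s \<longleftrightarrow> open U \<and> U \<subseteq> points A \<and> (\<forall>x\<in>U. \<exists>W. x \<in> W \<and> W \<subseteq> U \<and> sec V W s)) \<and>
     (\<forall>p\<in>points A. \<exists>W e. open W \<and> p \<in> W \<and> W \<subseteq> points A \<and>
        (\<forall>x\<in>W. inj_on (\<lambda>i. e i x) {..<r} \<and> independent ((\<lambda>i. e i x) ` {..<r}) \<and>
               span ((\<lambda>i. e i x) ` {..<r}) = fib V x) \<and>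
        (\<forall>U s. open U \<and> U \<subseteq> W \<longrightarrow>
           (sec V U s \<longleftrightarrow>
             (\<exists>a. (\<forall>i<r. smooth_fun A U (a i)) \<and> (\<forall>x\<in>U. s x = (\<Sum>i<r. a i x *\<^sub>R e i x))))))"

text \<open>\<open>F\<^sup>*(TN)\<close> for a smooth map \<open>F\<close> into the manifold \<open>N\<close> with atlas \<open>A'\<close>.\<close>

definition pullback_tangent_bundle ::
    "('m::topological_space, 'e::euclidean_space) chart set \<Rightarrow> ('n::topological_space, 'f::euclidean_space) chart set
      \<Rightarrow> ('m \<Rightarrow> 'n) \<Rightarrow> ('m, 'n tvec) vbundle" where
  "pullback_tangent_bundle A A' F = \<lparr> fib = (\<lambda>x. tangent_space A' (F x)), sec = smooth_along A A' F \<rparr>"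

abbreviation tangent_bundle ::
    "('m::topological_space, 'e::euclidean_space) chart set \<Rightarrow> ('m, 'm tvec) vbundle" where
  "tangent_bundle A \<equiv> pullback_tangent_bundle A A (\<lambda>x. x)"

text \<open>Signature \<open>(p, q)\<close>: \<open>p\<close> positive and \<open>q\<close> negative directions.\<close>

definition has_signature ::
    "'v::real_vector set \<Rightarrow> ('v \<Rightarrow> 'v \<Rightarrow> real) \<Rightarrow> nat \<Rightarrow> nat \<Rightarrow> bool" where
  "has_signature E h p q \<longleftrightarrow> (\<exists>e::nat \<Rightarrow> 'v.
     (\<forall>i<p+q. e i \<in> E) \<and> span (e ` {..<p+q}) = E \<and>
     (\<forall>i<p+q. \<forall>j<p+q. h (e i) (e j) = (if i \<noteq> j then 0 else if i < p then 1 else -1)))"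

definition bundle_metric ::
    "('m::topological_space, 'e::euclidean_space) chart set \<Rightarrow> ('m, 'v::real_vector) vbundle
      \<Rightarrow> ('m \<Rightarrow> 'v \<Rightarrow> 'v \<Rightarrow> real) \<Rightarrow> nat \<Rightarrow> nat \<Rightarrow> bool" where
  "bundle_metric A V h p q \<longleftrightarrow>
     (\<forall>x\<in>points A.
        (\<forall>u\<in>fib V x. \<forall>v\<in>fib V x. h x u v = h x v u) \<and>
        (\<forall>u\<in>fib V x. \<forall>v\<in>fib V x. \<forall>w\<in>fib V x. \<forall>a. h x (a *\<^sub>R u + v) w = a * h x u w + h x v w) \<and>
        has_signature (fib V x) (h x) p q) \<and>
     (\<forall>U s t. sec V U s \<longrightarrow> sec V U t \<longrightarrow> smooth_fun A U (\<lambda>x. h x (s x) (t x)))"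

text \<open>A linear connection assigns to \<open>x\<close>, a tangent vector \<open>v\<close> at \<open>x\<close> and a section \<open>s\<close> that is
  smooth near \<open>x\<close> the covariant derivative \<open>D x v s\<close>, an element of the fibre at \<open>x\<close>; thus
  \<open>\<nabla>\<^sub>X s\<close> is \<open>cov D X s\<close>. By the Leibniz rule \<open>D x v s\<close> depends only on the germ of \<open>s\<close> at \<open>x\<close>.\<close>

type_synonym ('m, 'v) conn = "'m \<Rightarrow> 'm tvec \<Rightarrow> ('m \<Rightarrow> 'v) \<Rightarrow> 'v"

definition cov :: "('m, 'v) conn \<Rightarrow> ('m \<Rightarrow> 'm tvec) \<Rightarrow> ('m \<Rightarrow> 'v) \<Rightarrow> 'm \<Rightarrow> 'v" where
  "cov D X s = (\<lambda>x. D x (X x) s)"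

definition connection ::
    "('m::topological_space, 'e::euclidean_space) chart set \<Rightarrow> ('m, 'v::real_vector) vbundle \<Rightarrow> ('m, 'v) conn \<Rightarrow> bool" where
  "connection A V D \<longleftrightarrow>
     (\<forall>U s t. sec V U s \<longrightarrow> sec V U t \<longrightarrow>
        (\<forall>x\<in>U. \<forall>v\<in>tangent_space A x. \<forall>w\<in>tangent_space A x. \<forall>a f.
           D x v s \<in> fib V x \<and>
           D x (a *\<^sub>R v + w) s = a *\<^sub>R D x v s + D x w s \<and>
           D x v (\<lambda>y. s y + t y) = D x v s + D x v t \<and>
           (smooth_fun A U f \<longrightarrow> D x v (\<lambda>y. f y *\<^sub>R s y) = f x *\<^sub>R D x v s + v f *\<^sub>R s x)) \<and>
        (\<forall>X. vector_field A U X \<longrightarrow> sec V U (cov D X s)))"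

definition metric_connection ::
    "('m::topological_space, 'e::euclidean_space) chart set \<Rightarrow> ('m, 'v::real_vector) vbundle
      \<Rightarrow> ('m \<Rightarrow> 'v \<Rightarrow> 'v \<Rightarrow> real) \<Rightarrow> ('m, 'v) conn \<Rightarrow> bool" where
  "metric_connection A V h D \<longleftrightarrow> connection A V D \<and>
     (\<forall>U s t. sec V U s \<longrightarrow> sec V U t \<longrightarrow>
        (\<forall>x\<in>U. \<forall>v\<in>tangent_space A x.
           v (\<lambda>y. h y (s y) (t y)) = h x (D x v s) (t x) + h x (s x) (D x v t)))"

definition curvature ::
    "('m::topological_space, 'e::euclidean_space) chart set \<Rightarrow> ('m, 'v::real_vector) conn
      \<Rightarrow> ('m \<Rightarrow> 'm tvec) \<Rightarrow> ('m \<Rightarrow> 'm tvec) \<Rightarrow> ('m \<Rightarrow> 'v) \<Rightarrow> 'm \<Rightarrow> 'v" where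
  "curvature A D X Y s =
     cov D X (cov D Y s) - cov D Y (cov D X s) - cov D (lie_bracket A X Y) s"


section \<open>Semi-Riemannian geometry\<close>

definition riemannian_metric ::
    "('m::topological_space, 'e::euclidean_space) chart set \<Rightarrow> ('m \<Rightarrow> 'm tvec \<Rightarrow> 'm tvec \<Rightarrow> real) \<Rightarrow> bool" where
  "riemannian_metric A g \<longleftrightarrow> bundle_metric A (tangent_bundle A) g DIM('e) 0"

definition lorentzian_metric ::
    "('m::topological_space, 'e::euclidean_space) chart set \<Rightarrow> ('m \<Rightarrow> 'm tvec \<Rightarrow> 'm tvec \<Rightarrow> real) \<Rightarrow> bool" where
  "lorentzian_metric A g \<longleftrightarrow> bundle_metric A (tangent_bundle A) g (DIM('e) - 1) 1"

definition lightlike_field ::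
    "('m::topological_space, 'e::euclidean_space) chart set \<Rightarrow> ('m \<Rightarrow> 'm tvec \<Rightarrow> 'm tvec \<Rightarrow> real)
      \<Rightarrow> ('m \<Rightarrow> 'm tvec) \<Rightarrow> bool" where
  "lightlike_field A g X \<longleftrightarrow> vector_field A (points A) X \<and>
     (\<forall>x\<in>points A. X x \<noteq> 0 \<and> g x (X x) (X x) = 0)"

definition levi_civita ::
    "('m::topological_space, 'e::euclidean_space) chart set \<Rightarrow> ('m \<Rightarrow> 'm tvec \<Rightarrow> 'm tvec \<Rightarrow> real)
      \<Rightarrow> ('m, 'm tvec) conn \<Rightarrow> bool" where
  "levi_civita A g D \<longleftrightarrow> metric_connection A (tangent_bundle A) g D \<and>
     (\<forall>U X Y. vector_field A U X \<longrightarrow> vector_field A U Y \<longrightarrow>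
        (\<forall>x\<in>U. cov D X Y x - cov D Y X x = lie_bracket A X Y x))"

definition gradient ::
    "('m::topological_space, 'e::euclidean_space) chart set \<Rightarrow> ('m \<Rightarrow> 'm tvec \<Rightarrow> 'm tvec \<Rightarrow> real)
      \<Rightarrow> ('m \<Rightarrow> real) \<Rightarrow> 'm \<Rightarrow> 'm tvec" where
  "gradient A g f x = (THE v. v \<in> tangent_space A x \<and> (\<forall>w\<in>tangent_space A x. g x v w = w f))"

definition orthonormal_frame ::
    "('m::topological_space, 'e::euclidean_space) chart set \<Rightarrow> ('m \<Rightarrow> 'm tvec \<Rightarrow> 'm tvec \<Rightarrow> real)
      \<Rightarrow> 'm set \<Rightarrow> (nat \<Rightarrow> 'm \<Rightarrow> 'm tvec) \<Rightarrow> bool" where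
  "orthonormal_frame A g U E \<longleftrightarrow>
     (\<forall>i<DIM('e). vector_field A U (E i)) \<and>
     (\<forall>x\<in>U. \<forall>i<DIM('e). \<forall>j<DIM('e). g x (E i x) (E j x) = (if i = j then 1 else 0))"

definition frame_near ::
    "('m::topological_space, 'e::euclidean_space) chart set \<Rightarrow> ('m \<Rightarrow> 'm tvec \<Rightarrow> 'm tvec \<Rightarrow> real)
      \<Rightarrow> 'm \<Rightarrow> nat \<Rightarrow> 'm \<Rightarrow> 'm tvec" where
  "frame_near A g x = (SOME E. \<exists>U. x \<in> U \<and> orthonormal_frame A g U E)"

text \<open>\<open>D\<close> is the Levi-Civita connection of \<open>g\<close>.\<close>

definition ricci ::
    "('m::topological_space, 'e::euclidean_space) chart set \<Rightarrow> ('m \<Rightarrow> 'm tvec \<Rightarrow> 'm tvec \<Rightarrow> real)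
      \<Rightarrow> ('m, 'm tvec) conn \<Rightarrow> ('m \<Rightarrow> 'm tvec) \<Rightarrow> ('m \<Rightarrow> 'm tvec) \<Rightarrow> 'm \<Rightarrow> real" where
  "ricci A g D X Y x = (let E = frame_near A g x in
     \<Sum>i<DIM('e). g x (curvature A D (E i) X Y x) (E i x))"

definition einstein ::
    "('m::topological_space, 'e::euclidean_space) chart set \<Rightarrow> ('m \<Rightarrow> 'm tvec \<Rightarrow> 'm tvec \<Rightarrow> real)
      \<Rightarrow> ('m, 'm tvec) conn \<Rightarrow> real \<Rightarrow> bool" where
  "einstein A g D \<Lambda> \<longleftrightarrow>
     (\<forall>X Y. vector_field A (points A) X \<longrightarrow> vector_field A (points A) Y \<longrightarrow>
        (\<forall>x\<in>points A. ricci A g D X Y x = \<Lambda> * g x (X x) (Y x)))"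


subsection \<open>Geometry along a map \<open>F\<close> between manifolds\<close>

definition pullback_metric ::
    "('n::topological_space, 'f::euclidean_space) chart set \<Rightarrow> ('m \<Rightarrow> 'n)
      \<Rightarrow> ('n \<Rightarrow> 'n tvec \<Rightarrow> 'n tvec \<Rightarrow> real) \<Rightarrow> 'm \<Rightarrow> 'm tvec \<Rightarrow> 'm tvec \<Rightarrow> real" where
  "pullback_metric A' F g' x u v = g' (F x) (differential A' F x u) (differential A' F x v)"

text \<open>The pull-back \<open>D\<close> of a connection \<open>D'\<close> on \<open>TN\<close> is the connection on \<open>F\<^sup>*(TN)\<close> with
  \<open>D\<^sub>v (Z \<circ> F) = D'\<close> of \<open>Z\<close> in the direction \<open>dF(v)\<close>.\<close>

definition pullback_connection ::
    "('m::topological_space, 'e::euclidean_space) chart set \<Rightarrow> ('n::topological_space, 'f::euclidean_space) chart set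
      \<Rightarrow> ('m \<Rightarrow> 'n) \<Rightarrow> ('n, 'n tvec) conn \<Rightarrow> ('m, 'n tvec) conn \<Rightarrow> bool" where
  "pullback_connection A A' F D' D \<longleftrightarrow> connection A (pullback_tangent_bundle A A' F) D \<and>
     (\<forall>W Z. vector_field A' W Z \<longrightarrow>
        (\<forall>x\<in>points A. F x \<in> W \<longrightarrow>
           (\<forall>v\<in>tangent_space A x. D x v (Z \<circ> F) = D' (F x) (differential A' F x v) Z)))"

text \<open>Second fundamental form and mean curvature of an immersion \<open>F\<close>, where \<open>D\<close> is the pull-back
  of the ambient Levi-Civita connection and \<open>\<nabla>\<close> (argument \<open>D0\<close>) is the Levi-Civita connection
  of the induced metric.\<close>

definition second_fundamental_form ::
    "('n::topological_space, 'f::euclidean_space) chart set \<Rightarrow> ('m \<Rightarrow> 'n) \<Rightarrow> ('m, 'm tvec) conn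
      \<Rightarrow> ('m, 'n tvec) conn \<Rightarrow> ('m \<Rightarrow> 'm tvec) \<Rightarrow> ('m \<Rightarrow> 'm tvec) \<Rightarrow> 'm \<Rightarrow> 'n tvec" where
  "second_fundamental_form A' F D0 D X Y x =
     cov D X (\<lambda>y. differential A' F y (Y y)) x - differential A' F x (cov D0 X Y x)"

definition mean_curvature ::
    "('m::topological_space, 'e::euclidean_space) chart set \<Rightarrow> ('n::topological_space, 'f::euclidean_space) chart set
      \<Rightarrow> ('n \<Rightarrow> 'n tvec \<Rightarrow> 'n tvec \<Rightarrow> real) \<Rightarrow> ('m \<Rightarrow> 'n) \<Rightarrow> ('m, 'm tvec) conn
      \<Rightarrow> ('m, 'n tvec) conn \<Rightarrow> 'm \<Rightarrow> 'n tvec" where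
  "mean_curvature A A' g' F D0 D x = (let E = frame_near A (pullback_metric A' F g') x in
     (1 / real DIM('e)) *\<^sub>R (\<Sum>i<DIM('e). second_fundamental_form A' F D0 D (E i) (E i) x))"


subsection \<open>Warped products\<close>

definition warped_metric ::
    "('b::topological_space, 'f::euclidean_space) chart set \<Rightarrow> ('m::topological_space, 'e::euclidean_space) chart set
      \<Rightarrow> ('b \<Rightarrow> 'b tvec \<Rightarrow> 'b tvec \<Rightarrow> real) \<Rightarrow> ('b \<Rightarrow> real) \<Rightarrow> ('m \<Rightarrow> 'm tvec \<Rightarrow> 'm tvec \<Rightarrow> real)
      \<Rightarrow> 'b \<times> 'm \<Rightarrow> ('b \<times> 'm) tvec \<Rightarrow> ('b \<times> 'm) tvec \<Rightarrow> real" where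
  "warped_metric AB A gB \<phi> g z u v =
     pullback_metric AB fst gB z u v + (\<phi> (fst z))\<^sup>2 * pullback_metric A snd g z u v"

text \<open>The lift to \<open>B \<times> M\<close> of a vector field on \<open>B\<close>; the first argument is the atlas of \<open>B \<times> M\<close>.\<close>

definition lift_field ::
    "('b::topological_space \<times> 'm::topological_space, 'e::euclidean_space) chart set
      \<Rightarrow> ('b \<Rightarrow> 'b tvec) \<Rightarrow> 'b \<times> 'm \<Rightarrow> ('b \<times> 'm) tvec" where
  "lift_field A' X z = differential A' (\<lambda>b. (b, snd z)) (fst z) (X (fst z))"


section \<open>Tractor bundles\<close>

text \<open>Throughout, \<open>V\<close> is the tractor bundle, \<open>h\<close> its metric, \<open>L\<close> the fibres of the
  distinguished line subbundle, and \<open>D\<close> the tractor connection.\<close>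

definition nonvanishing_section ::
    "('m, 'v::real_vector) vbundle \<Rightarrow> ('m \<Rightarrow> 'v set) \<Rightarrow> 'm set \<Rightarrow> ('m \<Rightarrow> 'v) \<Rightarrow> bool" where
  "nonvanishing_section V L U \<sigma> \<longleftrightarrow> sec V U \<sigma> \<and> (\<forall>x\<in>U. \<sigma> x \<in> L x \<and> \<sigma> x \<noteq> 0)"

definition lightlike_line_subbundle ::
    "('m::topological_space, 'e::euclidean_space) chart set \<Rightarrow> ('m, 'v::real_vector) vbundle
      \<Rightarrow> ('m \<Rightarrow> 'v \<Rightarrow> 'v \<Rightarrow> real) \<Rightarrow> ('m \<Rightarrow> 'v set) \<Rightarrow> bool" where
  "lightlike_line_subbundle A V h L \<longleftrightarrow>
     (\<forall>x\<in>points A. subspace (L x) \<and> dim (L x) = 1 \<and> L x \<subseteq> fib V x \<and> (\<forall>u\<in>L x. h x u u = 0)) \<and>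
     (\<forall>p\<in>points A. \<exists>U \<sigma>. p \<in> U \<and> nonvanishing_section V L U \<sigma>)"

definition tractor_conformal_bundle ::
    "('m::topological_space, 'e::euclidean_space) chart set \<Rightarrow> ('m, 'v::real_vector) vbundle
      \<Rightarrow> ('m \<Rightarrow> 'v set) \<Rightarrow> ('m \<Rightarrow> 'v \<Rightarrow> 'v \<Rightarrow> real) \<Rightarrow> bool" where
  "tractor_conformal_bundle A V L h \<longleftrightarrow>
     vector_bundle A (DIM('e) + 2) V \<and> bundle_metric A V h (DIM('e) + 1) 1 \<and>
     lightlike_line_subbundle A V h L"

definition perp :: "('m, 'v) vbundle \<Rightarrow> ('m \<Rightarrow> 'v \<Rightarrow> 'v \<Rightarrow> real) \<Rightarrow> ('m \<Rightarrow> 'v set) \<Rightarrow> 'm \<Rightarrow> 'v set" where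
  "perp V h L x = {u \<in> fib V x. \<forall>l\<in>L x. h x u l = 0}"

definition coset :: "'v::plus set \<Rightarrow> 'v \<Rightarrow> 'v set" where
  "coset K u = (\<lambda>k. u + k) ` K"

text \<open>\<open>\<beta>\<^sub>\<sigma>\<close>, with values in the fibre \<open>coset (L x) ` perp V h L x\<close> of the quotient bundle.\<close>

definition beta :: "('m \<Rightarrow> 'v::plus set) \<Rightarrow> ('m, 'v) conn \<Rightarrow> ('m \<Rightarrow> 'v) \<Rightarrow> 'm \<Rightarrow> 'm tvec \<Rightarrow> 'v set" where
  "beta L D \<sigma> x v = coset (L x) (D x v \<sigma>)"

text \<open>Since \<open>\<beta>\<^sub>\<sigma>\<close> is induced by a connection, it is automatically smooth and linear in the fibres,
  and hence a bundle isomorphism as soon as it is fibrewise bijective.\<close>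

definition tractor_connection ::
    "('m::topological_space, 'e::euclidean_space) chart set \<Rightarrow> ('m, 'v::real_vector) vbundle
      \<Rightarrow> ('m \<Rightarrow> 'v set) \<Rightarrow> ('m \<Rightarrow> 'v \<Rightarrow> 'v \<Rightarrow> real) \<Rightarrow> ('m, 'v) conn \<Rightarrow> bool" where
  "tractor_connection A V L h D \<longleftrightarrow> metric_connection A V h D \<and>
     (\<forall>U \<sigma>. nonvanishing_section V L U \<sigma> \<longrightarrow>
        (\<forall>x\<in>U. bij_betw (beta L D \<sigma> x) (tangent_space A x) (coset (L x) ` perp V h L x)))"

text \<open>The metric \<open>h\<^sup>\<sigma>\<close>. The form induced by \<open>h\<close> on the quotient of the orthogonal complement of
  the lightlike line is evaluated on the representatives \<open>D\<^sub>v \<sigma>\<close> of \<open>\<beta>\<^sub>\<sigma>(v)\<close>.\<close>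

definition sigma_metric ::
    "('m \<Rightarrow> 'v \<Rightarrow> 'v \<Rightarrow> real) \<Rightarrow> ('m, 'v) conn \<Rightarrow> ('m \<Rightarrow> 'v) \<Rightarrow> 'm \<Rightarrow> 'm tvec \<Rightarrow> 'm tvec \<Rightarrow> real" where
  "sigma_metric h D \<sigma> x u v = h x (D x u \<sigma>) (D x v \<sigma>)"

definition conformal_on ::
    "('m::topological_space, 'e::euclidean_space) chart set \<Rightarrow> 'm set \<Rightarrow> ('m \<Rightarrow> 'm tvec \<Rightarrow> 'm tvec \<Rightarrow> real)
      \<Rightarrow> ('m \<Rightarrow> 'm tvec \<Rightarrow> 'm tvec \<Rightarrow> real) \<Rightarrow> bool" where
  "conformal_on A U g1 g2 \<longleftrightarrow> (\<exists>f. smooth_fun A U f \<and> (\<forall>x\<in>U. f x > 0 \<and>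
     (\<forall>u\<in>tangent_space A x. \<forall>v\<in>tangent_space A x. g1 x u v = f x * g2 x u v)))"

definition standard_tractor ::
    "('m::topological_space, 'e::euclidean_space) chart set \<Rightarrow> ('m, 'v::real_vector) vbundle
      \<Rightarrow> ('m \<Rightarrow> 'v set) \<Rightarrow> ('m \<Rightarrow> 'v \<Rightarrow> 'v \<Rightarrow> real) \<Rightarrow> ('m, 'v) conn
      \<Rightarrow> ('m \<Rightarrow> 'm tvec \<Rightarrow> 'm tvec \<Rightarrow> real) \<Rightarrow> bool" where
  "standard_tractor A V L h D g \<longleftrightarrow>
     tractor_conformal_bundle A V L h \<and> tractor_connection A V L h D \<and>
     (\<forall>U \<sigma>. nonvanishing_section V L U \<sigma> \<longrightarrow> conformal_on A U (sigma_metric h D \<sigma>) g)"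

text \<open>In the trace condition \<open>\<beta>\<^sub>\<sigma>(Y)\<close> and \<open>\<beta>\<^sub>\<sigma>(E\<^sub>i)\<close> are again replaced by their representatives;
  by the first condition and \<open>\<nabla>h = 0\<close> this does not affect the value.\<close>

definition normal_tractor ::
    "('m::topological_space, 'e::euclidean_space) chart set \<Rightarrow> ('m, 'v::real_vector) vbundle
      \<Rightarrow> ('m \<Rightarrow> 'v set) \<Rightarrow> ('m \<Rightarrow> 'v \<Rightarrow> 'v \<Rightarrow> real) \<Rightarrow> ('m, 'v) conn \<Rightarrow> bool" where
  "normal_tractor A V L h D \<longleftrightarrow>
     (\<forall>X Y. vector_field A (points A) X \<longrightarrow> vector_field A (points A) Y \<longrightarrow>
        (\<forall>\<sigma>. sec V (points A) \<sigma> \<longrightarrow> (\<forall>x\<in>points A. \<sigma> x \<in> L x) \<longrightarrow>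
           (\<forall>x\<in>points A. curvature A D X Y \<sigma> x \<in> L x)) \<and>
        (\<forall>U \<sigma> E. nonvanishing_section V L U \<sigma> \<longrightarrow>
           orthonormal_frame A (sigma_metric h D \<sigma>) U E \<longrightarrow>
           (\<forall>x\<in>U. (\<Sum>i<DIM('e). h x (curvature A D (E i) X (cov D Y \<sigma>) x) (D x (E i x) \<sigma>)) = 0)))"

end

theory Submission
  imports Defs
begin

text \<open>The slice \<open>{b0} \<times> M\<close> with \<open>b0 = (\<rho>0, s0)\<close> and \<open>\<phi> b0 = 1\<close> is a totally umbilical submanifold of the
  warped product, and everything follows from its Gauss and Weingarten formulas. Write \<open>lam\<close> and \<open>mu\<close>
  for the derivatives of \<open>\<phi>\<close> at \<open>b0\<close> along \<open>\<xi>\<close> and \<open>\<eta>\<close>, and \<open>J\<close> for the differential of the slice. The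
  Koszul formula on the product, evaluated on lifts of fields from the two factors, gives
  \<open>D\<^sub>X \<xi> = lam J X\<close>, \<open>D\<^sub>X \<eta> = mu J X\<close> and \<open>D\<^sub>X (J Y) = J (\<nabla>\<^sub>X Y) + g(X, Y) \<nu>\<close> with \<open>\<nu> = mu \<xi> + lam \<eta>\<close>.
  In particular \<open>\<nu>\<close> is the mean curvature vector and \<open>\<parallel>\<nu>\<parallel>\<^sup>2 = - 2 lam mu\<close>, because \<open>\<xi>\<close> and \<open>\<eta>\<close> are null
  with product \<open>-1\<close>; for the same reason the gradient of \<open>\<phi>\<close> at \<open>b0\<close> is \<open>- \<nu>\<close>.

  For \<open>\<sigma> = f \<xi>\<close> the derivative \<open>D\<^sub>X \<sigma>\<close> equals \<open>f lam J X\<close> modulo \<open>\<xi>\<close>. Since \<open>lam \<noteq> 0\<close>, this shows that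
  \<open>\<beta>\<^sub>\<sigma>\<close> is an isomorphism and that the metric of \<open>\<sigma>\<close> is \<open>(f lam)\<^sup>2 g\<close>, so the tractor bundle is standard
  (lemma \<open>standard\<close>).

  Differentiating once more, the section \<open>\<xi>\<close> is flat, which is the first normality condition, and
  \<open>R\<^sup>D(X, Y) (J Z) = J (R(X, Y) Z + 2 lam mu (g(Y, Z) X - g(X, Z) Y))\<close>. The trace in the second normality
  condition therefore is \<open>Ric(X, Y) + 2 lam mu (n - 1) g(X, Y)\<close> (lemma \<open>trace_formula\<close>), and it vanishes
  exactly when \<open>Ric = (n - 1) \<parallel>\<nu>\<parallel>\<^sup>2 g\<close>.

  Tangent vectors being derivations, the geometry rests on three facts about smooth functions:
  Hadamard's lemma identifies tangent vectors with combinations of coordinate vectors, which also splits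
  the tangent spaces of a product; Gram--Schmidt provides the local orthonormal frames in which Ricci
  and mean curvature are computed; and bump functions provide the global vector field that determines
  the Einstein constant.\<close>

section \<open>Calculus of smooth functions on open sets\<close>

lemma Ck_on_imp_eq:
  assumes "open S" "Ck_on k S f" "\<And>x. x \<in> S \<Longrightarrow> f x = g x"
  shows "Ck_on k S g"
  using assms
proof (induction k arbitrary: f g)
  case 0
  then show ?case by (simp cong: continuous_on_cong)
next
  case (Suc k)
  have d: "g differentiable at x" "frechet_derivative f (at x) = frechet_derivative g (at x)"
    if "x \<in> S" for x
  proof -
    have f: "f differentiable at x" using Suc.prems that by simp
    show "g differentiable at x"
      using f Suc.prems that
      by (meson differentiable_def has_derivative_transform_within_open)
    show "frechet_derivative f (at x) = frechet_derivative g (at x)"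
      by (rule frechet_derivative_transform_within_open[OF f Suc.prems(1) that]) (use Suc.prems in auto)
  qed
  have "Ck_on k S (\<lambda>x. frechet_derivative g (at x) v)" for v
    by (rule Suc.IH[OF Suc.prems(1), of "\<lambda>x. frechet_derivative f (at x) v"])
      (use Suc.prems d in auto)
  then show ?case using d by simp
qed

lemma Ck_on_SucI:
  assumes "open S" "\<And>x. x \<in> S \<Longrightarrow> (f has_derivative f' x) (at x)" "\<And>v. Ck_on k S (\<lambda>x. f' x v)"
  shows "Ck_on (Suc k) S f"
proof -
  have "f' x = frechet_derivative f (at x)" if "x \<in> S" for x
    using assms(2)[OF that] by (rule frechet_derivative_at)
  then have "Ck_on k S (\<lambda>x. frechet_derivative f (at x) v)" for v
    using Ck_on_imp_eq[OF assms(1) assms(3)[of v]] by auto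
  then show ?thesis using assms(2) by (auto simp: differentiable_def)
qed

lemma Ck_on_SucD: "Ck_on (Suc k) S f \<Longrightarrow> Ck_on k S f"
proof (induction k arbitrary: f)
  case 0
  then show ?case
    by (auto intro!: continuous_at_imp_continuous_on differentiable_imp_continuous_within)
next
  case (Suc k)
  show ?case
    unfolding Ck_on.simps(2)[of k]
    using Suc.prems Suc.IH by (auto simp del: Ck_on.simps simp: Ck_on.simps(2)[of "Suc k"])
qed

lemma Ck_on_deriv:
  assumes "Ck_on (Suc k) S f" "x \<in> S"
  shows "(f has_derivative frechet_derivative f (at x)) (at x)"
  using assms by (simp add: frechet_derivative_works)

lemma Ck_on_subset: "Ck_on k S f \<Longrightarrow> T \<subseteq> S \<Longrightarrow> Ck_on k T f"
  by (induction k arbitrary: f) (auto intro: continuous_on_subset)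

lemma Ck_on_local:
  assumes "\<And>x. x \<in> S \<Longrightarrow> \<exists>T. open T \<and> x \<in> T \<and> T \<subseteq> S \<and> Ck_on k T f"
  shows "Ck_on k S f"
  using assms
proof (induction k arbitrary: f)
  case 0
  have "continuous_on S f"
  proof (rule continuous_at_imp_continuous_on, rule ballI)
    fix x assume "x \<in> S"
    from 0[OF this] obtain T where "open T" "x \<in> T" "continuous_on T f" by auto
    then show "isCont f x" by (simp add: continuous_on_eq_continuous_at)
  qed
  then show ?case by simp
next
  case (Suc k)
  have "Ck_on k S (\<lambda>x. frechet_derivative f (at x) v)" for v
  proof (rule Suc.IH)
    fix x assume "x \<in> S"
    from Suc.prems[OF this]
    show "\<exists>T. open T \<and> x \<in> T \<and> T \<subseteq> S \<and> Ck_on k T (\<lambda>x. frechet_derivative f (at x) v)" by auto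
  qed
  moreover have "f differentiable at x" if "x \<in> S" for x
    using Suc.prems[OF that] by auto
  ultimately show ?case by simp
qed

lemma Ck_on_const: "open S \<Longrightarrow> Ck_on k S (\<lambda>x. c)"
proof (induction k arbitrary: c)
  case (Suc k)
  then show ?case by (intro Ck_on_SucI[where f' = "\<lambda>x v. 0"]) auto
qed auto

lemma Ck_on_bounded_linear:
  assumes "bounded_linear L" "open S" "Ck_on k S f"
  shows "Ck_on k S (\<lambda>x. L (f x))"
  using assms(3)
proof (induction k arbitrary: f)
  case 0
  then show ?case using bounded_linear.continuous_on[OF assms(1)] by auto
next
  case (Suc k)
  show ?case
  proof (rule Ck_on_SucI[OF assms(2)])
    show "((\<lambda>x. L (f x)) has_derivative (\<lambda>v. L (frechet_derivative f (at x) v))) (at x)" if "x \<in> S" for x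
      by (rule bounded_linear.has_derivative[OF assms(1) Ck_on_deriv[OF Suc.prems that]])
    show "Ck_on k S (\<lambda>x. L (frechet_derivative f (at x) v))" for v
      using Suc by auto
  qed
qed

lemma Ck_on_linear: "bounded_linear L \<Longrightarrow> open S \<Longrightarrow> Ck_on k S L"
proof (cases k)
  case 0
  then show "bounded_linear L \<Longrightarrow> open S \<Longrightarrow> Ck_on k S L"
    using linear_continuous_on by auto
next
  case (Suc l)
  then show "bounded_linear L \<Longrightarrow> open S \<Longrightarrow> Ck_on k S L"
    using Ck_on_SucI[of S L "\<lambda>x. L" l] by (auto simp: bounded_linear_imp_has_derivative Ck_on_const)
qed

lemma Ck_on_add:
  assumes "open S" "Ck_on k S f" "Ck_on k S g"
  shows "Ck_on k S (\<lambda>x. f x + g x)"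
  using assms(2,3)
proof (induction k arbitrary: f g)
  case 0
  then show ?case by (auto intro: continuous_intros)
next
  case (Suc k)
  show ?case
  proof (rule Ck_on_SucI[OF assms(1)])
    show "((\<lambda>x. f x + g x) has_derivative
        (\<lambda>v. frechet_derivative f (at x) v + frechet_derivative g (at x) v)) (at x)" if "x \<in> S" for x
      by (intro has_derivative_add Ck_on_deriv[OF Suc.prems(1) that] Ck_on_deriv[OF Suc.prems(2) that])
    show "Ck_on k S (\<lambda>x. frechet_derivative f (at x) v + frechet_derivative g (at x) v)" for v
      using Suc by auto
  qed
qed

lemma Ck_on_sum:
  assumes "open S" "\<And>i. i \<in> I \<Longrightarrow> Ck_on k S (f i)"
  shows "Ck_on k S (\<lambda>x. \<Sum>i\<in>I. f i x)"
  using assms(2)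
  by (induction I rule: infinite_finite_induct) (auto intro: Ck_on_const Ck_on_add assms(1))

lemma Ck_on_scaleR:
  fixes a :: "'a::real_normed_vector \<Rightarrow> real"
  assumes "open S" "Ck_on k S a" "Ck_on k S f"
  shows "Ck_on k S (\<lambda>x. a x *\<^sub>R f x)"
  using assms(2,3)
proof (induction k arbitrary: a f)
  case 0
  then show ?case by (auto intro: continuous_intros)
next
  case (Suc k)
  show ?case
  proof (rule Ck_on_SucI[OF assms(1)])
    show "((\<lambda>x. a x *\<^sub>R f x) has_derivative
        (\<lambda>v. a x *\<^sub>R frechet_derivative f (at x) v + frechet_derivative a (at x) v *\<^sub>R f x)) (at x)"
      if "x \<in> S" for x
      by (intro has_derivative_scaleR Ck_on_deriv[OF Suc.prems(1) that] Ck_on_deriv[OF Suc.prems(2) that])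
    show "Ck_on k S (\<lambda>x. a x *\<^sub>R frechet_derivative f (at x) v + frechet_derivative a (at x) v *\<^sub>R f x)" for v
      by (intro Ck_on_add assms(1) Suc.IH) (use Suc.prems Ck_on_SucD in auto)
  qed
qed

text \<open>The chain rule is written out on the basis, so that it exhibits each directional derivative of
  \<open>g \<circ> f\<close> as a sum of products to which the induction hypothesis applies.\<close>

lemma Ck_on_compose:
  fixes f :: "'a::real_normed_vector \<Rightarrow> 'b::euclidean_space"
  assumes "open S" "f ` S \<subseteq> T" "Ck_on k S f" "Ck_on k T g"
  shows "Ck_on k S (\<lambda>x. g (f x))"
  using assms(3,4)
proof (induction k arbitrary: g)
  case 0
  then show ?case using continuous_on_compose2 assms(2) by auto
next
  case (Suc k)
  let ?D = "\<lambda>x v. \<Sum>b\<in>Basis. (frechet_derivative f (at x) v \<bullet> b) *\<^sub>R frechet_derivative g (at (f x)) b"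
  show ?case
  proof (rule Ck_on_SucI[OF assms(1)])
    fix x assume x: "x \<in> S"
    then have fx: "f x \<in> T" using assms(2) by auto
    have "linear (frechet_derivative g (at (f x)))"
      using Suc.prems(2) fx by (simp add: linear_frechet_derivative)
    then have "frechet_derivative g (at (f x)) w = (\<Sum>b\<in>Basis. (w \<bullet> b) *\<^sub>R frechet_derivative g (at (f x)) b)" for w
      by (subst (1) euclidean_representation[symmetric]) (simp only: linear_sum linear_scale)
    then have eq: "?D x = (\<lambda>v. frechet_derivative g (at (f x)) (frechet_derivative f (at x) v))"
      by (intro ext) (rule sym)
    show "((\<lambda>x. g (f x)) has_derivative ?D x) (at x)"
      unfolding eq
      by (rule has_derivative_compose[OF Ck_on_deriv[OF Suc.prems(1) x]
            Ck_on_deriv[OF Suc.prems(2) fx]])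
  next
    fix v
    show "Ck_on k S (\<lambda>x. ?D x v)"
    proof (intro Ck_on_sum Ck_on_scaleR assms(1))
      fix b :: 'b
      show "Ck_on k S (\<lambda>x. frechet_derivative f (at x) v \<bullet> b)"
        using Suc.prems by (intro Ck_on_bounded_linear[OF bounded_linear_inner_left assms(1)]) auto
      show "Ck_on k S (\<lambda>x. frechet_derivative g (at (f x)) b)"
        by (rule Suc.IH[OF Ck_on_SucD[OF Suc.prems(1)]]) (use Suc.prems in auto)
    qed
  qed
qed

lemma smooth_onD: "smooth_on S f \<Longrightarrow> Ck_on k S f"
  by (simp add: smooth_on_def)

lemma smooth_on_continuous: "smooth_on S f \<Longrightarrow> continuous_on S f"
  using smooth_onD[of S f 0] by simp

lemma smooth_on_has_derivative:
  "smooth_on S f \<Longrightarrow> x \<in> S \<Longrightarrow> (f has_derivative frechet_derivative f (at x)) (at x)"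
  by (rule Ck_on_deriv[OF smooth_onD[of S f "Suc 0"]])

lemma smooth_on_frechet: "smooth_on S f \<Longrightarrow> smooth_on S (\<lambda>x. frechet_derivative f (at x) v)"
proof -
  assume "smooth_on S f"
  then have "Ck_on (Suc k) S f" for k by (rule smooth_onD)
  then show ?thesis by (simp add: smooth_on_def)
qed

lemma smooth_on_imp_eq:
  assumes "smooth_on S f" "open S" "\<And>x. x \<in> S \<Longrightarrow> f x = g x"
  shows "smooth_on S g"
  unfolding smooth_on_def
  by (intro allI, rule Ck_on_imp_eq[OF assms(2) smooth_onD[OF assms(1)] assms(3)])

lemma smooth_on_subset: "smooth_on S f \<Longrightarrow> T \<subseteq> S \<Longrightarrow> smooth_on T f"
  unfolding smooth_on_def by (intro allI, rule Ck_on_subset, rule spec)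

lemma smooth_on_local:
  assumes "\<And>x. x \<in> S \<Longrightarrow> \<exists>T. open T \<and> x \<in> T \<and> T \<subseteq> S \<and> smooth_on T f"
  shows "smooth_on S f"
  unfolding smooth_on_def
proof (intro allI Ck_on_local)
  fix k x assume "x \<in> S"
  from assms[OF this] show "\<exists>T. open T \<and> x \<in> T \<and> T \<subseteq> S \<and> Ck_on k T f"
    using smooth_onD by meson
qed

lemma smooth_on_const: "open S \<Longrightarrow> smooth_on S (\<lambda>x. c)"
  by (simp add: smooth_on_def Ck_on_const)

lemma smooth_on_linear: "bounded_linear L \<Longrightarrow> open S \<Longrightarrow> smooth_on S L"
  by (simp add: smooth_on_def Ck_on_linear)

lemma smooth_on_bounded_linear:
  "bounded_linear L \<Longrightarrow> open S \<Longrightarrow> smooth_on S f \<Longrightarrow> smooth_on S (\<lambda>x. L (f x))"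
  by (simp add: smooth_on_def Ck_on_bounded_linear)

lemma smooth_on_add: "open S \<Longrightarrow> smooth_on S f \<Longrightarrow> smooth_on S g \<Longrightarrow> smooth_on S (\<lambda>x. f x + g x)"
  by (simp add: smooth_on_def Ck_on_add)

lemma smooth_on_scaleR:
  fixes a :: "'a::real_normed_vector \<Rightarrow> real"
  shows "open S \<Longrightarrow> smooth_on S a \<Longrightarrow> smooth_on S f \<Longrightarrow> smooth_on S (\<lambda>x. a x *\<^sub>R f x)"
  by (simp add: smooth_on_def Ck_on_scaleR)

lemma smooth_on_mult:
  fixes a :: "'a::real_normed_vector \<Rightarrow> real"
  shows "open S \<Longrightarrow> smooth_on S a \<Longrightarrow> smooth_on S f \<Longrightarrow> smooth_on S (\<lambda>x. a x * f x)"
  using smooth_on_scaleR[of S a f] by simp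

lemma smooth_on_compose:
  fixes f :: "'a::real_normed_vector \<Rightarrow> 'b::euclidean_space"
  shows "open S \<Longrightarrow> f ` S \<subseteq> T \<Longrightarrow> smooth_on S f \<Longrightarrow> smooth_on T g \<Longrightarrow> smooth_on S (\<lambda>x. g (f x))"
  by (simp add: smooth_on_def Ck_on_compose)

lemma smooth_on_Pair:
  assumes "open S" "smooth_on S f" "smooth_on S g"
  shows "smooth_on S (\<lambda>x. (f x, g x))"
proof -
  have "smooth_on S (\<lambda>x. (f x, 0) + (0, g x))"
    by (intro smooth_on_add assms smooth_on_bounded_linear[where L = "\<lambda>u. (u, 0)"]
        smooth_on_bounded_linear[where L = "\<lambda>u. (0, u)"] bounded_linear_Pair
        bounded_linear_ident bounded_linear_zero)
  then show ?thesis by simp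
qed


subsection \<open>Special functions\<close>

text \<open>Gram--Schmidt will need \<open>x\<^sup>-\<^sup>1\<^sup>/\<^sup>2\<close>; the family of all real powers is closed under differentiation.\<close>

lemma smooth_on_powr: "smooth_on {0<..} (\<lambda>x::real. x powr a)"
proof -
  have "Ck_on k {0<..} (\<lambda>x::real. x powr a)" for k
  proof (induction k arbitrary: a)
    case 0
    then show ?case by (auto intro!: continuous_intros)
  next
    case (Suc k)
    show ?case
    proof (rule Ck_on_SucI)
      show "((\<lambda>x. x powr a) has_derivative (\<lambda>v. v *\<^sub>R (a *\<^sub>R x powr (a - 1)))) (at x)"
        if "x \<in> {0<..}" for x :: real
        using that has_real_derivative_powr[of x a]
        by (simp add: has_field_derivative_def mult.commute[of _ "a * _"])
      show "Ck_on k {0<..} (\<lambda>x::real. v *\<^sub>R (a *\<^sub>R x powr (a - 1)))" for v :: real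
        by (intro Ck_on_scaleR Ck_on_const Suc) auto
    qed auto
  qed
  then show ?thesis by (simp add: smooth_on_def)
qed

text \<open>The derivatives of \<open>exp (-1/t)\<close>, extended by \<open>0\<close> to \<open>t \<le> 0\<close>, are combinations of the
  functions \<open>t\<^sup>-\<^sup>m exp (-1/t)\<close>, all of which tend to \<open>0\<close> at \<open>0\<close>; so the family is treated at once.\<close>

definition flat_exp :: "nat \<Rightarrow> real \<Rightarrow> real" where
  "flat_exp m t = (if t \<le> 0 then 0 else exp (- inverse t) * inverse t ^ m)"

lemma flat_exp_has_derivative:
  "(flat_exp m has_real_derivative (flat_exp (m + 2) t - real m * flat_exp (m + 1) t)) (at t)"
proof -
  consider "t < 0" | "t = 0" | "t > 0" by linarith
  then show ?thesis
  proof cases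
    case 1
    have "((\<lambda>_. 0) has_real_derivative 0) (at t)" by simp
    then have "(flat_exp m has_real_derivative 0) (at t)"
      by (rule has_field_derivative_transform_within_open[where S = "{..<0}"])
        (use 1 in \<open>auto simp: flat_exp_def\<close>)
    then show ?thesis using 1 by (simp add: flat_exp_def)
  next
    case 2
    have "((\<lambda>h. flat_exp m h / h) \<longlongrightarrow> 0) (at_right 0)"
    proof -
      have "((\<lambda>x. x ^ Suc m / exp x) \<longlongrightarrow> (0::real)) at_top"
        by (rule tendsto_power_div_exp_0)
      then have "((\<lambda>h. inverse h ^ Suc m / exp (inverse h)) \<longlongrightarrow> (0::real)) (at_right 0)"
        by (rule filterlim_compose[OF _ filterlim_inverse_at_top_right])
      then show ?thesis
        by (rule Lim_transform_eventually)
          (auto simp: eventually_at_right_field flat_exp_def exp_minus field_simps intro!: exI[of _ 1])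
    qed
    moreover have "((\<lambda>h. flat_exp m h / h) \<longlongrightarrow> 0) (at_left 0)"
      by (rule Lim_transform_eventually[OF tendsto_const])
        (auto simp: eventually_at_left_field flat_exp_def intro!: exI[of _ "-1"])
    ultimately have "((\<lambda>h. flat_exp m h / h) \<longlongrightarrow> 0) (at 0)"
      by (simp add: filterlim_split_at)
    then show ?thesis using 2 by (simp add: has_field_derivative_iff flat_exp_def)
  next
    case 3
    let ?g = "\<lambda>t. exp (- inverse t) * inverse t ^ m"
    have "(?g has_real_derivative
        exp (- inverse t) * inverse t ^ (m + 2) - real m * (exp (- inverse t) * inverse t ^ (m + 1))) (at t)"
    proof -
      have "(?g has_real_derivative exp (- inverse t) * (inverse t)\<^sup>2 * inverse t ^ m
          + exp (- inverse t) * (real m * inverse t ^ (m - 1) * - (inverse t)\<^sup>2)) (at t)"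
        using 3 by (auto intro!: derivative_eq_intros simp: power2_eq_square)
      also have "exp (- inverse t) * (inverse t)\<^sup>2 * inverse t ^ m
          + exp (- inverse t) * (real m * inverse t ^ (m - 1) * - (inverse t)\<^sup>2)
        = exp (- inverse t) * inverse t ^ (m + 2) - real m * (exp (- inverse t) * inverse t ^ (m + 1))"
        by (cases m) (simp_all add: power2_eq_square algebra_simps)
      finally show ?thesis .
    qed
    then have "(flat_exp m has_real_derivative
        exp (- inverse t) * inverse t ^ (m + 2) - real m * (exp (- inverse t) * inverse t ^ (m + 1))) (at t)"
      by (rule has_field_derivative_transform_within_open[where S = "{0<..}"])
        (use 3 in \<open>auto simp: flat_exp_def\<close>)
    then show ?thesis using 3 by (simp add: flat_exp_def)
  qed
qed

lemma smooth_flat_exp: "smooth_on UNIV (flat_exp m)"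
proof -
  have "Ck_on k UNIV (flat_exp m)" for k
  proof (induction k arbitrary: m)
    case 0
    show ?case
      using flat_exp_has_derivative by (auto intro!: continuous_at_imp_continuous_on DERIV_isCont)
  next
    case (Suc k)
    show ?case
    proof (rule Ck_on_SucI)
      show "(flat_exp m has_derivative
          (\<lambda>v. v *\<^sub>R (flat_exp (m + 2) t + (- real m) *\<^sub>R flat_exp (m + 1) t))) (at t)" for t
        using flat_exp_has_derivative[of m t] by (simp add: has_field_derivative_def mult_commute_abs)
      show "Ck_on k UNIV (\<lambda>t. v *\<^sub>R (flat_exp (m + 2) t + (- real m) *\<^sub>R flat_exp (m + 1) t))" for v :: real
        by (intro Ck_on_scaleR Ck_on_add Ck_on_const Suc) auto
    qed auto
  qed
  then show ?thesis by (simp add: smooth_on_def)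
qed

lemma smooth_bump:
  fixes p :: "'e::euclidean_space"
  assumes "r > 0"
  obtains \<beta> :: "'e \<Rightarrow> real" where "smooth_on UNIV \<beta>" "\<beta> p > 0" "\<And>y. y \<notin> ball p r \<Longrightarrow> \<beta> y = 0"
proof
  let ?q = "\<lambda>y. r\<^sup>2 - (norm (y - p))\<^sup>2"
  have "smooth_on UNIV (\<lambda>y. r\<^sup>2 + (\<Sum>b\<in>Basis. (-1) * (((y + - p) \<bullet> b) * ((y + - p) \<bullet> b))))"
    unfolding smooth_on_def
    by (intro allI Ck_on_add Ck_on_sum smooth_onD smooth_on_const smooth_on_mult smooth_on_add
        smooth_on_bounded_linear[OF bounded_linear_inner_left] smooth_on_linear bounded_linear_ident) auto
  also have "(\<lambda>y. r\<^sup>2 + (\<Sum>b\<in>Basis. (-1) * (((y + - p) \<bullet> b) * ((y + - p) \<bullet> b)))) = ?q"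
  proof
    fix y
    have "(norm (y - p))\<^sup>2 = (\<Sum>b\<in>Basis. ((y - p) \<bullet> b) * ((y - p) \<bullet> b))"
      unfolding power2_norm_eq_inner by (rule euclidean_inner)
    then show "r\<^sup>2 + (\<Sum>b\<in>Basis. (-1) * (((y + - p) \<bullet> b) * ((y + - p) \<bullet> b))) = ?q y"
      by (simp add: sum_negf)
  qed
  finally have "smooth_on UNIV ?q" .
  then show "smooth_on UNIV (\<lambda>y. flat_exp 0 (?q y))"
    by (intro smooth_on_compose[OF _ _ _ smooth_flat_exp]) auto
  show "flat_exp 0 (?q p) > 0" using assms by (simp add: flat_exp_def)
  show "flat_exp 0 (?q y) = 0" if "y \<notin> ball p r" for y
  proof -
    have "r\<^sup>2 \<le> (norm (y - p))\<^sup>2"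
      using that assms by (intro power_mono) (auto simp: dist_norm norm_minus_commute)
    then show ?thesis by (simp add: flat_exp_def)
  qed
qed


subsection \<open>Hadamard's lemma\<close>

text \<open>Differentiating under the integral sign only raises the power of \<open>t\<close> by one, so carrying the factor
  \<open>t\<^sup>m\<close> lets the induction on the order of differentiability go through.\<close>

lemma smooth_on_contraction_integral:
  fixes H :: "'e::euclidean_space \<Rightarrow> real"
  assumes "smooth_on (ball p r) H"
  shows "smooth_on (ball p r) (\<lambda>y. integral {0..1} (\<lambda>t. t ^ m * H (p + t *\<^sub>R (y - p))))"
proof -
  have mem: "p + t *\<^sub>R (y - p) \<in> ball p r" if "y \<in> ball p r" "t \<in> {0..1}" for y t
  proof -
    have "norm (t *\<^sub>R (y - p)) \<le> norm (y - p)" using that by (simp add: mult_left_le_one_le)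
    then show ?thesis using that by (simp add: dist_norm norm_minus_commute)
  qed
  have cont: "continuous_on (ball p r \<times> {0..1}) (\<lambda>(y, t). t ^ j * G (p + t *\<^sub>R (y - p)))"
    if "continuous_on (ball p r) G" for G :: "'e \<Rightarrow> real" and j :: nat
    unfolding case_prod_unfold
    by (intro continuous_intros continuous_on_compose2[OF that]) (use mem in auto)
  have "Ck_on k (ball p r) (\<lambda>y. integral {0..1} (\<lambda>t. t ^ m * H (p + t *\<^sub>R (y - p))))" for k
    using assms
  proof (induction k arbitrary: m H)
    case 0
    have "continuous_on (ball p r) (\<lambda>y. integral (cbox 0 1) (\<lambda>t. t ^ m * H (p + t *\<^sub>R (y - p))))"
      by (rule integral_continuous_on_param)
        (use cont[OF smooth_on_continuous[OF 0]] in \<open>simp add: cbox_interval\<close>)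
    then show ?case by (simp add: cbox_interval)
  next
    case (Suc k)
    let ?D = "\<lambda>y. frechet_derivative H (at y)"
    have bl: "bounded_linear (\<lambda>v. t ^ Suc m * ?D (p + t *\<^sub>R (y - p)) v)"
      if "y \<in> ball p r" "t \<in> {0..1}" for y t
      using smooth_on_has_derivative[OF Suc.prems mem[OF that]]
      by (intro bounded_linear_const_mult has_derivative_bounded_linear)
    define L where "L y t = Blinfun (\<lambda>v. t ^ Suc m * ?D (p + t *\<^sub>R (y - p)) v)" for y t
    have L: "blinfun_apply (L y t) = (\<lambda>v. t ^ Suc m * ?D (p + t *\<^sub>R (y - p)) v)"
      if "y \<in> ball p r" "t \<in> {0..1}" for y t
      unfolding L_def using bl[OF that] by (rule bounded_linear_Blinfun_apply)
    have contL: "continuous_on (ball p r \<times> cbox 0 1) (\<lambda>(y, t). L y t)"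
    proof (rule continuous_on_blinfun_componentwise)
      fix v :: 'e
      have "continuous_on (ball p r \<times> {0..1}) (\<lambda>(y, t). t ^ Suc m * ?D (p + t *\<^sub>R (y - p)) v)"
        by (intro cont smooth_on_continuous smooth_on_frechet Suc.prems)
      then show "continuous_on (ball p r \<times> cbox 0 1) (\<lambda>x. blinfun_apply (case x of (y, t) \<Rightarrow> L y t) v)"
        by (rule continuous_on_cong[THEN iffD1, rotated -1]) (auto simp: L cbox_interval)
    qed
    have intL: "L y integrable_on cbox 0 1" if "y \<in> ball p r" for y
    proof (rule integrable_continuous)
      have "continuous_on (cbox 0 1) (\<lambda>t. (\<lambda>(y, t). L y t) (y, t))"
        by (rule continuous_on_compose2[OF contL]) (use that in \<open>auto intro!: continuous_intros\<close>)
      then show "continuous_on (cbox 0 1) (L y)" by simp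
    qed
    show ?case
    proof (rule Ck_on_SucI)
      fix y assume y: "y \<in> ball p r"
      have "((\<lambda>y. integral (cbox 0 1) (\<lambda>t. t ^ m * H (p + t *\<^sub>R (y - p)))) has_derivative
          blinfun_apply (integral (cbox 0 1) (L y))) (at y within ball p r)"
      proof (rule leibniz_rule[OF _ _ contL y])
        fix z t assume z: "z \<in> ball p r" and "t \<in> cbox (0::real) 1"
        then have t: "t \<in> {0..1}" by (simp add: cbox_interval)
        have "((\<lambda>z. p + t *\<^sub>R (z - p)) has_derivative (\<lambda>v. t *\<^sub>R v)) (at z)"
          by (auto intro!: derivative_eq_intros)
        from has_derivative_compose[OF this smooth_on_has_derivative[OF Suc.prems mem[OF z t]]]
        have "((\<lambda>z. H (p + t *\<^sub>R (z - p))) has_derivative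
            (\<lambda>v. ?D (p + t *\<^sub>R (z - p)) (t *\<^sub>R v))) (at z)" .
        then have "((\<lambda>z. t ^ m * H (p + t *\<^sub>R (z - p))) has_derivative
            (\<lambda>v. t ^ m * ?D (p + t *\<^sub>R (z - p)) (t *\<^sub>R v))) (at z)"
          by (rule has_derivative_mult_right)
        moreover have "?D (p + t *\<^sub>R (z - p)) (t *\<^sub>R v) = t * ?D (p + t *\<^sub>R (z - p)) v" for v
          using linear_scale[OF has_derivative_linear[OF smooth_on_has_derivative[OF Suc.prems mem[OF z t]]]]
          by simp
        ultimately show "((\<lambda>z. t ^ m * H (p + t *\<^sub>R (z - p))) has_derivative blinfun_apply (L z t))
            (at z within ball p r)"
          unfolding L[OF z t] by (simp add: mult_ac has_derivative_at_withinI)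
      next
        fix z assume z: "z \<in> ball p r"
        show "(\<lambda>t. t ^ m * H (p + t *\<^sub>R (z - p))) integrable_on cbox 0 1"
        proof (rule integrable_continuous)
          have "continuous_on (cbox 0 1) (\<lambda>t. (\<lambda>(y, t). t ^ m * H (p + t *\<^sub>R (y - p))) (z, t))"
            by (rule continuous_on_compose2[OF cont[OF smooth_on_continuous[OF Suc.prems]]])
              (use z in \<open>auto intro!: continuous_intros\<close>)
          then show "continuous_on (cbox 0 1) (\<lambda>t. t ^ m * H (p + t *\<^sub>R (z - p)))" by simp
        qed
      qed (rule convex_ball)
      then show "((\<lambda>y. integral {0..1} (\<lambda>t. t ^ m * H (p + t *\<^sub>R (y - p)))) has_derivative
          (\<lambda>v. blinfun_apply (integral {0..1} (L y)) v)) (at y)"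
        by (simp only: cbox_interval at_within_open[OF y open_ball])
    next
      fix v
      have "Ck_on k (ball p r) (\<lambda>y. integral {0..1} (\<lambda>t. t ^ Suc m * ?D (p + t *\<^sub>R (y - p)) v))"
        by (rule Suc.IH[OF smooth_on_frechet[OF Suc.prems]])
      then show "Ck_on k (ball p r) (\<lambda>y. blinfun_apply (integral {0..1} (L y)) v)"
      proof (rule Ck_on_imp_eq[OF open_ball])
        fix y assume y: "y \<in> ball p r"
        show "integral {0..1} (\<lambda>t. t ^ Suc m * ?D (p + t *\<^sub>R (y - p)) v) = blinfun_apply (integral {0..1} (L y)) v"
          using intL[OF y] L[OF y]
          by (subst blinfun_apply_integral) (auto simp: cbox_interval intro!: integral_cong)
      qed
    qed auto
  qed
  then show ?thesis by (simp add: smooth_on_def)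
qed

text \<open>Integrating \<open>F\<close> along the segments from \<open>p\<close> writes it as \<open>F p\<close> plus a combination of the
  coordinate functions centred at \<open>p\<close>, with smooth coefficients.\<close>

lemma Hadamard:
  fixes F :: "'e::euclidean_space \<Rightarrow> real"
  assumes "smooth_on (ball p r) F" "r > 0"
  obtains G where "\<And>b. smooth_on (ball p r) (G b)"
    "\<And>y. y \<in> ball p r \<Longrightarrow> F y = F p + (\<Sum>b\<in>Basis. ((y - p) \<bullet> b) * G b y)"
    "\<And>b. G b p = frechet_derivative F (at p) b"
proof
  let ?D = "\<lambda>y. frechet_derivative F (at y)"
  let ?G = "\<lambda>b y. integral {0..1} (\<lambda>t. t ^ 0 * ?D (p + t *\<^sub>R (y - p)) b)"
  show "smooth_on (ball p r) (?G b)" for b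
    by (intro smooth_on_contraction_integral smooth_on_frechet assms)
  show "?G b p = ?D p b" for b by simp
  fix y assume y: "y \<in> ball p r"
  have mem: "p + t *\<^sub>R (y - p) \<in> ball p r" if "t \<in> {0..1}" for t
  proof -
    have "norm (t *\<^sub>R (y - p)) \<le> norm (y - p)" using that by (simp add: mult_left_le_one_le)
    then show ?thesis using y by (simp add: dist_norm norm_minus_commute)
  qed
  have lin: "linear (?D (p + t *\<^sub>R (y - p)))" if "t \<in> {0..1}" for t
    using smooth_on_has_derivative[OF assms(1) mem[OF that]] by (rule has_derivative_linear)
  have int: "(\<lambda>t. ?D (p + t *\<^sub>R (y - p)) b) integrable_on {0..1}" for b
    by (rule integrable_continuous_real,
        rule continuous_on_compose2[OF smooth_on_continuous[OF smooth_on_frechet[OF assms(1)]]])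
      (use mem in \<open>auto intro!: continuous_intros\<close>)
  have "((\<lambda>t. F (p + t *\<^sub>R (y - p))) has_vector_derivative ?D (p + t *\<^sub>R (y - p)) (y - p)) (at t within {0..1})"
    if t: "t \<in> {0..1}" for t
  proof -
    have "((\<lambda>t. p + t *\<^sub>R (y - p)) has_derivative (\<lambda>s. s *\<^sub>R (y - p))) (at t)"
      by (auto intro!: derivative_eq_intros)
    from has_derivative_compose[OF this smooth_on_has_derivative[OF assms(1) mem[OF t]]]
    show ?thesis
      using linear_scale[OF lin[OF t]]
      by (simp add: has_vector_derivative_def has_derivative_at_withinI)
  qed
  then have "((\<lambda>t. ?D (p + t *\<^sub>R (y - p)) (y - p)) has_integral F (p + 1 *\<^sub>R (y - p)) - F (p + 0 *\<^sub>R (y - p))) {0..1}"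
    by (intro fundamental_theorem_of_calculus) auto
  then have "F y - F p = integral {0..1} (\<lambda>t. ?D (p + t *\<^sub>R (y - p)) (y - p))"
    by (simp add: integral_unique)
  also have "\<dots> = integral {0..1} (\<lambda>t. \<Sum>b\<in>Basis. ((y - p) \<bullet> b) * ?D (p + t *\<^sub>R (y - p)) b)"
  proof (rule integral_cong)
    fix t :: real assume "t \<in> {0..1}"
    from lin[OF this] show "?D (p + t *\<^sub>R (y - p)) (y - p) = (\<Sum>b\<in>Basis. ((y - p) \<bullet> b) * ?D (p + t *\<^sub>R (y - p)) b)"
      by (subst (2) euclidean_representation[symmetric])
        (simp only: linear_sum linear_scale real_scaleR_def)
  qed
  also have "\<dots> = (\<Sum>b\<in>Basis. ((y - p) \<bullet> b) * ?G b y)"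
    by (subst integral_sum) (auto intro!: integrable_on_mult_right int)
  finally show "F y = F p + (\<Sum>b\<in>Basis. ((y - p) \<bullet> b) * ?G b y)" by simp
qed


section \<open>Smooth functions on a manifold\<close>

locale smooth_manifold =
  fixes A :: "('m::{t2_space,second_countable_topology}, 'e::euclidean_space) chart set"
  assumes atlas: "smooth_atlas A"
begin

lemma chart:
  assumes "(V, c) \<in> A"
  shows "open V" "open (c ` V)" "inj_on c V" "continuous_on V c"
    "continuous_on (c ` V) (inv_into V c)" "V \<subseteq> points A"
    "\<And>x. x \<in> V \<Longrightarrow> inv_into V c (c x) = x"
proof -
  have *: "open V" "open (c ` V)" "homeomorphism V (c ` V) c (inv_into V c)"
    using atlas assms by (auto simp: smooth_atlas_def)
  then show "open V" "open (c ` V)" by auto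
  show "inj_on c V" using *(3) by (metis homeomorphism_apply1 inj_on_inverseI)
  then show "inv_into V c (c x) = x" if "x \<in> V" for x using that by simp
  show "continuous_on V c" "continuous_on (c ` V) (inv_into V c)"
    using *(3) by (auto simp: homeomorphism_def)
  show "V \<subseteq> points A" using assms by (auto simp: points_def)
qed

lemma transition_smooth:
  "(V, c) \<in> A \<Longrightarrow> (W, d) \<in> A \<Longrightarrow> smooth_on (c ` (V \<inter> W)) (d \<circ> inv_into V c)"
  using atlas by (auto simp: smooth_atlas_def)

lemma chart_image_open:
  assumes "(V, c) \<in> A" "open U"
  shows "open (c ` (U \<inter> V))"
proof -
  have eq: "c ` (U \<inter> V) = c ` V \<inter> inv_into V c -` U"
    using chart(7)[OF assms(1)] by (auto 4 3 intro: rev_image_eqI)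
  show ?thesis
    unfolding eq using chart(2,5)[OF assms(1)] assms(2) by (simp add: continuous_open_preimage)
qed

lemma chart_preimage_open:
  assumes "(V, c) \<in> A" "open S"
  shows "open (V \<inter> c -` S)"
  using chart(1,4)[OF assms(1)] assms(2) by (simp add: continuous_open_preimage)

lemma chart_at:
  assumes "p \<in> points A"
  obtains V c where "(V, c) \<in> A" "p \<in> V"
  using assms by (auto simp: points_def)

lemma points_open: "open (points A)"
  using chart(1) by (auto simp: points_def)

lemma smooth_fun_open: "smooth_fun A U f \<Longrightarrow> open U"
  and smooth_fun_points: "smooth_fun A U f \<Longrightarrow> U \<subseteq> points A"
  by (auto simp: smooth_fun_def)

lemma smooth_fun_chart:
  "smooth_fun A U f \<Longrightarrow> (V, c) \<in> A \<Longrightarrow> smooth_on (c ` (U \<inter> V)) (f \<circ> inv_into V c)"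
  by (auto simp: smooth_fun_def)

lemma smooth_fun_chartI:
  assumes "open U" "U \<subseteq> points A"
    "\<And>V c. (V, c) \<in> A \<Longrightarrow> smooth_on (c ` (U \<inter> V)) (f \<circ> inv_into V c)"
  shows "smooth_fun A U f"
  using assms by (auto simp: smooth_fun_def)

text \<open>Smoothness can be tested near each point in one chart, since transition maps are smooth.\<close>

lemma smooth_funI:
  assumes "open U" "U \<subseteq> points A"
    and loc: "\<And>x. x \<in> U \<Longrightarrow> \<exists>V c W. (V, c) \<in> A \<and> open W \<and> x \<in> W \<and> W \<subseteq> U \<inter> V \<and>
       smooth_on (c ` W) (f \<circ> inv_into V c)"
  shows "smooth_fun A U f"
  unfolding smooth_fun_def
proof (intro conjI assms ballI, clarify)
  fix V c assume V: "(V, c) \<in> A"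
  show "smooth_on (c ` (U \<inter> V)) (f \<circ> inv_into V c)"
  proof (rule smooth_on_local)
    fix y assume "y \<in> c ` (U \<inter> V)"
    then obtain x where x: "x \<in> U" "x \<in> V" "y = c x" by auto
    obtain V' c' W where V': "(V', c') \<in> A" and W: "open W" "x \<in> W" "W \<subseteq> U \<inter> V'"
      and s: "smooth_on (c' ` W) (f \<circ> inv_into V' c')"
      using loc[OF x(1)] by blast
    have o: "open (c ` (W \<inter> V))" using chart_image_open[OF V W(1)] .
    have "smooth_on (c ` (W \<inter> V)) (\<lambda>z. (f \<circ> inv_into V' c') ((c' \<circ> inv_into V c) z))"
    proof (rule smooth_on_compose[OF o _ _ s])
      show "(c' \<circ> inv_into V c) ` c ` (W \<inter> V) \<subseteq> c' ` W" using chart(7)[OF V] by auto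
      show "smooth_on (c ` (W \<inter> V)) (c' \<circ> inv_into V c)"
        by (rule smooth_on_subset[OF transition_smooth[OF V V']]) (use W in auto)
    qed
    then have "smooth_on (c ` (W \<inter> V)) (f \<circ> inv_into V c)"
      by (rule smooth_on_imp_eq[OF _ o]) (use W chart(7)[OF V] chart(7)[OF V'] in auto)
    then show "\<exists>T. open T \<and> y \<in> T \<and> T \<subseteq> c ` (U \<inter> V) \<and> smooth_on T (f \<circ> inv_into V c)"
      using o W x by (intro exI[of _ "c ` (W \<inter> V)"]) auto
  qed
qed

lemma smooth_fun_subset: "smooth_fun A U f \<Longrightarrow> open W \<Longrightarrow> W \<subseteq> U \<Longrightarrow> smooth_fun A W f"
  unfolding smooth_fun_def by (fast intro: smooth_on_subset)

lemma smooth_fun_local: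
  assumes "\<And>x. x \<in> U \<Longrightarrow> \<exists>W. x \<in> W \<and> W \<subseteq> U \<and> smooth_fun A W f"
  shows "smooth_fun A U f"
proof (rule smooth_funI)
  show "open U"
    unfolding open_subopen[of U] using assms smooth_fun_open by meson
  show "U \<subseteq> points A" using assms smooth_fun_points by (meson subsetD subsetI)
  fix x assume "x \<in> U"
  then obtain W where W: "x \<in> W" "W \<subseteq> U" "smooth_fun A W f" using assms by blast
  then obtain V c where V: "(V, c) \<in> A" "x \<in> V" using smooth_fun_points chart_at by blast
  show "\<exists>V c W. (V, c) \<in> A \<and> open W \<and> x \<in> W \<and> W \<subseteq> U \<inter> V \<and> smooth_on (c ` W) (f \<circ> inv_into V c)"
    using V W smooth_fun_chart[OF W(3) V(1)] smooth_fun_open[OF W(3)] chart(1)[OF V(1)]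
    by (intro exI[of _ V] exI[of _ c] exI[of _ "W \<inter> V"]) auto
qed

lemma smooth_fun_cong:
  assumes "smooth_fun A U f" "\<And>x. x \<in> U \<Longrightarrow> f x = g x"
  shows "smooth_fun A U g"
proof (rule smooth_fun_chartI)
  fix V c assume V: "(V, c) \<in> A"
  show "smooth_on (c ` (U \<inter> V)) (g \<circ> inv_into V c)"
    by (rule smooth_on_imp_eq[OF smooth_fun_chart[OF assms(1) V] chart_image_open[OF V smooth_fun_open[OF assms(1)]]])
      (use assms(2) chart(7)[OF V] in auto)
qed (rule smooth_fun_open[OF assms(1)] smooth_fun_points[OF assms(1)])+

lemma smooth_fun_const: "open U \<Longrightarrow> U \<subseteq> points A \<Longrightarrow> smooth_fun A U (\<lambda>x. k)"
  by (auto simp: smooth_fun_def o_def intro!: smooth_on_const chart_image_open)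

lemma smooth_fun_add:
  "smooth_fun A U f \<Longrightarrow> smooth_fun A U g \<Longrightarrow> smooth_fun A U (\<lambda>x. f x + g x)"
  by (auto simp: smooth_fun_def o_def intro!: smooth_on_add chart_image_open)

lemma smooth_fun_mult:
  "smooth_fun A U f \<Longrightarrow> smooth_fun A U g \<Longrightarrow> smooth_fun A U (\<lambda>x. f x * g x)"
  by (auto simp: smooth_fun_def o_def intro!: smooth_on_mult chart_image_open)

lemma smooth_fun_cmult: "smooth_fun A U f \<Longrightarrow> smooth_fun A U (\<lambda>x. k * f x)"
  by (intro smooth_fun_mult smooth_fun_const) (auto simp: smooth_fun_def)

lemma smooth_fun_uminus: "smooth_fun A U f \<Longrightarrow> smooth_fun A U (\<lambda>x. - f x)"
  using smooth_fun_cmult[of U f "-1"] by simp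

lemma smooth_fun_sum:
  assumes "open U" "U \<subseteq> points A" "\<And>i. i \<in> I \<Longrightarrow> smooth_fun A U (f i)"
  shows "smooth_fun A U (\<lambda>x. \<Sum>i\<in>I. f i x)"
  using assms(3)
  by (induction I rule: infinite_finite_induct) (simp_all add: smooth_fun_const smooth_fun_add assms(1,2))

lemma smooth_fun_compose_real:
  fixes F :: "real \<Rightarrow> real"
  assumes "smooth_fun A U f" "smooth_on T F" "f ` U \<subseteq> T"
  shows "smooth_fun A U (\<lambda>x. F (f x))"
proof (rule smooth_fun_chartI)
  fix V c assume V: "(V, c) \<in> A"
  have "smooth_on (c ` (U \<inter> V)) (\<lambda>z. F ((f \<circ> inv_into V c) z))"
    by (rule smooth_on_compose[OF chart_image_open[OF V smooth_fun_open[OF assms(1)]] _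
          smooth_fun_chart[OF assms(1) V] assms(2)])
      (use assms(3) chart(7)[OF V] in auto)
  then show "smooth_on (c ` (U \<inter> V)) ((\<lambda>x. F (f x)) \<circ> inv_into V c)" by (simp add: o_def)
qed (rule smooth_fun_open[OF assms(1)] smooth_fun_points[OF assms(1)])+

lemma smooth_fun_in_chart:
  assumes "(V, c) \<in> A" "smooth_on S F" "open S"
  shows "smooth_fun A (V \<inter> c -` S) (\<lambda>x. F (c x))"
proof (rule smooth_funI)
  show o: "open (V \<inter> c -` S)" using chart_preimage_open[OF assms(1,3)] .
  show "V \<inter> c -` S \<subseteq> points A" using chart(6)[OF assms(1)] by auto
  fix x assume x: "x \<in> V \<inter> c -` S"
  have "smooth_on (c ` ((V \<inter> c -` S) \<inter> V)) ((\<lambda>x. F (c x)) \<circ> inv_into V c)"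
    by (rule smooth_on_imp_eq[OF smooth_on_subset[OF assms(2)] chart_image_open[OF assms(1) o]])
      (auto simp: chart(7)[OF assms(1)])
  then show "\<exists>V' c' W. (V', c') \<in> A \<and> open W \<and> x \<in> W \<and> W \<subseteq> (V \<inter> c -` S) \<inter> V' \<and>
      smooth_on (c' ` W) ((\<lambda>x. F (c x)) \<circ> inv_into V' c')"
    using o x assms(1) by (intro exI[of _ V] exI[of _ c] exI[of _ "V \<inter> c -` S"]) (auto simp: Int_absorb2)
qed

lemma smooth_fun_coord: "(V, c) \<in> A \<Longrightarrow> smooth_fun A V (\<lambda>x. c x \<bullet> b)"
  using smooth_fun_in_chart[of V c UNIV "\<lambda>y. y \<bullet> b"]
  by (simp add: smooth_on_linear bounded_linear_inner_left)

lemma smooth_nearI: "smooth_fun A U f \<Longrightarrow> p \<in> U \<Longrightarrow> smooth_near A p f"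
  by (auto simp: smooth_near_def)

lemma smooth_near_common:
  assumes "smooth_near A p f" "smooth_near A p g"
  obtains U where "p \<in> U" "smooth_fun A U f" "smooth_fun A U g"
proof -
  obtain U W where "p \<in> U" "smooth_fun A U f" "p \<in> W" "smooth_fun A W g"
    using assms by (auto simp: smooth_near_def)
  then show ?thesis
    using that[of "U \<inter> W"] smooth_fun_open smooth_fun_subset by (metis IntI inf_le1 inf_le2 open_Int)
qed

lemma smooth_near_add: "smooth_near A p f \<Longrightarrow> smooth_near A p g \<Longrightarrow> smooth_near A p (\<lambda>x. f x + g x)"
  using smooth_near_common smooth_fun_add smooth_nearI by metis

lemma smooth_near_mult: "smooth_near A p f \<Longrightarrow> smooth_near A p g \<Longrightarrow> smooth_near A p (\<lambda>x. f x * g x)"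
  using smooth_near_common smooth_fun_mult smooth_nearI by metis

lemma smooth_near_cmult: "smooth_near A p f \<Longrightarrow> smooth_near A p (\<lambda>x. k * f x)"
  unfolding smooth_near_def using smooth_fun_cmult by blast

lemma smooth_near_const: "p \<in> points A \<Longrightarrow> smooth_near A p (\<lambda>x. k)"
  using smooth_fun_const[OF points_open order_refl] by (rule smooth_nearI)

lemma smooth_near_points: "smooth_near A p f \<Longrightarrow> p \<in> points A"
  unfolding smooth_near_def using smooth_fun_points by blast

lemma smooth_near_eq:
  assumes "smooth_near A p f" "open W" "p \<in> W" "\<And>x. x \<in> W \<Longrightarrow> f x = g x"
  shows "smooth_near A p g"
proof -
  obtain U where U: "p \<in> U" "smooth_fun A U f" using assms by (auto simp: smooth_near_def)
  have "smooth_fun A (U \<inter> W) g"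
    by (rule smooth_fun_cong[OF smooth_fun_subset[OF U(2)]]) (use U assms smooth_fun_open in auto)
  then show ?thesis using U assms by (auto intro: smooth_nearI)
qed

lemma smooth_near_sum:
  assumes "p \<in> points A" "\<And>i. i \<in> I \<Longrightarrow> smooth_near A p (f i)"
  shows "smooth_near A p (\<lambda>x. \<Sum>i\<in>I. f i x)"
  using assms(2)
  by (induction I rule: infinite_finite_induct)
    (auto intro: smooth_near_const smooth_near_add assms(1))


section \<open>Tangent vectors\<close>

lemma tangent_add: "v \<in> tangent_space A p \<Longrightarrow> smooth_near A p f \<Longrightarrow> smooth_near A p g \<Longrightarrow>
    v (\<lambda>x. f x + g x) = v f + v g"
  and tangent_mult: "v \<in> tangent_space A p \<Longrightarrow> smooth_near A p f \<Longrightarrow> smooth_near A p g \<Longrightarrow>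
    v (\<lambda>x. f x * g x) = f p * v g + g p * v f"
  and tangent_cmult: "v \<in> tangent_space A p \<Longrightarrow> smooth_near A p f \<Longrightarrow> v (\<lambda>x. k * f x) = k * v f"
  and tangent_not_smooth: "v \<in> tangent_space A p \<Longrightarrow> \<not> smooth_near A p f \<Longrightarrow> v f = 0"
  by (auto simp: tangent_space_def)

lemma tangent_const:
  assumes "v \<in> tangent_space A p" "p \<in> points A"
  shows "v (\<lambda>x. k) = 0"
proof -
  have "v (\<lambda>x. 1 * 1) = 1 * v (\<lambda>x. 1) + 1 * v (\<lambda>x. 1)"
    using assms by (intro tangent_mult smooth_near_const)
  then have "v (\<lambda>x. 1) = 0" by simp
  then show ?thesis using tangent_cmult[OF assms(1) smooth_near_const[OF assms(2), of 1], of k] by simp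
qed

lemma tangent_sum:
  assumes "v \<in> tangent_space A p" "p \<in> points A" "\<And>i. i \<in> I \<Longrightarrow> smooth_near A p (f i)"
  shows "v (\<lambda>x. \<Sum>i\<in>I. f i x) = (\<Sum>i\<in>I. v (f i))"
  using assms(3)
  by (induction I rule: infinite_finite_induct)
    (auto simp: tangent_const[OF assms(1,2)] tangent_add[OF assms(1)] smooth_near_sum[OF assms(2)])

text \<open>A difference that vanishes near \<open>p\<close> is its own product with a function vanishing near \<open>p\<close>;
  the Leibniz rule kills such a product.\<close>

lemma tangent_germ:
  assumes v: "v \<in> tangent_space A p" and f: "smooth_near A p f"
    and W: "open W" "p \<in> W" "\<And>x. x \<in> W \<Longrightarrow> f x = g x"
  shows "v f = v g"
proof -
  let ?d = "\<lambda>x. g x + (-1) * f x" and ?k = "\<lambda>x. if x \<in> W then 0 else (1::real)"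
  have p: "p \<in> points A" using f smooth_near_points by auto
  have g: "smooth_near A p g" using smooth_near_eq[OF f W] .
  have sd: "smooth_near A p ?d"
    by (intro smooth_near_add g smooth_near_cmult f)
  have sk: "smooth_near A p ?k"
    by (rule smooth_near_eq[OF smooth_near_const[OF p, of 0] W(1,2)]) simp
  have "?d = (\<lambda>x. ?d x * ?k x)" using W(3) by auto
  then have "v ?d = v (\<lambda>x. ?d x * ?k x)" by simp
  also have "\<dots> = ?d p * v ?k + ?k p * v ?d" by (rule tangent_mult[OF v sd sk])
  also have "\<dots> = 0" using W by auto
  finally have "v ?d = 0" .
  moreover have "v ?d = v g + (-1) * v f"
    by (simp only: tangent_add[OF v g smooth_near_cmult[OF f]] tangent_cmult[OF v f])
  ultimately show ?thesis by simp
qed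

lemma subspace_tangent: "subspace (tangent_space A p)"
  unfolding subspace_def tangent_space_def by (auto simp: scaleR_fun_def algebra_simps)

text \<open>The directional derivative along \<open>w\<close> in the chart \<open>c\<close>; it is \<open>0\<close> on functions that are not smooth
  near \<open>p\<close>, as membership in \<^const>\<open>tangent_space\<close> demands.\<close>

definition coord_vec :: "'m set \<Rightarrow> ('m \<Rightarrow> 'e) \<Rightarrow> 'e \<Rightarrow> 'm \<Rightarrow> 'm tvec" where
  "coord_vec V c w p = (\<lambda>f. if smooth_near A p f then frechet_derivative (f \<circ> inv_into V c) (at (c p)) w else 0)"

lemma coord_has_derivative:
  assumes V: "(V, c) \<in> A" "p \<in> V" and f: "smooth_near A p f"
  shows "((f \<circ> inv_into V c) has_derivative frechet_derivative (f \<circ> inv_into V c) (at (c p))) (at (c p))"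
proof -
  obtain U where U: "p \<in> U" "smooth_fun A U f" using f by (auto simp: smooth_near_def)
  show ?thesis by (rule smooth_on_has_derivative[OF smooth_fun_chart[OF U(2) V(1)]]) (use U V in auto)
qed

lemma coord_vec_tangent:
  assumes V: "(V, c) \<in> A" "p \<in> V"
  shows "coord_vec V c w p \<in> tangent_space A p"
proof -
  note D = coord_has_derivative[OF V]
  have inv: "inv_into V c (c p) = p" using chart(7)[OF V(1) V(2)] .
  have "frechet_derivative ((\<lambda>x. f x + g x) \<circ> inv_into V c) (at (c p)) w =
      frechet_derivative (f \<circ> inv_into V c) (at (c p)) w + frechet_derivative (g \<circ> inv_into V c) (at (c p)) w"
    "frechet_derivative ((\<lambda>x. f x * g x) \<circ> inv_into V c) (at (c p)) w =
      f p * frechet_derivative (g \<circ> inv_into V c) (at (c p)) w + g p * frechet_derivative (f \<circ> inv_into V c) (at (c p)) w"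
    if "smooth_near A p f" "smooth_near A p g" for f g
    using has_derivative_add[OF D[OF that(1)] D[OF that(2)]] has_derivative_mult[OF D[OF that(1)] D[OF that(2)]] inv
    by (simp_all add: o_def frechet_derivative_at[symmetric] algebra_simps)
  moreover have "frechet_derivative ((\<lambda>x. k * f x) \<circ> inv_into V c) (at (c p)) w =
      k * frechet_derivative (f \<circ> inv_into V c) (at (c p)) w" if "smooth_near A p f" for f k
    using has_derivative_mult_right[OF D[OF that], of k] by (simp add: o_def frechet_derivative_at[symmetric])
  ultimately show ?thesis
    by (auto simp: tangent_space_def coord_vec_def smooth_near_add smooth_near_mult smooth_near_cmult)
qed

lemma coord_vec_coord:
  assumes V: "(V, c) \<in> A" "p \<in> V"
  shows "coord_vec V c w p (\<lambda>x. c x \<bullet> b) = w \<bullet> b"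
proof -
  have s: "smooth_near A p (\<lambda>x. c x \<bullet> b)" using smooth_fun_coord[OF V(1)] V(2) by (rule smooth_nearI)
  have "((\<lambda>y. y \<bullet> b) has_derivative (\<lambda>w. w \<bullet> b)) (at (c p))" by (auto intro!: derivative_eq_intros)
  then have "(((\<lambda>x. c x \<bullet> b) \<circ> inv_into V c) has_derivative (\<lambda>w. w \<bullet> b)) (at (c p))"
    by (rule has_derivative_transform_within_open[where s = "c ` V"])
      (use chart[OF V(1)] V(2) in \<open>auto simp: f_inv_into_f\<close>)
  then show ?thesis using s by (simp add: coord_vec_def frechet_derivative_at[symmetric])
qed

lemma coord_vec_smooth:
  assumes V: "(V, c) \<in> A" and f: "smooth_fun A W f"
  shows "smooth_fun A (W \<inter> V) (\<lambda>p. coord_vec V c w p f)"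
proof -
  let ?F = "f \<circ> inv_into V c"
  have o: "open W" using f smooth_fun_open by auto
  have "smooth_fun A (V \<inter> c -` c ` (W \<inter> V)) (\<lambda>p. frechet_derivative ?F (at (c p)) w)"
    using smooth_fun_in_chart[OF V smooth_on_frechet[OF smooth_fun_chart[OF f V]] chart_image_open[OF V o]] .
  moreover have "V \<inter> c -` c ` (W \<inter> V) = W \<inter> V"
    using chart(3)[OF V] by (auto dest: inj_onD)
  ultimately have "smooth_fun A (W \<inter> V) (\<lambda>p. frechet_derivative ?F (at (c p)) w)" by simp
  then show ?thesis
    by (rule smooth_fun_cong) (use smooth_nearI[OF f] in \<open>auto simp: coord_vec_def\<close>)
qed

text \<open>Coordinate vectors span: by Hadamard's lemma a function is, near \<open>p\<close>, a constant plus
  products of centred coordinate functions with smooth functions.\<close>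

lemma tangent_coord_expansion:
  assumes v: "v \<in> tangent_space A p" and V: "(V, c) \<in> A" "p \<in> V"
  shows "v f = (\<Sum>b\<in>Basis. v (\<lambda>x. c x \<bullet> b) * coord_vec V c b p f)"
proof (cases "smooth_near A p f")
  case False
  then show ?thesis using v by (simp add: tangent_not_smooth coord_vec_def)
next
  case True
  let ?F = "f \<circ> inv_into V c"
  have p: "p \<in> points A" using True smooth_near_points by auto
  obtain U where U: "p \<in> U" "smooth_fun A U f" using True by (auto simp: smooth_near_def)
  have "open (c ` (U \<inter> V))" using chart_image_open[OF V(1) smooth_fun_open[OF U(2)]] .
  moreover have "c p \<in> c ` (U \<inter> V)" using U V by auto
  ultimately obtain r where r: "r > 0" "ball (c p) r \<subseteq> c ` (U \<inter> V)" by (meson openE)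
  have F: "smooth_on (ball (c p) r) ?F" using smooth_on_subset[OF smooth_fun_chart[OF U(2) V(1)] r(2)] .
  obtain G where G: "\<And>b. smooth_on (ball (c p) r) (G b)"
    "\<And>y. y \<in> ball (c p) r \<Longrightarrow> ?F y = ?F (c p) + (\<Sum>b\<in>Basis. ((y - c p) \<bullet> b) * G b y)"
    "\<And>b. G b (c p) = frechet_derivative ?F (at (c p)) b"
    using Hadamard[OF F r(1)] by blast
  let ?W = "V \<inter> c -` ball (c p) r"
  have oW: "open ?W" and pW: "p \<in> ?W" using chart_preimage_open[OF V(1)] V r by auto
  have sG: "smooth_near A p (\<lambda>x. G b (c x))" for b
    by (rule smooth_nearI[OF smooth_fun_in_chart[OF V(1) G(1) open_ball] pW])
  have sc: "smooth_near A p (\<lambda>x. c x \<bullet> b)" for b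
    by (rule smooth_nearI[OF smooth_fun_coord[OF V(1)] V(2)])
  have sk: "smooth_near A p (\<lambda>x. k)" for k by (rule smooth_near_const[OF p])
  have sdc: "smooth_near A p (\<lambda>x. c x \<bullet> b + - (c p \<bullet> b))" for b
    by (intro smooth_near_add sc sk)
  have prod: "v (\<lambda>x. (c x \<bullet> b + - (c p \<bullet> b)) * G b (c x)) = v (\<lambda>x. c x \<bullet> b) * coord_vec V c b p f" for b
    by (simp only: tangent_mult[OF v sdc sG] tangent_add[OF v sc sk] tangent_const[OF v p])
      (use True G(3) in \<open>simp add: coord_vec_def\<close>)
  have "v f = v (\<lambda>x. f p + (\<Sum>b\<in>Basis. (c x \<bullet> b + - (c p \<bullet> b)) * G b (c x)))"
  proof (rule tangent_germ[OF v True oW pW])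
    fix x assume "x \<in> ?W"
    then show "f x = f p + (\<Sum>b\<in>Basis. (c x \<bullet> b + - (c p \<bullet> b)) * G b (c x))"
      using G(2)[of "c x"] chart(7)[OF V(1)] V(2) by (simp add: inner_diff_left)
  qed
  also have "\<dots> = (\<Sum>b\<in>Basis. v (\<lambda>x. c x \<bullet> b) * coord_vec V c b p f)"
    by (simp only: tangent_add[OF v sk smooth_near_sum[OF p smooth_near_mult[OF sdc sG]]]
        tangent_const[OF v p] tangent_sum[OF v p smooth_near_mult[OF sdc sG]] prod add_0)
  finally show ?thesis .
qed

lemma sum_fun_apply: "(\<Sum>i\<in>I. F i) x = (\<Sum>i\<in>I. F i x)" for F :: "'i \<Rightarrow> 'x \<Rightarrow> 'y::comm_monoid_add"
  by (induction I rule: infinite_finite_induct) simp_all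

lemma tangent_coord_sum:
  assumes "v \<in> tangent_space A p" "(V, c) \<in> A" "p \<in> V"
  shows "v = (\<Sum>b\<in>Basis. v (\<lambda>x. c x \<bullet> b) *\<^sub>R coord_vec V c b p)"
  by (rule ext, subst tangent_coord_expansion[OF assms]) (simp add: sum_fun_apply scaleR_fun_def)

lemma tangent_eqI:
  assumes "v \<in> tangent_space A p" "w \<in> tangent_space A p" "(V, c) \<in> A" "p \<in> V"
    "\<And>b. b \<in> Basis \<Longrightarrow> v (\<lambda>x. c x \<bullet> b) = w (\<lambda>x. c x \<bullet> b)"
  shows "v = w"
proof
  show "v f = w f" for f
    unfolding tangent_coord_expansion[OF assms(1,3,4), of f] tangent_coord_expansion[OF assms(2,3,4), of f]
    using assms(5) by (intro sum.cong) simp_all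
qed

lemma coord_vec_sum_coord:
  assumes V: "(V, c) \<in> A" "p \<in> V" and b: "b \<in> Basis"
  shows "(\<Sum>b'\<in>Basis. a b' *\<^sub>R coord_vec V c b' p) (\<lambda>x. c x \<bullet> b) = a b"
proof -
  have "(\<Sum>b'\<in>Basis. a b' *\<^sub>R coord_vec V c b' p) (\<lambda>x. c x \<bullet> b) = (\<Sum>b'\<in>Basis. a b' * (b' \<bullet> b))"
    by (simp add: sum_fun_apply scaleR_fun_def coord_vec_coord[OF V])
  also have "\<dots> = (\<Sum>b'\<in>Basis. if b' = b then a b' else 0)"
    using b by (intro sum.cong) (auto simp: inner_Basis)
  finally show ?thesis using b by simp
qed

end


section \<open>Smooth maps, sections along them, and the pull-back of the tangent bundle\<close>

lemma independent_familyI: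
  fixes e :: "'i \<Rightarrow> 'v::real_vector"
  assumes "finite I" "\<And>a i. (\<Sum>i\<in>I. a i *\<^sub>R e i) = 0 \<Longrightarrow> i \<in> I \<Longrightarrow> a i = 0"
  shows "inj_on e I" "independent (e ` I)"
proof -
  show inj: "inj_on e I"
  proof (rule inj_onI, rule ccontr)
    fix i j assume ij: "i \<in> I" "j \<in> I" "e i = e j" "i \<noteq> j"
    have "(\<Sum>k\<in>I. (if k = i then 1 else if k = j then -1 else 0) *\<^sub>R e k)
        = (\<Sum>k\<in>{i, j}. (if k = i then 1 else if k = j then -1 else 0) *\<^sub>R e k)"
      using ij assms(1) by (intro sum.mono_neutral_right) auto
    also have "\<dots> = 0" using ij by simp
    finally have "(if i = i then 1 else if i = j then -1 else (0::real)) = 0"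
      using assms(2)[of "\<lambda>k. if k = i then 1 else if k = j then -1 else 0" i] ij by blast
    then show False by simp
  qed
  show "independent (e ` I)"
  proof (rule independent_if_scalars_zero)
    fix f v assume 0: "(\<Sum>x\<in>e ` I. f x *\<^sub>R x) = 0" and "v \<in> e ` I"
    then obtain i where i: "i \<in> I" "v = e i" by auto
    have "(\<Sum>i\<in>I. f (e i) *\<^sub>R e i) = 0" using 0 by (simp add: sum.reindex[OF inj])
    from assms(2)[OF this i(1)] i(2) show "f v = 0" by simp
  qed (use assms in auto)
qed

lemma span_family:
  fixes e :: "'i \<Rightarrow> 'v::real_vector"
  assumes "finite I"
  shows "span (e ` I) = {\<Sum>i\<in>I. a i *\<^sub>R e i | a. True}"
proof
  let ?S = "{\<Sum>i\<in>I. a i *\<^sub>R e i | a. True}"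
  have "subspace ?S"
    unfolding subspace_def
  proof (intro conjI ballI allI)
    show "0 \<in> ?S" by (auto intro!: exI[of _ "\<lambda>_. 0"])
    show "x + y \<in> ?S" if xy: "x \<in> ?S" "y \<in> ?S" for x y
    proof -
      obtain a where "x = (\<Sum>i\<in>I. a i *\<^sub>R e i)" using xy(1) by blast
      moreover obtain b where "y = (\<Sum>i\<in>I. b i *\<^sub>R e i)" using xy(2) by blast
      ultimately have "x + y = (\<Sum>i\<in>I. (a i + b i) *\<^sub>R e i)" by (simp add: scaleR_add_left sum.distrib)
      then show ?thesis by auto
    qed
    show "c *\<^sub>R x \<in> ?S" if x: "x \<in> ?S" for c x
    proof -
      obtain a where "x = (\<Sum>i\<in>I. a i *\<^sub>R e i)" using x by blast
      then have "c *\<^sub>R x = (\<Sum>i\<in>I. (c * a i) *\<^sub>R e i)" by (simp add: scaleR_sum_right)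
      then show ?thesis by auto
    qed
  qed
  moreover have "e ` I \<subseteq> ?S"
  proof
    fix v assume "v \<in> e ` I"
    then obtain i where i: "i \<in> I" "v = e i" by auto
    have "v = (\<Sum>j\<in>I. (if j = i then 1 else 0) *\<^sub>R e j)"
      using i assms by (simp add: if_distrib[of "\<lambda>c. c *\<^sub>R _"] cong: if_cong)
    then show "v \<in> ?S" by (intro CollectI exI[of _ "\<lambda>j. if j = i then 1 else 0"]) simp
  qed
  ultimately show "span (e ` I) \<subseteq> ?S" by (rule span_minimal[rotated])
  show "?S \<subseteq> span (e ` I)" by (auto intro: span_base intro!: span_sum span_scale)
qed

text \<open>Maps are called smooth when they pull smooth functions back to smooth functions; this also
  gives continuity, as constant functions are smooth on every open set.\<close>

definition smooth_map ::
    "('m::topological_space, 'e::euclidean_space) chart set \<Rightarrow> ('n::topological_space, 'f::euclidean_space) chart set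
      \<Rightarrow> ('m \<Rightarrow> 'n) \<Rightarrow> bool" where
  "smooth_map A A' F \<longleftrightarrow> F ` points A \<subseteq> points A' \<and>
     (\<forall>W f. smooth_fun A' W f \<longrightarrow> smooth_fun A (points A \<inter> F -` W) (f \<circ> F))"

lemma differential_linear:
  "differential A' F x (a *\<^sub>R u + v) = a *\<^sub>R differential A' F x u + differential A' F x v"
  "differential A' F x (u + v) = differential A' F x u + differential A' F x v"
  "differential A' F x (a *\<^sub>R u) = a *\<^sub>R differential A' F x u"
  "differential A' F x (u - v) = differential A' F x u - differential A' F x v"
  "differential A' F x 0 = 0"
  by (auto simp: differential_def scaleR_fun_def fun_eq_iff)

lemma differential_sum: "differential A' F x (\<Sum>i\<in>I. u i) = (\<Sum>i\<in>I. differential A' F x (u i))"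
  by (induction I rule: infinite_finite_induct) (simp_all only: differential_linear sum.infinite sum.empty sum.insert not_False_eq_True)

locale smooth_mapping = M: smooth_manifold A + N: smooth_manifold A'
  for A :: "('m::{t2_space,second_countable_topology}, 'e::euclidean_space) chart set"
    and A' :: "('n::{t2_space,second_countable_topology}, 'f::euclidean_space) chart set" +
  fixes F :: "'m \<Rightarrow> 'n"
  assumes F: "smooth_map A A' F"
begin

lemma map_points: "x \<in> points A \<Longrightarrow> F x \<in> points A'"
  using F by (auto simp: smooth_map_def)

lemma pullback_smooth:
  assumes "smooth_fun A' W f" "open U" "U \<subseteq> points A"
  shows "smooth_fun A (U \<inter> F -` W) (f \<circ> F)"
proof -
  have *: "smooth_fun A (points A \<inter> F -` W) (f \<circ> F)" using F assms(1) by (auto simp: smooth_map_def)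
  have "open (U \<inter> (points A \<inter> F -` W))" using assms(2) M.smooth_fun_open[OF *] by auto
  moreover have "U \<inter> F -` W = U \<inter> (points A \<inter> F -` W)" using assms(3) by auto
  ultimately show ?thesis by (intro M.smooth_fun_subset[OF *]) auto
qed

lemma preimage_open: "open W \<Longrightarrow> W \<subseteq> points A' \<Longrightarrow> open U \<Longrightarrow> U \<subseteq> points A \<Longrightarrow> open (U \<inter> F -` W)"
  using M.smooth_fun_open[OF pullback_smooth[OF N.smooth_fun_const]] by blast

lemma pullback_smooth_near:
  assumes "x \<in> points A" "smooth_near A' (F x) f"
  shows "smooth_near A x (f \<circ> F)"
proof -
  obtain W where W: "F x \<in> W" "smooth_fun A' W f" using assms(2) by (auto simp: smooth_near_def)
  show ?thesis
    by (rule M.smooth_nearI[OF pullback_smooth[OF W(2) M.points_open order_refl]]) (use W assms in auto)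
qed

lemma differential_apply:
  "smooth_near A' (F x) f \<Longrightarrow> differential A' F x v f = v (f \<circ> F)"
  by (simp add: differential_def)

lemma differential_tangent:
  assumes "x \<in> points A" "v \<in> tangent_space A x"
  shows "differential A' F x v \<in> tangent_space A' (F x)"
proof -
  have "v ((\<lambda>y. f y + g y) \<circ> F) = v (f \<circ> F) + v (g \<circ> F)"
    "v ((\<lambda>y. f y * g y) \<circ> F) = f (F x) * v (g \<circ> F) + g (F x) * v (f \<circ> F)"
    if "smooth_near A' (F x) f" "smooth_near A' (F x) g" for f g
    using M.tangent_add[OF assms(2) pullback_smooth_near[OF assms(1) that(1)] pullback_smooth_near[OF assms(1) that(2)]]
      M.tangent_mult[OF assms(2) pullback_smooth_near[OF assms(1) that(1)] pullback_smooth_near[OF assms(1) that(2)]]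
    by (simp_all add: o_def)
  moreover have "v ((\<lambda>y. k * f y) \<circ> F) = k * v (f \<circ> F)" if "smooth_near A' (F x) f" for f k
    using M.tangent_cmult[OF assms(2) pullback_smooth_near[OF assms(1) that]] by (simp add: o_def)
  ultimately show ?thesis
    by (auto simp: tangent_space_def differential_def N.smooth_near_add N.smooth_near_mult N.smooth_near_cmult)
qed


subsection \<open>Sections along a smooth map\<close>

lemma along_open: "smooth_along A A' F U s \<Longrightarrow> open U"
  and along_points: "smooth_along A A' F U s \<Longrightarrow> U \<subseteq> points A"
  and along_tangent: "smooth_along A A' F U s \<Longrightarrow> x \<in> U \<Longrightarrow> s x \<in> tangent_space A' (F x)"
  and along_smooth: "smooth_along A A' F U s \<Longrightarrow> smooth_fun A' W f \<Longrightarrow> smooth_fun A (U \<inter> F -` W) (\<lambda>x. s x f)"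
  by (auto simp: smooth_along_def)

lemma along_smooth_near:
  assumes "smooth_along A A' F U s" "x \<in> U" "smooth_near A' (F x) f"
  shows "smooth_near A x (\<lambda>y. s y f)"
proof -
  obtain W where W: "F x \<in> W" "smooth_fun A' W f" using assms(3) by (auto simp: smooth_near_def)
  show ?thesis
    by (rule M.smooth_nearI[OF along_smooth[OF assms(1) W(2)]]) (use W assms in auto)
qed

lemma along_subset:
  assumes "smooth_along A A' F U s" "open U'" "U' \<subseteq> U"
  shows "smooth_along A A' F U' s"
  unfolding smooth_along_def
proof (intro conjI ballI allI impI)
  show "U' \<subseteq> points A" using assms along_points by (meson subset_trans)
  show "s x \<in> tangent_space A' (F x)" if "x \<in> U'" for x
    using that assms along_tangent by (meson subsetD)
  fix W f assume Wf: "smooth_fun A' W f"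
  have "smooth_fun A (U \<inter> F -` W) (\<lambda>x. s x f)" by (rule along_smooth[OF assms(1) Wf])
  moreover have "open (U' \<inter> F -` W)"
    by (rule preimage_open) (use N.smooth_fun_open[OF Wf] N.smooth_fun_points[OF Wf] assms(2) \<open>U' \<subseteq> points A\<close> in auto)
  ultimately show "smooth_fun A (U' \<inter> F -` W) (\<lambda>x. s x f)"
    by (rule M.smooth_fun_subset) (use assms(3) in auto)
qed (fact assms(2))

text \<open>The value of a section on any function is a combination of its values on coordinate functions,
  with coefficients pulled back from the target.\<close>

lemma alongI:
  assumes "open U" "U \<subseteq> points A" and t: "\<And>x. x \<in> U \<Longrightarrow> s x \<in> tangent_space A' (F x)"
    and coord: "\<And>V d b. (V, d) \<in> A' \<Longrightarrow> b \<in> Basis \<Longrightarrow> smooth_fun A (U \<inter> F -` V) (\<lambda>x. s x (\<lambda>y. d y \<bullet> b))"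
  shows "smooth_along A A' F U s"
  unfolding smooth_along_def
proof (intro conjI ballI allI impI assms(1,2) t)
  fix W f assume Wf: "smooth_fun A' W f"
  show "smooth_fun A (U \<inter> F -` W) (\<lambda>x. s x f)"
  proof (rule M.smooth_fun_local)
    fix x assume x: "x \<in> U \<inter> F -` W"
    then obtain V d where V: "(V, d) \<in> A'" "F x \<in> V"
      using map_points N.chart_at assms(2) by (metis IntD1 subsetD)
    let ?U = "U \<inter> F -` (W \<inter> V)"
    have o: "open ?U"
      by (rule preimage_open)
        (use N.smooth_fun_open[OF Wf] N.smooth_fun_points[OF Wf] N.chart(1,6)[OF V(1)] assms(1,2) in auto)
    have "smooth_fun A ?U (\<lambda>x. \<Sum>b\<in>Basis. s x (\<lambda>y. d y \<bullet> b) * N.coord_vec V d b (F x) f)"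
    proof (intro M.smooth_fun_sum M.smooth_fun_mult o)
      fix b :: 'f assume "b \<in> Basis"
      show "smooth_fun A ?U (\<lambda>x. s x (\<lambda>y. d y \<bullet> b))"
        by (rule M.smooth_fun_subset[OF coord[OF V(1) \<open>b \<in> Basis\<close>] o]) auto
      show "smooth_fun A ?U (\<lambda>x. N.coord_vec V d b (F x) f)"
        using pullback_smooth[OF N.coord_vec_smooth[OF V(1) Wf] assms(1,2)] by (simp add: o_def)
    qed (use assms(2) in auto)
    then have "smooth_fun A ?U (\<lambda>x. s x f)"
      by (rule M.smooth_fun_cong) (use N.tangent_coord_expansion[OF t V(1)] in auto)
    then show "\<exists>W'. x \<in> W' \<and> W' \<subseteq> U \<inter> F -` W \<and> smooth_fun A W' (\<lambda>x. s x f)"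
      using x V by (intro exI[of _ ?U]) auto
  qed
qed

lemma along_local:
  assumes "\<And>x. x \<in> U \<Longrightarrow> \<exists>W. x \<in> W \<and> W \<subseteq> U \<and> smooth_along A A' F W s"
  shows "smooth_along A A' F U s"
proof (rule alongI)
  show "open U" unfolding open_subopen[of U] using assms along_open by meson
  show "U \<subseteq> points A" using assms along_points by (meson subsetD subsetI)
  show "s x \<in> tangent_space A' (F x)" if "x \<in> U" for x using assms[OF that] along_tangent by auto
  fix V d and b :: 'f assume V: "(V, d) \<in> A'"
  show "smooth_fun A (U \<inter> F -` V) (\<lambda>x. s x (\<lambda>y. d y \<bullet> b))"
  proof (rule M.smooth_fun_local)
    fix x assume x: "x \<in> U \<inter> F -` V"
    then obtain W where W: "x \<in> W" "W \<subseteq> U" "smooth_along A A' F W s" using assms by blast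
    show "\<exists>W. x \<in> W \<and> W \<subseteq> U \<inter> F -` V \<and> smooth_fun A W (\<lambda>x. s x (\<lambda>y. d y \<bullet> b))"
      using along_smooth[OF W(3) N.smooth_fun_coord[OF V]] W x by (intro exI[of _ "W \<inter> F -` V"]) auto
  qed
qed

lemma along_cong:
  assumes s: "smooth_along A A' F U s" and eq: "\<And>x. x \<in> U \<Longrightarrow> s x = t x"
  shows "smooth_along A A' F U t"
proof (rule alongI[OF along_open[OF s] along_points[OF s]])
  show "t x \<in> tangent_space A' (F x)" if "x \<in> U" for x using along_tangent[OF s that] eq[OF that] by simp
  fix V d and b :: 'f assume V: "(V, d) \<in> A'"
  show "smooth_fun A (U \<inter> F -` V) (\<lambda>x. t x (\<lambda>y. d y \<bullet> b))"
    by (rule M.smooth_fun_cong[OF along_smooth[OF s N.smooth_fun_coord[OF V]]]) (simp add: eq)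
qed

lemma along_lincomb:
  assumes a: "smooth_fun A U a" and s: "smooth_along A A' F U s" and t: "smooth_along A A' F U t"
  shows "smooth_along A A' F U (\<lambda>x. a x *\<^sub>R s x + t x)"
proof (rule alongI[OF along_open[OF s] along_points[OF s]])
  show "a x *\<^sub>R s x + t x \<in> tangent_space A' (F x)" if "x \<in> U" for x
    using N.subspace_tangent along_tangent[OF s that] along_tangent[OF t that]
    by (intro subspace_add subspace_scale)
  fix V d and b :: 'f assume V: "(V, d) \<in> A'"
  note c = N.smooth_fun_coord[OF V, of b]
  have "smooth_fun A (U \<inter> F -` V) (\<lambda>x. a x * s x (\<lambda>y. d y \<bullet> b) + t x (\<lambda>y. d y \<bullet> b))"
    by (intro M.smooth_fun_add M.smooth_fun_mult along_smooth[OF s c] along_smooth[OF t c]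
        M.smooth_fun_subset[OF a] M.smooth_fun_open[OF along_smooth[OF s c]]) auto
  then show "smooth_fun A (U \<inter> F -` V) (\<lambda>x. (a x *\<^sub>R s x + t x) (\<lambda>y. d y \<bullet> b))"
    by (simp add: scaleR_fun_def)
qed

lemma along_zero:
  assumes "open U" "U \<subseteq> points A"
  shows "smooth_along A A' F U (\<lambda>x. 0)"
proof (rule alongI[OF assms])
  show "0 \<in> tangent_space A' (F x)" for x using N.subspace_tangent by (rule subspace_0)
  fix V d assume V: "(V, d) \<in> A'"
  show "smooth_fun A (U \<inter> F -` V) (\<lambda>x. 0 (\<lambda>y. d y \<bullet> b))" for b
    by (simp, intro M.smooth_fun_const preimage_open) (use assms N.chart(1,6)[OF V] in auto)
qed

lemma along_scale:
  "smooth_fun A U a \<Longrightarrow> smooth_along A A' F U s \<Longrightarrow> smooth_along A A' F U (\<lambda>x. a x *\<^sub>R s x)"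
  using along_lincomb[of U a s "\<lambda>x. 0"] along_zero[of U] by (simp add: smooth_fun_def)

lemma along_add:
  "smooth_along A A' F U s \<Longrightarrow> smooth_along A A' F U t \<Longrightarrow> smooth_along A A' F U (\<lambda>x. s x + t x)"
  using along_lincomb[of U "\<lambda>x. 1" s t] M.smooth_fun_const[of U 1] by (simp add: along_open along_points)

lemma along_sum:
  assumes "open U" "U \<subseteq> points A" "\<And>i. i \<in> I \<Longrightarrow> smooth_along A A' F U (s i)"
  shows "smooth_along A A' F U (\<lambda>x. \<Sum>i\<in>I. s i x)"
  using assms(3)
  by (induction I rule: infinite_finite_induct) (simp_all add: along_zero along_add assms(1,2))

lemma along_coord_vec:
  assumes V: "(V, d) \<in> A'"
  shows "smooth_along A A' F (points A \<inter> F -` V) (\<lambda>x. N.coord_vec V d w (F x))"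
proof (rule alongI)
  show "open (points A \<inter> F -` V)"
    by (rule preimage_open) (use N.chart(1,6)[OF V] M.points_open in auto)
  show "N.coord_vec V d w (F x) \<in> tangent_space A' (F x)" if "x \<in> points A \<inter> F -` V" for x
    using that by (intro N.coord_vec_tangent V) auto
  fix V' d' and b :: 'f assume V': "(V', d') \<in> A'"
  have "smooth_fun A (points A \<inter> F -` (V' \<inter> V)) (\<lambda>x. N.coord_vec V d w (F x) (\<lambda>y. d' y \<bullet> b))"
    using pullback_smooth[OF N.coord_vec_smooth[OF V N.smooth_fun_coord[OF V']] M.points_open order_refl]
    by (simp add: o_def)
  moreover have "points A \<inter> F -` V \<inter> F -` V' = points A \<inter> F -` (V' \<inter> V)" by auto
  ultimately show "smooth_fun A (points A \<inter> F -` V \<inter> F -` V') (\<lambda>x. N.coord_vec V d w (F x) (\<lambda>y. d' y \<bullet> b))"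
    by simp
qed auto

lemma along_differential:
  assumes X: "vector_field A U X"
  shows "smooth_along A A' F U (\<lambda>x. differential A' F x (X x))"
proof -
  have U: "open U" "U \<subseteq> points A" using X by (auto simp: smooth_along_def)
  show ?thesis
  proof (rule alongI[OF U])
    show "differential A' F x (X x) \<in> tangent_space A' (F x)" if "x \<in> U" for x
      using that X U by (intro differential_tangent) (auto simp: smooth_along_def)
    fix V d and b :: 'f assume V: "(V, d) \<in> A'"
    let ?c = "\<lambda>y. d y \<bullet> b"
    have "smooth_fun A (U \<inter> (points A \<inter> F -` V)) (\<lambda>x. X x (?c \<circ> F))"
      using X pullback_smooth[OF N.smooth_fun_coord[OF V] M.points_open order_refl]
      by (auto simp: smooth_along_def)
    then have "smooth_fun A (U \<inter> F -` V) (\<lambda>x. X x (?c \<circ> F))"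
      using U(2) by (metis inf.absorb_iff1 inf_assoc)
    then show "smooth_fun A (U \<inter> F -` V) (\<lambda>x. differential A' F x (X x) ?c)"
      by (rule M.smooth_fun_cong)
        (use N.smooth_nearI[OF N.smooth_fun_coord[OF V]] in \<open>auto simp: differential_def\<close>)
  qed
qed

text \<open>The pulled back coordinate vectors are a local frame, and the coefficients of a section in it are
  its values on the coordinate functions.\<close>

theorem vector_bundle_pullback: "vector_bundle A DIM('f) (pullback_tangent_bundle A A' F)"
proof -
  let ?V = "pullback_tangent_bundle A A' F"
  obtain \<beta> where \<beta>: "bij_betw \<beta> {..<DIM('f)} (Basis :: 'f set)"
    using ex_bij_betw_nat_finite[of "Basis :: 'f set"] by (auto simp: lessThan_atLeast0)
  note coord_sum = sum.reindex_bij_betw[OF \<beta>, symmetric]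
  have fr: "inj_on (\<lambda>i. N.coord_vec V d (\<beta> i) q) {..<DIM('f)}"
    "independent ((\<lambda>i. N.coord_vec V d (\<beta> i) q) ` {..<DIM('f)})"
    "span ((\<lambda>i. N.coord_vec V d (\<beta> i) q) ` {..<DIM('f)}) = tangent_space A' q"
    if V: "(V, d) \<in> A'" "q \<in> V" for V d q
  proof -
    let ?e = "\<lambda>i. N.coord_vec V d (\<beta> i) q"
    have "a i = 0" if 0: "(\<Sum>i<DIM('f). a i *\<^sub>R ?e i) = 0" and i: "i \<in> {..<DIM('f)}" for a i
    proof -
      define a' where "a' b = a (inv_into {..<DIM('f)} \<beta> b)" for b
      have a': "a' (\<beta> j) = a j" if "j < DIM('f)" for j
        using \<beta> that by (simp add: a'_def bij_betw_def)
      have "(\<Sum>b\<in>Basis. a' b *\<^sub>R N.coord_vec V d b q) = 0"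
        unfolding coord_sum using 0 a' by simp
      moreover have "\<beta> i \<in> Basis" using \<beta> i by (auto simp: bij_betw_def)
      ultimately show ?thesis using N.coord_vec_sum_coord[OF V, of "\<beta> i" a'] a' i by simp
    qed
    then show "inj_on ?e {..<DIM('f)}" "independent (?e ` {..<DIM('f)})"
      using independent_familyI[of "{..<DIM('f)}" ?e] by blast+
    have "v \<in> span (?e ` {..<DIM('f)})" if "v \<in> tangent_space A' q" for v
      unfolding span_family[OF finite_lessThan]
      by (rule CollectI, rule exI[of _ "\<lambda>i. v (\<lambda>y. d y \<bullet> \<beta> i)"])
        (use N.tangent_coord_sum[OF that V] in \<open>simp add: coord_sum\<close>)
    moreover have "span (?e ` {..<DIM('f)}) \<subseteq> tangent_space A' q"
      by (rule span_minimal[OF _ N.subspace_tangent]) (use N.coord_vec_tangent[OF V] in auto)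
    ultimately show "span (?e ` {..<DIM('f)}) = tangent_space A' q" by auto
  qed
  show ?thesis
    unfolding vector_bundle_def
  proof (intro conjI ballI allI)
    fix x assume x: "x \<in> points A"
    then obtain V d where V: "(V, d) \<in> A'" "F x \<in> V" using map_points N.chart_at by metis
    show "subspace (fib ?V x)" using N.subspace_tangent by (simp add: pullback_tangent_bundle_def)
    show "dim (fib ?V x) = DIM('f)"
      using dim_eq_card[OF _ fr(2)[OF V], of "tangent_space A' (F x)"] fr(3)[OF V] card_image[OF fr(1)[OF V]]
        span_eq_iff[THEN iffD2, OF N.subspace_tangent[of "F x"]]
      by (simp add: pullback_tangent_bundle_def)
  next
    fix U s
    show "sec ?V U s = (open U \<and> U \<subseteq> points A \<and> (\<forall>x\<in>U. \<exists>W. x \<in> W \<and> W \<subseteq> U \<and> sec ?V W s))"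
      using along_local[of U s] along_open[of U s] along_points[of U s]
      by (auto simp: pullback_tangent_bundle_def)
  next
    fix p assume p: "p \<in> points A"
    then obtain V d where V: "(V, d) \<in> A'" "F p \<in> V" using map_points N.chart_at by metis
    let ?W = "points A \<inter> F -` V" and ?e = "\<lambda>i x. N.coord_vec V d (\<beta> i) (F x)"
    have W: "open ?W" by (rule along_open[OF along_coord_vec[OF V(1)]])
    have secs: "smooth_along A A' F U s \<longleftrightarrow>
       (\<exists>a. (\<forall>i<DIM('f). smooth_fun A U (a i)) \<and> (\<forall>x\<in>U. s x = (\<Sum>i<DIM('f). a i x *\<^sub>R ?e i x)))"
      if U: "open U" "U \<subseteq> ?W" for U s
    proof
      assume s: "smooth_along A A' F U s"
      have "smooth_fun A U (\<lambda>x. s x (\<lambda>y. d y \<bullet> b))" for b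
        using along_smooth[OF s N.smooth_fun_coord[OF V(1)], of b] U by (simp add: inf_absorb1)
      moreover have "s x = (\<Sum>i<DIM('f). s x (\<lambda>y. d y \<bullet> \<beta> i) *\<^sub>R ?e i x)" if "x \<in> U" for x
        using N.tangent_coord_sum[OF along_tangent[OF s that] V(1)] U that unfolding coord_sum by auto
      ultimately show "\<exists>a. (\<forall>i<DIM('f). smooth_fun A U (a i)) \<and> (\<forall>x\<in>U. s x = (\<Sum>i<DIM('f). a i x *\<^sub>R ?e i x))"
        by (intro exI[of _ "\<lambda>i x. s x (\<lambda>y. d y \<bullet> \<beta> i)"]) auto
    next
      assume "\<exists>a. (\<forall>i<DIM('f). smooth_fun A U (a i)) \<and> (\<forall>x\<in>U. s x = (\<Sum>i<DIM('f). a i x *\<^sub>R ?e i x))"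
      then obtain a where a: "\<And>i. i < DIM('f) \<Longrightarrow> smooth_fun A U (a i)"
        "\<And>x. x \<in> U \<Longrightarrow> s x = (\<Sum>i<DIM('f). a i x *\<^sub>R ?e i x)" by auto
      have "smooth_along A A' F U (\<lambda>x. \<Sum>i<DIM('f). a i x *\<^sub>R ?e i x)"
        by (intro along_sum along_scale a along_subset[OF along_coord_vec[OF V(1)]] U) (use U in auto)
      then show "smooth_along A A' F U s" by (rule along_cong) (simp add: a(2))
    qed
    show "\<exists>W e. open W \<and> p \<in> W \<and> W \<subseteq> points A \<and>
        (\<forall>x\<in>W. inj_on (\<lambda>i. e i x) {..<DIM('f)} \<and> independent ((\<lambda>i. e i x) ` {..<DIM('f)}) \<and>
               span ((\<lambda>i. e i x) ` {..<DIM('f)}) = fib ?V x) \<and>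
        (\<forall>U s. open U \<and> U \<subseteq> W \<longrightarrow>
           (sec ?V U s \<longleftrightarrow>
             (\<exists>a. (\<forall>i<DIM('f). smooth_fun A U (a i)) \<and> (\<forall>x\<in>U. s x = (\<Sum>i<DIM('f). a i x *\<^sub>R e i x)))))"
      using W p V fr[OF V(1)] secs
      by (intro exI[of _ ?W] exI[of _ ?e]) (simp add: pullback_tangent_bundle_def)
  qed
qed

end

context smooth_manifold
begin

lemma smooth_mapping_ident: "smooth_mapping A A (\<lambda>x. x)"
proof unfold_locales
  show "smooth_map A A (\<lambda>x. x)"
    using smooth_fun_points by (auto simp: smooth_map_def o_def inf.absorb2)
qed

sublocale ident: smooth_mapping A A "\<lambda>x. x" by (rule smooth_mapping_ident)

lemma field_smooth: "vector_field A U X \<Longrightarrow> smooth_fun A U f \<Longrightarrow> smooth_fun A U (\<lambda>x. X x f)"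
  using ident.along_smooth[of U X U f] by simp

text \<open>Identities for vector fields yield identities for tangent vectors by extending the latter with
  constant coefficients in a chart.\<close>

lemma vector_field_at:
  assumes "p \<in> points A" "v \<in> tangent_space A p"
  obtains U X where "p \<in> U" "vector_field A U X" "X p = v"
proof -
  obtain V c where V: "(V, c) \<in> A" "p \<in> V" using chart_at assms(1) by blast
  let ?X = "\<lambda>q. \<Sum>b\<in>Basis. v (\<lambda>x. c x \<bullet> b) *\<^sub>R coord_vec V c b q"
  have "smooth_along A A (\<lambda>x. x) V (coord_vec V c b)" for b
    using ident.along_coord_vec[OF V(1), of b] chart(6)[OF V(1)] by (simp add: inf_absorb2)
  then have "vector_field A V ?X"
    by (intro ident.along_sum ident.along_scale smooth_fun_const chart(1,6)[OF V(1)])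
  then show ?thesis using that[of V ?X] V tangent_coord_sum[OF assms(2) V] by simp
qed

text \<open>A coordinate field is cut off by a bump function. The support is compact, hence closed since the
  space is Hausdorff, so the extension by \<open>0\<close> is smooth.\<close>

lemma global_vector_field:
  assumes "p \<in> points A"
  obtains X where "vector_field A (points A) X" "X p \<noteq> 0"
proof -
  obtain V c where V: "(V, c) \<in> A" "p \<in> V" using chart_at assms(1) by blast
  obtain r where r: "r > 0" "cball (c p) r \<subseteq> c ` V"
    using chart(2)[OF V(1)] V(2) by (meson imageI open_contains_cball)
  obtain \<beta> where \<beta>: "smooth_on UNIV \<beta>" "\<beta> (c p) > (0::real)" "\<And>y. y \<notin> ball (c p) r \<Longrightarrow> \<beta> y = 0"
    using smooth_bump[OF r(1)] by blast
  obtain b :: 'e where b: "b \<in> Basis" using nonempty_Basis by blast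
  define X where "X q = (if q \<in> V then \<beta> (c q) *\<^sub>R coord_vec V c b q else 0)" for q
  let ?K = "inv_into V c ` cball (c p) r"
  have "compact ?K"
    by (rule compact_continuous_image[OF continuous_on_subset[OF chart(5)[OF V(1)] r(2)]]) simp
  then have K: "closed ?K" by (rule compact_imp_closed)
  have KV: "q \<in> ?K" if "q \<in> V" "c q \<in> cball (c p) r" for q
    using that chart(7)[OF V(1)] by (metis imageI)
  have onV: "vector_field A V X"
  proof (rule ident.along_cong)
    show "smooth_along A A (\<lambda>x. x) V (\<lambda>q. \<beta> (c q) *\<^sub>R coord_vec V c b q)"
    proof (rule ident.along_scale)
      show "smooth_fun A V (\<lambda>q. \<beta> (c q))" using smooth_fun_in_chart[OF V(1) \<beta>(1) open_UNIV] by simp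
      show "smooth_along A A (\<lambda>x. x) V (coord_vec V c b)"
        using ident.along_coord_vec[OF V(1), of b] chart(6)[OF V(1)] by (simp add: inf_absorb2)
    qed
  qed (simp add: X_def)
  have off: "vector_field A (points A - ?K) X"
  proof (rule ident.along_cong)
    show "smooth_along A A (\<lambda>x. x) (points A - ?K) (\<lambda>q. 0)"
      using points_open K by (intro ident.along_zero) auto
    show "0 = X q" if "q \<in> points A - ?K" for q
    proof (cases "q \<in> V")
      case True
      then have "c q \<notin> cball (c p) r" using that KV[of q] by blast
      then have "c q \<notin> ball (c p) r" using ball_subset_cball by blast
      from \<beta>(3)[OF this] show ?thesis by (simp add: X_def)
    qed (simp add: X_def)
  qed
  have "vector_field A (points A) X"
  proof (rule ident.along_local)
    fix x assume "x \<in> points A"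
    moreover have "?K \<subseteq> V" using r(2) by (auto simp: inv_into_into)
    ultimately have "x \<in> V \<or> x \<in> points A - ?K" by auto
    then show "\<exists>W. x \<in> W \<and> W \<subseteq> points A \<and> vector_field A W X"
      using onV off chart(6)[OF V(1)] by blast
  qed
  moreover have "X p (\<lambda>x. c x \<bullet> b) = \<beta> (c p)"
    using V b by (simp add: X_def scaleR_fun_def coord_vec_coord)
  ultimately show ?thesis using that[of X] \<beta>(2) by fastforce
qed

text \<open>The mixed terms \<open>X(f) Y(g)\<close> of the iterated product rule are symmetric in \<open>X\<close> and \<open>Y\<close>.\<close>

lemma lie_bracket_tangent:
  assumes X: "vector_field A U X" and Y: "vector_field A U Y" and p: "p \<in> U"
  shows "lie_bracket A X Y p \<in> tangent_space A p"
proof -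
  have U: "open U" "U \<subseteq> points A" using X by (auto simp: smooth_along_def)
  have half: "X p (\<lambda>q. Y q (\<lambda>x. f x + g x)) = X p (\<lambda>q. Y q f) + X p (\<lambda>q. Y q g)"
    "X p (\<lambda>q. Y q (\<lambda>x. f x * g x)) = f p * X p (\<lambda>q. Y q g) + Y p g * X p f + g p * X p (\<lambda>q. Y q f) + Y p f * X p g"
    "X p (\<lambda>q. Y q (\<lambda>x. k * f x)) = k * X p (\<lambda>q. Y q f)"
    if X: "vector_field A U X" and Y: "vector_field A U Y" and fg: "smooth_near A p f" "smooth_near A p g"
    for X Y f g k
  proof -
    note Xp = ident.along_tangent[OF X p]
    obtain W0 where W0: "p \<in> W0" "smooth_fun A W0 f" "smooth_fun A W0 g"
      using smooth_near_common[OF fg] by blast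
    define W where "W = W0 \<inter> U"
    have W: "open W" "p \<in> W" "W \<subseteq> U" and nf: "\<And>q. q \<in> W \<Longrightarrow> smooth_near A q f"
      and ng: "\<And>q. q \<in> W \<Longrightarrow> smooth_near A q g"
      using W0 p U smooth_fun_open smooth_nearI by (auto simp: W_def)
    have Yq: "Y q \<in> tangent_space A q" if "q \<in> W" for q using ident.along_tangent[OF Y] that W by auto
    note n = ident.along_smooth_near[OF Y p]
    have nsum: "smooth_near A p (\<lambda>x. f x + g x)" and nprod: "smooth_near A p (\<lambda>x. f x * g x)"
      and nk: "smooth_near A p (\<lambda>x. k * f x)"
      using fg by (auto intro: smooth_near_add smooth_near_mult smooth_near_cmult)
    have "X p (\<lambda>q. Y q (\<lambda>x. f x + g x)) = X p (\<lambda>q. Y q f + Y q g)"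
      by (rule tangent_germ[OF Xp n[OF nsum] W(1,2)]) (rule tangent_add[OF Yq nf ng])
    then show "X p (\<lambda>q. Y q (\<lambda>x. f x + g x)) = X p (\<lambda>q. Y q f) + X p (\<lambda>q. Y q g)"
      by (simp only: tangent_add[OF Xp n[OF fg(1)] n[OF fg(2)]])
    have "X p (\<lambda>q. Y q (\<lambda>x. f x * g x)) = X p (\<lambda>q. f q * Y q g + g q * Y q f)"
      by (rule tangent_germ[OF Xp n[OF nprod] W(1,2)]) (rule tangent_mult[OF Yq nf ng])
    then show "X p (\<lambda>q. Y q (\<lambda>x. f x * g x)) = f p * X p (\<lambda>q. Y q g) + Y p g * X p f + g p * X p (\<lambda>q. Y q f) + Y p f * X p g"
      by (simp only: tangent_add[OF Xp smooth_near_mult[OF fg(1) n[OF fg(2)]] smooth_near_mult[OF fg(2) n[OF fg(1)]]]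
          tangent_mult[OF Xp fg(1) n[OF fg(2)]] tangent_mult[OF Xp fg(2) n[OF fg(1)]] add_ac)
    have "X p (\<lambda>q. Y q (\<lambda>x. k * f x)) = X p (\<lambda>q. k * Y q f)"
      by (rule tangent_germ[OF Xp n[OF nk] W(1,2)]) (rule tangent_cmult[OF Yq nf])
    then show "X p (\<lambda>q. Y q (\<lambda>x. k * f x)) = k * X p (\<lambda>q. Y q f)"
      by (simp only: tangent_cmult[OF Xp n[OF fg(1)]])
  qed
  show ?thesis
    unfolding tangent_space_def lie_bracket_def
    using half[OF X Y] half[OF Y X]
    by (simp add: smooth_near_add smooth_near_mult smooth_near_cmult algebra_simps)
qed

text \<open>The bracket is not linear over functions: the term \<open>Y(a) X\<close> records the failure.\<close>

lemma lie_bracket_sum: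
  assumes I: "finite I" and X: "vector_field A U X" and Xi: "\<And>i. i \<in> I \<Longrightarrow> vector_field A U (X' i)"
    and Y: "vector_field A U Y" and a: "\<And>i. i \<in> I \<Longrightarrow> smooth_fun A U (a i)"
    and eq: "\<And>q. q \<in> U \<Longrightarrow> X q = (\<Sum>i\<in>I. a i q *\<^sub>R X' i q)" and p: "p \<in> U"
  shows "lie_bracket A X Y p = (\<Sum>i\<in>I. a i p *\<^sub>R lie_bracket A (X' i) Y p - Y p (a i) *\<^sub>R X' i p)"
proof
  fix f
  have U: "open U" "U \<subseteq> points A" using X by (auto simp: smooth_along_def)
  show "lie_bracket A X Y p f = (\<Sum>i\<in>I. a i p *\<^sub>R lie_bracket A (X' i) Y p - Y p (a i) *\<^sub>R X' i p) f"
  proof (cases "smooth_near A p f")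
    case True
    note Yp = ident.along_tangent[OF Y p]
    note n = ident.along_smooth_near[OF Xi p True]
    note na = smooth_nearI[OF a p]
    have "Y p (\<lambda>q. X q f) = Y p (\<lambda>q. \<Sum>i\<in>I. a i q * X' i q f)"
      by (rule tangent_germ[OF Yp ident.along_smooth_near[OF X p True] U(1) p])
        (simp add: eq sum_fun_apply scaleR_fun_def)
    also have "\<dots> = (\<Sum>i\<in>I. Y p (\<lambda>q. a i q * X' i q f))"
      using p U(2) by (intro tangent_sum[OF Yp] smooth_near_mult n na) auto
    also have "\<dots> = (\<Sum>i\<in>I. a i p * Y p (\<lambda>q. X' i q f) + X' i p f * Y p (a i))"
      by (intro sum.cong refl tangent_mult[OF Yp] n na)
    finally have "Y p (\<lambda>q. X q f) = (\<Sum>i\<in>I. a i p * Y p (\<lambda>q. X' i q f) + X' i p f * Y p (a i))" .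
    moreover have "X p (\<lambda>q. Y q f) = (\<Sum>i\<in>I. a i p * X' i p (\<lambda>q. Y q f))"
      by (simp add: eq[OF p] sum_fun_apply scaleR_fun_def)
    ultimately show ?thesis
      using True by (simp add: lie_bracket_def sum_fun_apply scaleR_fun_def sum_subtractf sum.distrib algebra_simps)
  next
    case False
    then show ?thesis
      using tangent_not_smooth[OF ident.along_tangent[OF Xi p] False]
      by (simp add: lie_bracket_def sum_fun_apply scaleR_fun_def)
  qed
qed

end


section \<open>Symmetric bilinear forms and orthonormal families\<close>

locale inner_form =
  fixes E :: "'v::real_vector set" and h :: "'v \<Rightarrow> 'v \<Rightarrow> real"
  assumes E: "subspace E"
    and sym: "u \<in> E \<Longrightarrow> v \<in> E \<Longrightarrow> h u v = h v u"
    and lin: "u \<in> E \<Longrightarrow> v \<in> E \<Longrightarrow> w \<in> E \<Longrightarrow> h (a *\<^sub>R u + v) w = a * h u w + h v w"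
begin

lemmas E_add = subspace_add[OF E] and E_scale = subspace_scale[OF E] and E_diff = subspace_diff[OF E]
  and E_zero = subspace_0[OF E]

lemma add_left: "u \<in> E \<Longrightarrow> v \<in> E \<Longrightarrow> w \<in> E \<Longrightarrow> h (u + v) w = h u w + h v w"
  using lin[of u v w 1] by simp

lemma zero_left: "w \<in> E \<Longrightarrow> h 0 w = 0"
  using lin[of 0 0 w 1] E_zero by simp

lemma scale_left: "u \<in> E \<Longrightarrow> w \<in> E \<Longrightarrow> h (a *\<^sub>R u) w = a * h u w"
  using lin[of u 0 w a] E_zero zero_left[of w] by simp

lemma diff_left: "u \<in> E \<Longrightarrow> v \<in> E \<Longrightarrow> w \<in> E \<Longrightarrow> h (u - v) w = h u w - h v w"
  using lin[of v u w "-1"] by simp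

lemma sum_left: "(\<And>i. i \<in> I \<Longrightarrow> u i \<in> E) \<Longrightarrow> w \<in> E \<Longrightarrow> h (\<Sum>i\<in>I. u i) w = (\<Sum>i\<in>I. h (u i) w)"
  by (induction I rule: infinite_finite_induct) (simp_all add: zero_left add_left subspace_sum[OF E])

lemma add_right: "u \<in> E \<Longrightarrow> v \<in> E \<Longrightarrow> w \<in> E \<Longrightarrow> h w (u + v) = h w u + h w v"
  using add_left E_add by (simp add: sym[of w])

lemma zero_right: "w \<in> E \<Longrightarrow> h w 0 = 0"
  using zero_left E_zero by (simp add: sym[of w])

lemma scale_right: "u \<in> E \<Longrightarrow> w \<in> E \<Longrightarrow> h w (a *\<^sub>R u) = a * h w u"
  using scale_left E_scale by (simp add: sym[of w])

lemma diff_right: "u \<in> E \<Longrightarrow> v \<in> E \<Longrightarrow> w \<in> E \<Longrightarrow> h w (u - v) = h w u - h w v"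
  using diff_left E_diff by (simp add: sym[of w])

lemma sum_right: "(\<And>i. i \<in> I \<Longrightarrow> u i \<in> E) \<Longrightarrow> w \<in> E \<Longrightarrow> h w (\<Sum>i\<in>I. u i) = (\<Sum>i\<in>I. h w (u i))"
  by (induction I rule: infinite_finite_induct) (simp_all add: zero_right add_right subspace_sum[OF E])

lemmas bilinear = add_left scale_left diff_left zero_left add_right scale_right diff_right zero_right

lemma pos_def:
  assumes "has_signature E h n 0" "u \<in> E" "u \<noteq> 0"
  shows "h u u > 0"
proof -
  obtain e :: "nat \<Rightarrow> 'v" where "\<forall>i<n. e i \<in> E" "span (e ` {..<n}) = E"
    "\<forall>i<n. \<forall>j<n. h (e i) (e j) = (if i \<noteq> j then 0 else if i < n then 1 else -1)"
    using assms(1) unfolding has_signature_def add_0_right by blast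
  then have e: "\<And>i. i < n \<Longrightarrow> e i \<in> E" "span (e ` {..<n}) = E"
    "\<And>i j. i < n \<Longrightarrow> j < n \<Longrightarrow> h (e i) (e j) = (if i \<noteq> j then 0 else 1)"
    by simp_all
  obtain a where a: "u = (\<Sum>i<n. a i *\<^sub>R e i)"
    using assms(2) e(2) span_family[OF finite_lessThan, of e n] by blast
  have "h (\<Sum>i<n. a i *\<^sub>R e i) (\<Sum>j<n. a j *\<^sub>R e j) = (\<Sum>i<n. h (a i *\<^sub>R e i) (\<Sum>j<n. a j *\<^sub>R e j))"
    using e(1) by (intro sum_left E_scale subspace_sum[OF E]) auto
  also have "\<dots> = (\<Sum>i<n. a i * a i)"
  proof (rule sum.cong[OF refl])
    fix i assume "i \<in> {..<n}"
    then have i: "i < n" by simp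
    have "h (a i *\<^sub>R e i) (\<Sum>j<n. a j *\<^sub>R e j) = (\<Sum>j<n. h (a i *\<^sub>R e i) (a j *\<^sub>R e j))"
      using e(1) i by (intro sum_right E_scale) auto
    also have "\<dots> = (\<Sum>j<n. if j = i then a i * a i else 0)"
      using e i by (intro sum.cong) (auto simp: scale_left scale_right E_scale)
    finally show "h (a i *\<^sub>R e i) (\<Sum>j<n. a j *\<^sub>R e j) = a i * a i" using i by simp
  qed
  finally have h: "h u u = (\<Sum>i<n. a i * a i)" using a by simp
  have "\<exists>i<n. a i \<noteq> 0" using a assms(3) by (metis (no_types, lifting) lessThan_iff scale_eq_0_iff sum.neutral)
  then show ?thesis unfolding h by (auto intro!: sum_pos2 simp: zero_less_mult_iff)
qed

text \<open>An orthonormal family of the right length is a basis, by comparing with the basis that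
  witnesses the signature.\<close>

lemma orthonormal_expansion:
  assumes sig: "has_signature E h n 0" and e: "\<And>i. i < n \<Longrightarrow> e i \<in> E"
    "\<And>i j. i < n \<Longrightarrow> j < n \<Longrightarrow> h (e i) (e j) = (if i = j then 1 else 0)" and u: "u \<in> E"
  shows "u = (\<Sum>i<n. h u (e i) *\<^sub>R e i)"
proof -
  have coeff: "h (\<Sum>i<n. a i *\<^sub>R e i) (e j) = a j" if "j < n" for a j
  proof -
    have "h (\<Sum>i<n. a i *\<^sub>R e i) (e j) = (\<Sum>i<n. h (a i *\<^sub>R e i) (e j))"
      using e(1) that by (intro sum_left E_scale) auto
    also have "\<dots> = (\<Sum>i<n. if i = j then a j else 0)"
      using e that by (intro sum.cong) (auto simp: scale_left)
    finally show ?thesis using that by simp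
  qed
  have "a i = 0" if "(\<Sum>i<n. a i *\<^sub>R e i) = 0" "i \<in> {..<n}" for a i
    using coeff[of i a] zero_left[of "e i"] e(1)[of i] that by simp
  then have ind: "inj_on e {..<n}" "independent (e ` {..<n})"
    using independent_familyI[of "{..<n}" e] by blast+
  have "u \<in> span (e ` {..<n})"
  proof (rule ccontr)
    assume nu: "u \<notin> span (e ` {..<n})"
    then have i: "independent (insert u (e ` {..<n}))" using ind(2) by (simp add: independent_insert)
    obtain f :: "nat \<Rightarrow> 'v" where f: "span (f ` {..<n}) = E" using sig by (auto simp: has_signature_def)
    have "insert u (e ` {..<n}) \<subseteq> span (f ` {..<n})" using u e(1) f by auto
    then have "card (insert u (e ` {..<n})) \<le> card (f ` {..<n})"
      using independent_span_bound[OF _ i] by auto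
    also have "\<dots> \<le> n" using card_image_le[of "{..<n}" f] by simp
    moreover have "u \<notin> e ` {..<n}" using nu span_base[of u "e ` {..<n}"] by blast
    ultimately show False using card_image[OF ind(1)] by simp
  qed
  then obtain a where "u = (\<Sum>i<n. a i *\<^sub>R e i)" unfolding span_family[OF finite_lessThan] by blast
  then show ?thesis using coeff[of _ a] by simp
qed

text \<open>\<open>Le\<close> and \<open>Lf\<close> stand for the values of a linear map on the two families; linearity enters only
  through the expansion of \<open>Le\<close>, which is how the curvature will provide it.\<close>

lemma trace_frame_independent:
  assumes sig: "has_signature E h n 0"
    and e: "\<And>i. i < n \<Longrightarrow> e i \<in> E" "\<And>i j. i < n \<Longrightarrow> j < n \<Longrightarrow> h (e i) (e j) = (if i = j then 1 else 0)"
    and f: "\<And>i. i < n \<Longrightarrow> f i \<in> E" and Lf: "\<And>j. j < n \<Longrightarrow> Lf j \<in> E"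
    and Le: "\<And>i. i < n \<Longrightarrow> Le i = (\<Sum>j<n. h (e i) (f j) *\<^sub>R Lf j)"
  shows "(\<Sum>i<n. h (Le i) (e i)) = (\<Sum>j<n. h (Lf j) (f j))"
proof -
  have "(\<Sum>i<n. h (Le i) (e i)) = (\<Sum>i<n. \<Sum>j<n. h (Lf j) (h (f j) (e i) *\<^sub>R e i))"
  proof (rule sum.cong[OF refl])
    fix i assume "i \<in> {..<n}"
    then have i: "i < n" by simp
    have "h (Le i) (e i) = (\<Sum>j<n. h (h (e i) (f j) *\<^sub>R Lf j) (e i))"
      unfolding Le[OF i] using e(1)[OF i] Lf by (intro sum_left E_scale) auto
    also have "\<dots> = (\<Sum>j<n. h (Lf j) (h (f j) (e i) *\<^sub>R e i))"
      using e(1)[OF i] Lf f by (intro sum.cong) (auto simp: scale_left scale_right sym[of "e i"])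
    finally show "h (Le i) (e i) = (\<Sum>j<n. h (Lf j) (h (f j) (e i) *\<^sub>R e i))" .
  qed
  also have "\<dots> = (\<Sum>j<n. \<Sum>i<n. h (Lf j) (h (f j) (e i) *\<^sub>R e i))" by (rule sum.swap)
  also have "\<dots> = (\<Sum>j<n. h (Lf j) (\<Sum>i<n. h (f j) (e i) *\<^sub>R e i))"
    using e(1) Lf by (intro sum.cong refl sum_right[symmetric] E_scale) auto
  also have "\<dots> = (\<Sum>j<n. h (Lf j) (f j))"
    using orthonormal_expansion[OF sig e f] by (intro sum.cong) auto
  finally show ?thesis .
qed

end


section \<open>Local orthonormal frames\<close>

context smooth_manifold
begin

lemma metric_form:
  assumes "bundle_metric A V h p q" "\<And>x. x \<in> points A \<Longrightarrow> subspace (fib V x)" "x \<in> points A"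
  shows "inner_form (fib V x) (h x)"
  using assms unfolding bundle_metric_def by unfold_locales blast+

lemma tangent_metric_form:
  assumes "bundle_metric A (tangent_bundle A) g p q" "x \<in> points A"
  shows "inner_form (tangent_space A x) (g x)"
  using metric_form[OF assms(1) _ assms(2)] subspace_tangent by (simp add: pullback_tangent_bundle_def)

lemma metric_smooth:
  assumes "bundle_metric A (tangent_bundle A) g p q" "vector_field A U X" "vector_field A U Y"
  shows "smooth_fun A U (\<lambda>x. g x (X x) (Y x))"
  using assms by (auto simp: bundle_metric_def pullback_tangent_bundle_def)

text \<open>Gram--Schmidt, applied pointwise to a local frame, keeps the fields smooth.\<close>

lemma local_orthonormal_frame:
  assumes g: "riemannian_metric A g" and p: "p \<in> points A"
  obtains U E where "p \<in> U" "orthonormal_frame A g U E"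
proof -
  let ?n = "DIM('e)"
  have gm: "bundle_metric A (tangent_bundle A) g ?n 0" using g by (simp add: riemannian_metric_def)
  note form = tangent_metric_form[OF gm]
  have sig: "has_signature (tangent_space A x) (g x) ?n 0" if "x \<in> points A" for x
    using gm that by (auto simp: bundle_metric_def pullback_tangent_bundle_def)
  have "\<exists>W e. open W \<and> p \<in> W \<and> W \<subseteq> points A \<and>
      (\<forall>x\<in>W. inj_on (\<lambda>i. e i x) {..<?n} \<and> independent ((\<lambda>i. e i x) ` {..<?n}) \<and>
        span ((\<lambda>i. e i x) ` {..<?n}) = tangent_space A x) \<and>
      (\<forall>U s. open U \<and> U \<subseteq> W \<longrightarrow> (vector_field A U s \<longleftrightarrow>
        (\<exists>a. (\<forall>i<?n. smooth_fun A U (a i)) \<and> (\<forall>x\<in>U. s x = (\<Sum>i<?n. a i x *\<^sub>R e i x)))))"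
    using bspec[OF ident.vector_bundle_pullback[unfolded vector_bundle_def, THEN conjunct2, THEN conjunct2] p]
    by (simp only: pullback_tangent_bundle_def vbundle.simps)
  then obtain W e where W: "open W" "p \<in> W" "W \<subseteq> points A"
    and frame: "\<forall>x\<in>W. inj_on (\<lambda>i. e i x) {..<?n} \<and> independent ((\<lambda>i. e i x) ` {..<?n}) \<and>
        span ((\<lambda>i. e i x) ` {..<?n}) = tangent_space A x"
    and sections: "\<forall>U s. open U \<and> U \<subseteq> W \<longrightarrow> (vector_field A U s \<longleftrightarrow>
        (\<exists>a. (\<forall>i<?n. smooth_fun A U (a i)) \<and> (\<forall>x\<in>U. s x = (\<Sum>i<?n. a i x *\<^sub>R e i x))))"
    by (elim exE conjE) (rule that)
  have ie: "inj_on (\<lambda>i. e i x) {..<?n}" "independent ((\<lambda>i. e i x) ` {..<?n})"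
    if "x \<in> W" for x using frame that by auto
  have e: "vector_field A W (e k)" if "k < ?n" for k
  proof -
    have "e k x = (\<Sum>i<?n. (if i = k then 1 else 0) *\<^sub>R e i x)" for x
      using that by (simp add: if_distrib[of "\<lambda>c. c *\<^sub>R _"] cong: if_cong)
    then show ?thesis
      using sections[rule_format, of W "e k"] W
      by (auto intro!: exI[of _ "\<lambda>i x. if i = k then 1 else 0"] smooth_fun_const)
  qed
  have "\<exists>E. (\<forall>i<k. vector_field A W (E i)) \<and>
      (\<forall>x\<in>W. \<forall>i<k. E i x \<in> span ((\<lambda>i. e i x) ` {..<k})) \<and>
      (\<forall>x\<in>W. \<forall>i<k. \<forall>j<k. g x (E i x) (E j x) = (if i = j then 1 else 0))" if "k \<le> ?n" for k
    using that
  proof (induction k)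
    case (Suc k)
    then have "k \<le> ?n" by simp
    from Suc.IH[OF this] obtain E where "\<forall>i<k. vector_field A W (E i)"
      "\<forall>x\<in>W. \<forall>i<k. E i x \<in> span ((\<lambda>i. e i x) ` {..<k})"
      "\<forall>x\<in>W. \<forall>i<k. \<forall>j<k. g x (E i x) (E j x) = (if i = j then 1 else 0)"
      by (elim exE conjE) (rule that)
    then have E: "\<And>i. i < k \<Longrightarrow> vector_field A W (E i)"
      "\<And>x i. x \<in> W \<Longrightarrow> i < k \<Longrightarrow> E i x \<in> span ((\<lambda>i. e i x) ` {..<k})"
      "\<And>x i j. x \<in> W \<Longrightarrow> i < k \<Longrightarrow> j < k \<Longrightarrow> g x (E i x) (E j x) = (if i = j then 1 else 0)"
      by simp_all
    have k: "k < ?n" using Suc.prems by simp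
    define P where "P x = (\<Sum>i<k. g x (e k x) (E i x) *\<^sub>R E i x)" for x
    define Y where "Y x = (-1) *\<^sub>R P x + e k x" for x
    define N where "N x = g x (Y x) (Y x)" for x
    have sP: "vector_field A W P"
      unfolding P_def using E(1)
      by (intro ident.along_sum ident.along_scale metric_smooth[OF gm] e[OF k] W) auto
    have sY: "vector_field A W Y"
      unfolding Y_def by (intro ident.along_lincomb smooth_fun_const W sP e[OF k])
    have sN: "smooth_fun A W N" unfolding N_def by (intro metric_smooth[OF gm] sY)
    have Pspan: "P x \<in> span ((\<lambda>i. e i x) ` {..<k})" if "x \<in> W" for x
      unfolding P_def using E(2)[OF that] by (intro span_sum span_scale) auto
    have mono: "span ((\<lambda>i. e i x) ` {..<k}) \<subseteq> span ((\<lambda>i. e i x) ` {..<Suc k})" for x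
      by (intro span_mono) auto
    have Yspan: "Y x \<in> span ((\<lambda>i. e i x) ` {..<Suc k})" if "x \<in> W" for x
      unfolding Y_def using Pspan[OF that] mono by (intro span_add span_scale) (auto intro: span_base)
    have Y0: "Y x \<noteq> 0" if x: "x \<in> W" for x
    proof
      assume "Y x = 0"
      then have "e k x \<in> span ((\<lambda>i. e i x) ` {..<k})" using Pspan[OF x] by (simp add: Y_def)
      moreover have "(\<lambda>i. e i x) ` {..<k} \<subseteq> (\<lambda>i. e i x) ` {..<?n} - {e k x}"
        using inj_onD[OF ie(1)[OF x]] k by fastforce
      ultimately have "e k x \<in> span ((\<lambda>i. e i x) ` {..<?n} - {e k x})" using span_mono by blast
      then show False using ie(2)[OF x] k unfolding dependent_def by blast
    qed
    have Npos: "N x > 0" if "x \<in> W" for x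
      unfolding N_def using that W Y0[OF that]
      by (intro inner_form.pos_def[OF form sig] ident.along_tangent[OF sY]) auto
    have orth: "g x (Y x) (E j x) = 0" if x: "x \<in> W" and j: "j < k" for x j
    proof -
      interpret G: inner_form "tangent_space A x" "g x" using form x W by auto
      have t: "E i x \<in> tangent_space A x" if "i < k" for i using ident.along_tangent[OF E(1)[OF that] x] .
      have ek: "e k x \<in> tangent_space A x" using ident.along_tangent[OF e[OF k] x] .
      have Pt: "P x \<in> tangent_space A x" using ident.along_tangent[OF sP x] .
      have "g x (P x) (E j x) = (\<Sum>i<k. g x (g x (e k x) (E i x) *\<^sub>R E i x) (E j x))"
        unfolding P_def using t j by (intro G.sum_left G.E_scale) auto
      also have "\<dots> = (\<Sum>i<k. if i = j then g x (e k x) (E j x) else 0)"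
        using t j E(3)[OF x] by (intro sum.cong) (auto simp: G.scale_left)
      finally have "g x (P x) (E j x) = g x (e k x) (E j x)" using j by simp
      then show ?thesis unfolding Y_def using G.lin[OF Pt ek t[OF j], of "-1"] by simp
    qed
    define Ek where "Ek x = (N x powr (-1/2)) *\<^sub>R Y x" for x
    have sEk: "vector_field A W Ek"
      unfolding Ek_def using Npos
      by (intro ident.along_scale sY smooth_fun_compose_real[OF sN smooth_on_powr]) auto
    have norm: "g x (Ek x) (Ek x) = 1" and orthk: "j < k \<Longrightarrow> g x (Ek x) (E j x) = 0"
      "j < k \<Longrightarrow> g x (E j x) (Ek x) = 0" if x: "x \<in> W" for x j
    proof -
      interpret G: inner_form "tangent_space A x" "g x" using form x W by auto
      have Yt: "Y x \<in> tangent_space A x" using ident.along_tangent[OF sY x] .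
      have "(N x powr (-1/2)) * ((N x powr (-1/2)) * N x) = 1"
        using Npos[OF x] powr_add[of "N x" "-1/2" "-1/2"] by (simp add: powr_minus field_simps)
      then show "g x (Ek x) (Ek x) = 1"
        unfolding Ek_def using Yt by (simp add: G.bilinear G.E_scale N_def)
      have t: "E j x \<in> tangent_space A x" if "j < k" using ident.along_tangent[OF E(1)[OF that] x] .
      show o: "g x (Ek x) (E j x) = 0" if "j < k"
        unfolding Ek_def using Yt t[OF that] orth[OF x that] by (simp add: G.bilinear)
      show "g x (E j x) (Ek x) = 0" if "j < k"
        using o[OF that] t[OF that] ident.along_tangent[OF sEk x] by (simp add: G.sym)
    qed
    show ?case
    proof (intro exI[of _ "E(k := Ek)"] conjI allI impI ballI)
      show "vector_field A W ((E(k := Ek)) i)" if "i < Suc k" for i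
        using that E(1) sEk by (cases "i = k") auto
      show "(E(k := Ek)) i x \<in> span ((\<lambda>i. e i x) ` {..<Suc k})" if "x \<in> W" "i < Suc k" for x i
        using that subsetD[OF mono E(2)[OF that(1), of i]] Yspan[OF that(1)]
        by (cases "i = k") (auto simp: Ek_def intro: span_scale)
      show "g x ((E(k := Ek)) i x) ((E(k := Ek)) j x) = (if i = j then 1 else 0)"
        if "x \<in> W" "i < Suc k" "j < Suc k" for x i j
        using that E(3)[OF that(1)] norm[OF that(1)] orthk[OF that(1)]
        by (cases "i = k"; cases "j = k") auto
    qed
  qed auto
  from this[OF order_refl] obtain E where "\<And>i. i < ?n \<Longrightarrow> vector_field A W (E i)"
      "\<And>x i j. x \<in> W \<Longrightarrow> i < ?n \<Longrightarrow> j < ?n \<Longrightarrow> g x (E i x) (E j x) = (if i = j then 1 else 0)"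
    by blast
  then have "orthonormal_frame A g W E" by (simp add: orthonormal_frame_def)
  then show ?thesis using that W(2) by blast
qed

lemma frame_near_orthonormal:
  assumes "riemannian_metric A g" "p \<in> points A"
    and eq: "\<And>x u v. x \<in> points A \<Longrightarrow> u \<in> tangent_space A x \<Longrightarrow> v \<in> tangent_space A x \<Longrightarrow> g' x u v = g x u v"
  obtains U where "p \<in> U" "orthonormal_frame A g U (frame_near A g' p)"
proof -
  have iff: "orthonormal_frame A g' U E \<longleftrightarrow> orthonormal_frame A g U E" for U E
    unfolding orthonormal_frame_def
  proof (rule conj_cong[OF refl], intro ball_cong refl all_cong)
    fix x i j assume E: "\<forall>i<DIM('e). vector_field A U (E i)" and "x \<in> U" "i < DIM('e)" "j < DIM('e)"
    then have "x \<in> points A" "E i x \<in> tangent_space A x" "E j x \<in> tangent_space A x"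
      using ident.along_tangent ident.along_points[of U "E i"] by auto
    from eq[OF this] show "(g' x (E i x) (E j x) = (if i = j then 1 else 0)) \<longleftrightarrow>
        (g x (E i x) (E j x) = (if i = j then 1 else 0))" by simp
  qed
  obtain U E where "p \<in> U" "orthonormal_frame A g U E" using local_orthonormal_frame[OF assms(1,2)] .
  then have "\<exists>E U. p \<in> U \<and> orthonormal_frame A g' U E" using iff by blast
  then have "\<exists>U. p \<in> U \<and> orthonormal_frame A g' U (frame_near A g' p)"
    unfolding frame_near_def by (rule someI_ex)
  then show ?thesis using that iff by blast
qed

end


section \<open>Connections and their curvature\<close>

locale connection_along = smooth_mapping A A' F
  for A :: "('m::{t2_space,second_countable_topology}, 'e::euclidean_space) chart set"
    and A' :: "('n::{t2_space,second_countable_topology}, 'f::euclidean_space) chart set"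
    and F :: "'m \<Rightarrow> 'n" +
  fixes D :: "('m, 'n tvec) conn"
  assumes D: "connection A (pullback_tangent_bundle A A' F) D"
begin

lemma conn_fibre: "smooth_along A A' F U s \<Longrightarrow> x \<in> U \<Longrightarrow> v \<in> tangent_space A x \<Longrightarrow> D x v s \<in> tangent_space A' (F x)"
  and conn_lin: "smooth_along A A' F U s \<Longrightarrow> x \<in> U \<Longrightarrow> v \<in> tangent_space A x \<Longrightarrow> w \<in> tangent_space A x \<Longrightarrow>
    D x (a *\<^sub>R v + w) s = a *\<^sub>R D x v s + D x w s"
  and conn_add: "smooth_along A A' F U s \<Longrightarrow> smooth_along A A' F U t \<Longrightarrow> x \<in> U \<Longrightarrow> v \<in> tangent_space A x \<Longrightarrow>
    D x v (\<lambda>y. s y + t y) = D x v s + D x v t"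
  and conn_leibniz: "smooth_along A A' F U s \<Longrightarrow> smooth_fun A U f \<Longrightarrow> x \<in> U \<Longrightarrow> v \<in> tangent_space A x \<Longrightarrow>
    D x v (\<lambda>y. f y *\<^sub>R s y) = f x *\<^sub>R D x v s + v f *\<^sub>R s x"
  and conn_smooth: "smooth_along A A' F U s \<Longrightarrow> vector_field A U X \<Longrightarrow> smooth_along A A' F U (cov D X s)"
  using D unfolding connection_def pullback_tangent_bundle_def by simp_all

lemma conn_dir_zero: "smooth_along A A' F U s \<Longrightarrow> x \<in> U \<Longrightarrow> D x 0 s = 0"
  using conn_lin[of U s x 0 0 1] subspace_0[OF M.subspace_tangent] by simp

lemma conn_dir_scale: "smooth_along A A' F U s \<Longrightarrow> x \<in> U \<Longrightarrow> v \<in> tangent_space A x \<Longrightarrow>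
    D x (a *\<^sub>R v) s = a *\<^sub>R D x v s"
  using conn_lin[of U s x v 0 a] subspace_0[OF M.subspace_tangent] conn_dir_zero[of U s x] by simp

lemma conn_dir_add: "smooth_along A A' F U s \<Longrightarrow> x \<in> U \<Longrightarrow> v \<in> tangent_space A x \<Longrightarrow> w \<in> tangent_space A x \<Longrightarrow>
    D x (v + w) s = D x v s + D x w s"
  using conn_lin[of U s x v w 1] by simp

lemma conn_dir_diff: "smooth_along A A' F U s \<Longrightarrow> x \<in> U \<Longrightarrow> v \<in> tangent_space A x \<Longrightarrow> w \<in> tangent_space A x \<Longrightarrow>
    D x (v - w) s = D x v s - D x w s"
  using conn_lin[of U s x w v "-1"] by simp

lemma conn_dir_sum:
  assumes "smooth_along A A' F U s" "x \<in> U" "\<And>i. i \<in> I \<Longrightarrow> v i \<in> tangent_space A x"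
  shows "D x (\<Sum>i\<in>I. v i) s = (\<Sum>i\<in>I. D x (v i) s)"
  using assms(3)
  by (induction I rule: infinite_finite_induct)
    (simp_all add: conn_dir_zero[OF assms(1,2)] conn_dir_add[OF assms(1,2)] subspace_sum[OF M.subspace_tangent])

lemma conn_cmult:
  assumes "smooth_along A A' F U s" "x \<in> U" "v \<in> tangent_space A x"
  shows "D x v (\<lambda>y. k *\<^sub>R s y) = k *\<^sub>R D x v s"
proof -
  have U: "open U" "U \<subseteq> points A" using assms(1) by (auto simp: smooth_along_def)
  have "v (\<lambda>y. k) = 0" using M.tangent_const assms U by auto
  then show ?thesis using conn_leibniz[OF assms(1) M.smooth_fun_const[OF U, of k] assms(2,3)] by simp
qed

lemma conn_zero: "x \<in> points A \<Longrightarrow> v \<in> tangent_space A x \<Longrightarrow> D x v (\<lambda>y. 0) = 0"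
  using conn_cmult[OF along_zero[OF M.points_open order_refl], of x v 0] by simp

lemma conn_sum:
  assumes "open U" "U \<subseteq> points A" "\<And>i. i \<in> I \<Longrightarrow> smooth_along A A' F U (s i)" "x \<in> U" "v \<in> tangent_space A x"
  shows "D x v (\<lambda>y. \<Sum>i\<in>I. s i y) = (\<Sum>i\<in>I. D x v (s i))"
  using assms(3)
proof (induction I rule: infinite_finite_induct)
  case (insert i I)
  have "D x v (\<lambda>y. \<Sum>i\<in>insert i I. s i y) = D x v (\<lambda>y. s i y + (\<Sum>i\<in>I. s i y))"
    using insert(1,2) by (simp only: sum.insert not_False_eq_True)
  also have "\<dots> = D x v (s i) + D x v (\<lambda>y. \<Sum>i\<in>I. s i y)"
    using insert.prems by (intro conn_add[OF _ along_sum[OF assms(1,2)] assms(4,5)]) auto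
  also have "D x v (\<lambda>y. \<Sum>i\<in>I. s i y) = (\<Sum>i\<in>I. D x v (s i))"
    using insert.prems by (intro insert.IH) auto
  finally show ?case using insert(1,2) by (simp only: sum.insert not_False_eq_True)
qed (use conn_zero[of x v] assms in auto)

text \<open>As for tangent vectors, a section that vanishes near \<open>x\<close> is unchanged when multiplied by a
  function that vanishes near \<open>x\<close>.\<close>

lemma conn_germ:
  assumes s: "smooth_along A A' F U s" and W: "open W" "x \<in> W" "x \<in> U" and eq: "\<And>y. y \<in> U \<inter> W \<Longrightarrow> s y = t y"
    and v: "v \<in> tangent_space A x"
  shows "D x v s = D x v t"
proof -
  let ?U = "U \<inter> W"
  have U: "open ?U" "x \<in> ?U" "?U \<subseteq> points A" using s W by (auto simp: smooth_along_def)
  have s': "smooth_along A A' F ?U s" by (rule along_subset[OF s U(1)]) auto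
  have t': "smooth_along A A' F ?U t" by (rule along_cong[OF s']) (rule eq)
  let ?d = "\<lambda>y. t y + (-1) *\<^sub>R s y" and ?k = "\<lambda>y. if y \<in> ?U then 0 else (1::real)"
  have s1: "smooth_along A A' F ?U (\<lambda>y. (-1) *\<^sub>R s y)" by (rule along_scale[OF M.smooth_fun_const[OF U(1,3)] s'])
  have d: "smooth_along A A' F ?U ?d" by (rule along_add[OF t' s1])
  have k: "smooth_fun A ?U ?k" by (rule M.smooth_fun_cong[OF M.smooth_fun_const[OF U(1,3), of 0]]) auto
  have "?d = (\<lambda>y. ?k y *\<^sub>R ?d y)" using eq by (auto simp: fun_eq_iff)
  then have "D x v ?d = D x v (\<lambda>y. ?k y *\<^sub>R ?d y)" by metis
  also have "\<dots> = ?k x *\<^sub>R D x v ?d + v ?k *\<^sub>R ?d x" by (rule conn_leibniz[OF d k U(2) v])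
  also have "\<dots> = 0" using eq[OF U(2)] U(2) by simp
  finally have "D x v t + (-1) *\<^sub>R D x v s = 0"
    using conn_add[OF t' s1 U(2) v] conn_cmult[OF s' U(2) v, of "-1"] by simp
  then show ?thesis by simp
qed

lemma conn_cong:
  assumes s: "smooth_along A A' F U s" and x: "x \<in> U" and eq: "\<And>y. y \<in> U \<Longrightarrow> s y = t y"
    and v: "v \<in> tangent_space A x"
  shows "D x v s = D x v t"
  using s eq by (intro conn_germ[OF s along_open[OF s] x x _ v]) auto

lemma curvature_expand:
  "curvature A D X Y s x = D x (X x) (cov D Y s) - D x (Y x) (cov D X s) - D x (lie_bracket A X Y x) s"
  by (simp add: curvature_def cov_def)

context
  fixes U X Y
  assumes X: "vector_field A U X" and Y: "vector_field A U Y"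
begin

private lemma U: "open U" "U \<subseteq> points A"
  using X by (auto simp: smooth_along_def)

private lemma Xt: "x \<in> U \<Longrightarrow> X x \<in> tangent_space A x" and Yt: "x \<in> U \<Longrightarrow> Y x \<in> tangent_space A x"
  and Bt: "x \<in> U \<Longrightarrow> lie_bracket A X Y x \<in> tangent_space A x"
  using M.ident.along_tangent[OF X] M.ident.along_tangent[OF Y] M.lie_bracket_tangent[OF X Y] by auto

lemma curvature_fibre:
  assumes s: "smooth_along A A' F U s" and x: "x \<in> U"
  shows "curvature A D X Y s x \<in> tangent_space A' (F x)"
  unfolding curvature_expand
  by (intro subspace_diff[OF N.subspace_tangent] conn_fibre[OF _ x] conn_smooth s X Y Xt Yt Bt x)

lemma curvature_cong:
  assumes s: "smooth_along A A' F U s" and eq: "\<And>y. y \<in> U \<Longrightarrow> s y = t y" and x: "x \<in> U"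
  shows "curvature A D X Y s x = curvature A D X Y t x"
proof -
  have c: "D x v (cov D Z s) = D x v (cov D Z t)" if Z: "vector_field A U Z" and v: "v \<in> tangent_space A x" for Z v
    by (rule conn_cong[OF conn_smooth[OF s Z] x _ v])
      (auto simp: cov_def intro!: conn_cong[OF s _ eq] M.ident.along_tangent[OF Z])
  show ?thesis
    unfolding curvature_expand
    using c[OF X Yt[OF x]] c[OF Y Xt[OF x]] conn_cong[OF s x eq Bt[OF x]] by simp
qed

lemma curvature_add:
  assumes s: "smooth_along A A' F U s" and t: "smooth_along A A' F U t" and x: "x \<in> U"
  shows "curvature A D X Y (\<lambda>y. s y + t y) x = curvature A D X Y s x + curvature A D X Y t x"
proof -
  have c: "D x v (cov D Z (\<lambda>y. s y + t y)) = D x v (cov D Z s) + D x v (cov D Z t)"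
    if Z: "vector_field A U Z" and v: "v \<in> tangent_space A x" for Z v
  proof -
    have "D x v (cov D Z (\<lambda>y. s y + t y)) = D x v (\<lambda>y. cov D Z s y + cov D Z t y)"
      by (rule conn_cong[OF conn_smooth[OF along_add[OF s t] Z] x _ v])
        (auto simp: cov_def conn_add[OF s t _ M.ident.along_tangent[OF Z]])
    then show ?thesis using conn_add[OF conn_smooth[OF s Z] conn_smooth[OF t Z] x v] by simp
  qed
  show ?thesis
    unfolding curvature_expand c[OF X Yt[OF x]] c[OF Y Xt[OF x]] conn_add[OF s t x Bt[OF x]] by simp
qed

lemma curvature_scale:
  assumes s: "smooth_along A A' F U s" and f: "smooth_fun A U f" and x: "x \<in> U"
  shows "curvature A D X Y (\<lambda>y. f y *\<^sub>R s y) x = f x *\<^sub>R curvature A D X Y s x"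
proof -
  have c: "D x v (cov D Z (\<lambda>y. f y *\<^sub>R s y)) =
      f x *\<^sub>R D x v (cov D Z s) + v f *\<^sub>R D x (Z x) s + (Z x f *\<^sub>R D x v s + v (\<lambda>y. Z y f) *\<^sub>R s x)"
    if Z: "vector_field A U Z" and v: "v \<in> tangent_space A x" for Z v
  proof -
    note Zf = M.field_smooth[OF Z f]
    have "D x v (cov D Z (\<lambda>y. f y *\<^sub>R s y)) = D x v (\<lambda>y. f y *\<^sub>R cov D Z s y + Z y f *\<^sub>R s y)"
      by (rule conn_cong[OF conn_smooth[OF along_scale[OF f s] Z] x _ v])
        (auto simp: cov_def conn_leibniz[OF s f _ M.ident.along_tangent[OF Z]])
    also have "\<dots> = D x v (\<lambda>y. f y *\<^sub>R cov D Z s y) + D x v (\<lambda>y. Z y f *\<^sub>R s y)"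
      by (rule conn_add[OF along_scale[OF f conn_smooth[OF s Z]] along_scale[OF Zf s] x v])
    finally show ?thesis
      using conn_leibniz[OF conn_smooth[OF s Z] f x v] conn_leibniz[OF s Zf x v] by (simp add: cov_def)
  qed
  have bracket: "lie_bracket A X Y x f = X x (\<lambda>q. Y q f) - Y x (\<lambda>q. X q f)"
    using M.smooth_nearI[OF f x] by (simp add: lie_bracket_def)
  show ?thesis
    unfolding curvature_expand c[OF X Yt[OF x]] c[OF Y Xt[OF x]] conn_leibniz[OF s f x Bt[OF x]] bracket
    by (simp add: algebra_simps)
qed

text \<open>Tensoriality in the first argument: the derivatives of the coefficients \<open>a i\<close> from
  \<open>\<nabla>\<^sub>Y \<nabla>\<^sub>X s\<close> cancel against those in the bracket.\<close>

lemma curvature_sum_left: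
  assumes s: "smooth_along A A' F U s" and I: "finite I" and Xi: "\<And>i. i \<in> I \<Longrightarrow> vector_field A U (X' i)"
    and a: "\<And>i. i \<in> I \<Longrightarrow> smooth_fun A U (a i)"
    and eq: "\<And>q. q \<in> U \<Longrightarrow> X q = (\<Sum>i\<in>I. a i q *\<^sub>R X' i q)" and x: "x \<in> U"
  shows "curvature A D X Y s x = (\<Sum>i\<in>I. a i x *\<^sub>R curvature A D (X' i) Y s x)"
proof -
  note Xit = M.ident.along_tangent[OF Xi] and sc = subspace_scale[OF M.subspace_tangent]
  have dir: "D q (X q) t = (\<Sum>i\<in>I. a i q *\<^sub>R D q (X' i q) t)" if t: "smooth_along A A' F U t" and q: "q \<in> U" for q t
    by (simp add: eq[OF q] conn_dir_sum[OF t q] conn_dir_scale[OF t q] Xit q sc)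
  have "D x (Y x) (cov D X s) = D x (Y x) (\<lambda>q. \<Sum>i\<in>I. a i q *\<^sub>R cov D (X' i) s q)"
    by (rule conn_cong[OF conn_smooth[OF s X] x _ Yt[OF x]]) (simp add: cov_def dir[OF s])
  also have "\<dots> = (\<Sum>i\<in>I. D x (Y x) (\<lambda>q. a i q *\<^sub>R cov D (X' i) s q))"
    by (intro conn_sum[OF U] along_scale conn_smooth s a Xi x Yt)
  also have "\<dots> = (\<Sum>i\<in>I. a i x *\<^sub>R D x (Y x) (cov D (X' i) s) + Y x (a i) *\<^sub>R D x (X' i x) s)"
  proof (intro sum.cong refl)
    fix i assume i: "i \<in> I"
    show "D x (Y x) (\<lambda>q. a i q *\<^sub>R cov D (X' i) s q) = a i x *\<^sub>R D x (Y x) (cov D (X' i) s) + Y x (a i) *\<^sub>R D x (X' i x) s"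
      using conn_leibniz[OF conn_smooth[OF s Xi[OF i]] a[OF i] x Yt[OF x]] by (simp add: cov_def)
  qed
  finally have 1: "D x (Y x) (cov D X s) = (\<Sum>i\<in>I. a i x *\<^sub>R D x (Y x) (cov D (X' i) s) + Y x (a i) *\<^sub>R D x (X' i x) s)" .
  have "D x (lie_bracket A X Y x) s = D x (\<Sum>i\<in>I. a i x *\<^sub>R lie_bracket A (X' i) Y x - Y x (a i) *\<^sub>R X' i x) s"
    using M.lie_bracket_sum[OF I X Xi Y a eq x] by simp
  also have "\<dots> = (\<Sum>i\<in>I. a i x *\<^sub>R D x (lie_bracket A (X' i) Y x) s - Y x (a i) *\<^sub>R D x (X' i x) s)"
    by (subst conn_dir_sum[OF s x])
      (simp_all add: conn_dir_diff[OF s x] conn_dir_scale[OF s x] Xit x sc M.lie_bracket_tangent[OF Xi Y]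
        subspace_diff[OF M.subspace_tangent])
  finally have 2: "D x (lie_bracket A X Y x) s =
      (\<Sum>i\<in>I. a i x *\<^sub>R D x (lie_bracket A (X' i) Y x) s - Y x (a i) *\<^sub>R D x (X' i x) s)" .
  have "(\<Sum>i\<in>I. a i x *\<^sub>R curvature A D (X' i) Y s x) = (\<Sum>i\<in>I. a i x *\<^sub>R D x (X' i x) (cov D Y s))
      - (\<Sum>i\<in>I. a i x *\<^sub>R D x (Y x) (cov D (X' i) s)) - (\<Sum>i\<in>I. a i x *\<^sub>R D x (lie_bracket A (X' i) Y x) s)"
    unfolding curvature_expand scaleR_right_diff_distrib sum_subtractf by (rule refl)
  then show ?thesis
    unfolding curvature_expand[of X] 1 2 dir[OF conn_smooth[OF s Y] x] sum_subtractf sum.distrib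
    by simp
qed

end

end


section \<open>Levi-Civita connections\<close>

context smooth_manifold
begin

lemma connection_along_ident: "connection A (tangent_bundle A) D \<Longrightarrow> connection_along A A (\<lambda>x. x) D"
  by unfold_locales

lemma levi_civita_connection: "levi_civita A g D \<Longrightarrow> connection A (tangent_bundle A) D"
  by (simp add: levi_civita_def metric_connection_def)

lemma levi_civita_metric:
  assumes "levi_civita A g D" "vector_field A U X" "vector_field A U Y" "x \<in> U" "v \<in> tangent_space A x"
  shows "v (\<lambda>y. g y (X y) (Y y)) = g x (D x v X) (Y x) + g x (X x) (D x v Y)"
  using assms by (auto simp: levi_civita_def metric_connection_def pullback_tangent_bundle_def)

lemma levi_civita_torsion:
  assumes "levi_civita A g D" "vector_field A U X" "vector_field A U Y" "x \<in> U"
  shows "D x (X x) Y - D x (Y x) X = lie_bracket A X Y x"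
  using assms by (auto simp: levi_civita_def cov_def)

text \<open>Metricity for the three pairs of fields, combined with signs, leaves \<open>\<nabla>\<^sub>X Y\<close> twice up to brackets.\<close>

lemma Koszul:
  assumes LC: "levi_civita A g D" and form: "inner_form (tangent_space A x) (g x)"
    and X: "vector_field A U X" and Y: "vector_field A U Y" and Z: "vector_field A U Z" and x: "x \<in> U"
  shows "2 * g x (D x (X x) Y) (Z x) =
    X x (\<lambda>y. g y (Y y) (Z y)) + Y x (\<lambda>y. g y (X y) (Z y)) - Z x (\<lambda>y. g y (X y) (Y y))
    + g x (lie_bracket A X Y x) (Z x) - g x (lie_bracket A X Z x) (Y x) - g x (lie_bracket A Y Z x) (X x)"
proof -
  interpret G: inner_form "tangent_space A x" "g x" by (rule form)
  interpret C: connection_along A A "\<lambda>x. x" D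
    by (rule connection_along_ident[OF levi_civita_connection[OF LC]])
  have t: "X x \<in> tangent_space A x" "Y x \<in> tangent_space A x" "Z x \<in> tangent_space A x"
    using ident.along_tangent X Y Z x by auto
  note f = C.conn_fibre[OF _ x]
  note simps = levi_civita_torsion[OF LC _ _ x, symmetric] levi_civita_metric[OF LC _ _ x]
  show ?thesis
    using t X Y Z
    by (simp add: simps G.diff_left f) (simp add: G.sym f)
qed

text \<open>\<^const>\<open>ricci\<close> is defined with one chosen frame; by tensoriality any local orthonormal frame
  gives the same trace.\<close>

lemma ricci_orthonormal:
  assumes g: "riemannian_metric A g" and D: "connection A (tangent_bundle A) D"
    and E: "orthonormal_frame A g U E" and x: "x \<in> U" and X: "vector_field A U X" and Y: "vector_field A U Y"
  shows "ricci A g D X Y x = (\<Sum>i<DIM('e). g x (curvature A D (E i) X Y x) (E i x))"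
proof -
  interpret C: connection_along A A "\<lambda>x. x" D by (rule connection_along_ident[OF D])
  let ?n = "DIM('e)"
  have gm: "bundle_metric A (tangent_bundle A) g ?n 0" using g by (simp add: riemannian_metric_def)
  have sig: "has_signature (tangent_space A y) (g y) ?n 0" if "y \<in> points A" for y
    using gm that by (auto simp: bundle_metric_def pullback_tangent_bundle_def)
  have xp: "x \<in> points A" using X x ident.along_points by auto
  define F where "F = frame_near A g x"
  obtain U' where U': "x \<in> U'" "orthonormal_frame A g U' F"
    using frame_near_orthonormal[OF g xp, of g] unfolding F_def by blast
  let ?U = "U \<inter> U'"
  have Fi: "vector_field A U' (F i)" if "i < ?n" for i using U' that by (auto simp: orthonormal_frame_def)
  have o: "open ?U" using ident.along_open[OF X] ident.along_open[OF Fi[OF DIM_positive]] by auto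
  have xU: "x \<in> ?U" using x U' by auto
  have f: "vector_field A ?U (E i)" "vector_field A ?U (F i)" if "i < ?n" for i
    using that E U' o by (auto simp: orthonormal_frame_def intro: ident.along_subset)
  have X': "vector_field A ?U X" and Y': "vector_field A ?U Y"
    using X Y o by (auto intro: ident.along_subset)
  have p: "?U \<subseteq> points A" using ident.along_points[OF X'] .
  have on: "g y (E i y) (E j y) = (if i = j then 1 else 0)" "g y (F i y) (F j y) = (if i = j then 1 else 0)"
    if "y \<in> ?U" "i < ?n" "j < ?n" for y i j
    using that E U' by (auto simp: orthonormal_frame_def)
  note form = tangent_metric_form[OF gm]
  have expand: "E i y = (\<Sum>j<?n. g y (E i y) (F j y) *\<^sub>R F j y)" if "y \<in> ?U" "i < ?n" for y i
    using that p on[OF that(1)]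
    by (intro inner_form.orthonormal_expansion[OF form sig] ident.along_tangent[OF f(1)] ident.along_tangent[OF f(2)]) auto
  have curv: "curvature A D (E i) X Y x = (\<Sum>j<?n. g x (E i x) (F j x) *\<^sub>R curvature A D (F j) X Y x)" if "i < ?n" for i
    using that
    by (intro C.curvature_sum_left[OF f(1) X' Y' _ f(2) metric_smooth[OF gm]] xU expand f) auto
  have "(\<Sum>i<?n. g x (curvature A D (E i) X Y x) (E i x)) = (\<Sum>j<?n. g x (curvature A D (F j) X Y x) (F j x))"
  proof (rule inner_form.trace_frame_independent[OF form[OF xp] sig[OF xp]])
    show "curvature A D (F j) X Y x \<in> tangent_space A x" if "j < ?n" for j
      by (rule C.curvature_fibre[OF f(2)[OF that] X' Y' xU])
  qed (use ident.along_tangent[OF f(1) xU] ident.along_tangent[OF f(2) xU] on[OF xU] curv in auto)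
  then show ?thesis by (simp add: ricci_def Let_def F_def)
qed

end


section \<open>Products of manifolds\<close>

context smooth_mapping
begin

lemma differential_comp:
  assumes G: "smooth_mapping A' A'' G" and x: "x \<in> points A" and H: "\<And>y. G (F y) = H y"
  shows "differential A'' G (F x) (differential A' F x v) = differential A'' H x v"
proof -
  interpret G: smooth_mapping A' A'' G by (rule G)
  show ?thesis
    using G.pullback_smooth_near[OF map_points[OF x]] by (auto simp: differential_def fun_eq_iff o_def H)
qed

lemma differential_const:
  assumes "x \<in> points A" "v \<in> tangent_space A x" "\<And>y. F y = c"
  shows "differential A' F x v = 0"
proof
  have "f \<circ> F = (\<lambda>_. f c)" for f :: "'n \<Rightarrow> real" using assms(3) by auto
  then show "differential A' F x v f = 0 f" for f
    using M.tangent_const[OF assms(2,1)] by (simp add: differential_def)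
qed

text \<open>All brackets of lifted fields are computed from this: under each projection a lift is related to
  a field on the factor, namely the original field or \<open>0\<close>.\<close>

lemma related_bracket:
  assumes V: "vector_field A U V" and W: "vector_field A U W"
    and X: "vector_field A' U' X" and Y: "vector_field A' U' Y"
    and rel: "\<And>q. q \<in> U \<Longrightarrow> F q \<in> U'" "\<And>q. q \<in> U \<Longrightarrow> differential A' F q (V q) = X (F q)"
      "\<And>q. q \<in> U \<Longrightarrow> differential A' F q (W q) = Y (F q)"
    and p: "p \<in> U"
  shows "differential A' F p (lie_bracket A V W p) = lie_bracket A' X Y (F p)"
proof
  fix f
  have U: "open U" "U \<subseteq> points A" using V by (auto simp: smooth_along_def)
  have half: "V p (\<lambda>q. W q (f \<circ> F)) = X (F p) (\<lambda>q. Y q f)"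
    if V: "vector_field A U V" and W: "vector_field A U W" and Y: "vector_field A' U' Y"
      and rel: "\<And>q. q \<in> U \<Longrightarrow> F q \<in> U'" "\<And>q. q \<in> U \<Longrightarrow> differential A' F q (V q) = X (F q)"
        "\<And>q. q \<in> U \<Longrightarrow> differential A' F q (W q) = Y (F q)"
      and f: "smooth_near A' (F p) f" for V W X Y
  proof -
    obtain S where S: "F p \<in> S" "smooth_fun A' S f" using f by (auto simp: smooth_near_def)
    have o: "open (U \<inter> F -` S)"
      by (rule preimage_open[OF N.smooth_fun_open[OF S(2)] N.smooth_fun_points[OF S(2)] U])
    have pU: "p \<in> points A" using p U by auto
    have sY: "smooth_near A' (F p) (\<lambda>q. Y q f)" using N.ident.along_smooth_near[OF Y rel(1)[OF p] f] .
    have "V p (\<lambda>q. W q (f \<circ> F)) = V p ((\<lambda>q. Y q f) \<circ> F)"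
    proof (rule M.tangent_germ[OF M.ident.along_tangent[OF V p] _ o])
      show "smooth_near A p (\<lambda>q. W q (f \<circ> F))"
        by (rule M.ident.along_smooth_near[OF W p pullback_smooth_near[OF pU f]])
      fix q assume q: "q \<in> U \<inter> F -` S"
      then have "differential A' F q (W q) f = W q (f \<circ> F)"
        by (intro differential_apply N.smooth_nearI[OF S(2)]) auto
      then show "W q (f \<circ> F) = ((\<lambda>q. Y q f) \<circ> F) q" using rel(3) q by simp
    qed (use p S in auto)
    also have "\<dots> = differential A' F p (V p) (\<lambda>q. Y q f)" using differential_apply[OF sY] by simp
    finally show ?thesis using rel(2)[OF p] by simp
  qed
  show "differential A' F p (lie_bracket A V W p) f = lie_bracket A' X Y (F p) f"
  proof (cases "smooth_near A' (F p) f")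
    case True
    have "smooth_near A p (f \<circ> F)" using pullback_smooth_near True p U by auto
    then show ?thesis
      using True half[OF V W Y rel True] half[OF W V X rel(1,3,2) True]
      by (simp add: differential_apply lie_bracket_def o_def)
  qed (simp add: differential_def lie_bracket_def)
qed

lemma along_compose:
  assumes G: "smooth_mapping A' A'' G" and s: "smooth_along A' A'' G W s" and U: "open U" "U \<subseteq> points A" "F ` U \<subseteq> W"
  shows "smooth_along A A'' (\<lambda>x. G (F x)) U (\<lambda>x. s (F x))"
  unfolding smooth_along_def
proof (intro conjI ballI allI impI U(1,2))
  interpret G: smooth_mapping A' A'' G by (rule G)
  show "s (F x) \<in> tangent_space A'' (G (F x))" if "x \<in> U" for x
    using G.along_tangent[OF s] U that by auto
  fix S f assume "smooth_fun A'' S f"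
  then have "smooth_fun A (U \<inter> F -` (W \<inter> G -` S)) ((\<lambda>x. s x f) \<circ> F)"
    using pullback_smooth[OF G.along_smooth[OF s] U(1,2)] by blast
  moreover have "U \<inter> F -` (W \<inter> G -` S) = U \<inter> (\<lambda>x. G (F x)) -` S" using U(3) by auto
  ultimately show "smooth_fun A (U \<inter> (\<lambda>x. G (F x)) -` S) (\<lambda>x. s (F x) f)" by (simp add: o_def)
qed

lemma smooth_mapping_compose:
  assumes G: "smooth_mapping A' A'' G"
  shows "smooth_mapping A A'' (\<lambda>x. G (F x))"
proof -
  interpret G: smooth_mapping A' A'' G by (rule G)
  show ?thesis
  proof (unfold_locales, unfold smooth_map_def, intro conjI allI impI)
    show "(\<lambda>x. G (F x)) ` points A \<subseteq> points A''" using map_points G.map_points by auto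
    fix W f assume "smooth_fun A'' W f"
    then have "smooth_fun A (points A \<inter> F -` (points A' \<inter> G -` W)) (f \<circ> G \<circ> F)"
      using pullback_smooth[OF G.pullback_smooth[OF _ N.points_open order_refl] M.points_open order_refl] by blast
    moreover have "points A \<inter> F -` (points A' \<inter> G -` W) = points A \<inter> (\<lambda>x. G (F x)) -` W"
      using map_points by auto
    ultimately show "smooth_fun A (points A \<inter> (\<lambda>x. G (F x)) -` W) (f \<circ> (\<lambda>x. G (F x)))"
      by (simp add: o_def)
  qed
qed

end

lemma (in smooth_manifold) differential_ident:
  assumes "v \<in> tangent_space A x" "\<And>y. F y = y"
  shows "differential A F x v = v"
proof
  have "f \<circ> F = f" for f :: "'m \<Rightarrow> real" using assms(2) by auto
  then show "differential A F x v f = v f" for f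
    using tangent_not_smooth[OF assms(1), of f] assms(2) by (simp add: differential_def)
qed

lemma (in smooth_manifold) lie_bracket_zero:
  assumes "vector_field A U X" "p \<in> U"
  shows "lie_bracket A (\<lambda>x. 0) X p = 0" "lie_bracket A X (\<lambda>x. 0) p = 0"
proof -
  have "X p (\<lambda>q. 0) = 0"
    using tangent_const[OF ident.along_tangent[OF assms]] ident.along_points[OF assms(1)] assms(2) by auto
  then show "lie_bracket A (\<lambda>x. 0) X p = 0" "lie_bracket A X (\<lambda>x. 0) p = 0"
    by (auto simp: lie_bracket_def fun_eq_iff)
qed

locale product_manifold = L: smooth_manifold AB + R: smooth_manifold A
  for AB :: "('b::{t2_space,second_countable_topology}, 'f::euclidean_space) chart set"
    and A :: "('m::{t2_space,second_countable_topology}, 'e::euclidean_space) chart set"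
begin

abbreviation "At \<equiv> prod_atlas AB A"

lemma prod_chartI: "(U, c) \<in> AB \<Longrightarrow> (V, d) \<in> A \<Longrightarrow> (U \<times> V, \<lambda>(x, y). (c x, d y)) \<in> At"
  unfolding prod_atlas_def by blast

lemma prod_chartE:
  assumes "(S, k) \<in> At"
  obtains U c V d where "(U, c) \<in> AB" "(V, d) \<in> A" "S = U \<times> V" "k = (\<lambda>(x, y). (c x, d y))"
  using assms unfolding prod_atlas_def by blast

lemma points_prod: "points At = points AB \<times> points A"
proof
  show "points At \<subseteq> points AB \<times> points A"
    unfolding points_def by (auto elim!: prod_chartE)
  show "points AB \<times> points A \<subseteq> points At"
  proof clarify
    fix b x assume "b \<in> points AB" "x \<in> points A"
    then obtain U c V d where *: "(U, c) \<in> AB" "b \<in> U" "(V, d) \<in> A" "x \<in> V"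
      using L.chart_at R.chart_at by metis
    show "(b, x) \<in> points At"
      unfolding points_def by (rule UN_I[OF prod_chartI[OF *(1,3)]]) (use * in simp)
  qed
qed

lemma prod_image: "(\<lambda>(x, y). (c x, d y)) ` (S \<times> T) = c ` S \<times> d ` T"
  by (auto simp: image_iff)

lemma prod_inv:
  assumes "(U, c) \<in> AB" "(V, d) \<in> A" "a \<in> c ` U" "b \<in> d ` V"
  shows "inv_into (U \<times> V) (\<lambda>(x, y). (c x, d y)) (a, b) = (inv_into U c a, inv_into V d b)"
proof (rule inv_into_f_eq)
  show "inj_on (\<lambda>(x, y). (c x, d y)) (U \<times> V)"
    using L.chart(3)[OF assms(1)] R.chart(3)[OF assms(2)] by (auto simp: inj_on_def)
qed (use assms in \<open>auto simp: inv_into_into f_inv_into_f\<close>)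

lemma smooth_atlas_prod: "smooth_atlas At"
  unfolding smooth_atlas_def
proof (intro conjI ballI; clarify)
  fix S k assume "(S, k) \<in> At"
  then obtain U c V d where *: "(U, c) \<in> AB" "(V, d) \<in> A" "S = U \<times> V" "k = (\<lambda>(x, y). (c x, d y))"
    by (rule prod_chartE)
  note cU = L.chart[OF *(1)] and dV = R.chart[OF *(2)]
  have im: "k ` S = c ` U \<times> d ` V" unfolding * prod_image ..
  show "open S \<and> open (k ` S) \<and> homeomorphism S (k ` S) k (inv_into S k)"
  proof (intro conjI)
    show "open S" unfolding * using cU(1) dV(1) by (rule open_Times)
    show "open (k ` S)" unfolding im using cU(2) dV(2) by (rule open_Times)
    have cont: "continuous_on S k"
      unfolding * case_prod_unfold
      by (intro continuous_intros continuous_on_compose2[OF cU(4)] continuous_on_compose2[OF dV(4)]) auto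
    have "continuous_on (c ` U \<times> d ` V) (\<lambda>y. (inv_into U c (fst y), inv_into V d (snd y)))"
      by (intro continuous_intros continuous_on_compose2[OF cU(5)] continuous_on_compose2[OF dV(5)]) auto
    then have conti: "continuous_on (k ` S) (inv_into S k)"
      unfolding im
      by (rule continuous_on_cong[THEN iffD1, rotated -1]) (use prod_inv[OF *(1,2)] in \<open>auto simp: *\<close>)
    have inj: "inj_on k S" unfolding * using cU(3) dV(3) by (auto simp: inj_on_def)
    show "homeomorphism S (k ` S) k (inv_into S k)"
      using cont conti inj by (auto simp: homeomorphism_def image_comp image_iff)
  qed
next
  fix S k S' k' assume S: "(S, k) \<in> At" and S': "(S', k') \<in> At"
  obtain U c V d where *: "(U, c) \<in> AB" "(V, d) \<in> A" "S = U \<times> V" "k = (\<lambda>(x, y). (c x, d y))"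
    using S by (rule prod_chartE)
  obtain U' c' V' d' where st: "(U', c') \<in> AB" "(V', d') \<in> A" "S' = U' \<times> V'" "k' = (\<lambda>(x, y). (c' x, d' y))"
    using S' by (rule prod_chartE)
  have im: "k ` (S \<inter> S') = c ` (U \<inter> U') \<times> d ` (V \<inter> V')"
    unfolding *(3,4) st(3) Times_Int_Times prod_image ..
  have o: "open (c ` (U \<inter> U'))" "open (d ` (V \<inter> V'))"
    using L.chart_image_open[OF *(1) L.chart(1)[OF st(1)]] R.chart_image_open[OF *(2) R.chart(1)[OF st(2)]]
    by (simp_all add: Int_commute)
  let ?S = "c ` (U \<inter> U') \<times> d ` (V \<inter> V')"
  have oS: "open ?S" using o by (rule open_Times)
  have "smooth_on ?S (\<lambda>y. ((c' \<circ> inv_into U c) (fst y), (d' \<circ> inv_into V d) (snd y)))"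
    by (intro smooth_on_Pair oS smooth_on_compose[OF oS _ _ L.transition_smooth[OF *(1) st(1)]]
        smooth_on_compose[OF oS _ _ R.transition_smooth[OF *(2) st(2)]]
        smooth_on_linear bounded_linear_fst bounded_linear_snd) auto
  then have "smooth_on ?S (k' \<circ> inv_into S k)"
  proof (rule smooth_on_imp_eq[OF _ oS])
    fix y assume "y \<in> ?S"
    then have "fst y \<in> c ` U" "snd y \<in> d ` V" by auto
    from prod_inv[OF *(1,2) this]
    show "((c' \<circ> inv_into U c) (fst y), (d' \<circ> inv_into V d) (snd y)) = (k' \<circ> inv_into S k) y"
      by (simp add: * st)
  qed
  then show "smooth_on (k ` (S \<inter> S')) (k' \<circ> inv_into S k)" unfolding im .
qed

sublocale P: smooth_manifold At by unfold_locales (rule smooth_atlas_prod)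

sublocale fst: smooth_mapping At AB fst
proof (unfold_locales, unfold smooth_map_def, intro conjI allI impI)
  show "fst ` points At \<subseteq> points AB" by (auto simp: points_prod)
  fix W f assume f: "smooth_fun AB W f"
  show "smooth_fun At (points At \<inter> fst -` W) (f \<circ> fst)"
  proof (rule P.smooth_fun_chartI)
    have "points At \<inter> fst -` W = W \<times> points A" using L.smooth_fun_points[OF f] by (auto simp: points_prod)
    then show "open (points At \<inter> fst -` W)" using L.smooth_fun_open[OF f] R.points_open by (simp add: open_Times)
    fix S k assume Sk: "(S, k) \<in> At"
    then obtain U c V d where *: "(U, c) \<in> AB" "(V, d) \<in> A" "S = U \<times> V" "k = (\<lambda>(x, y). (c x, d y))"
      by (rule prod_chartE)
    let ?S = "c ` (W \<inter> U) \<times> d ` V"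
    have eq: "points At \<inter> fst -` W \<inter> S = (W \<inter> U) \<times> V"
      using L.chart(6)[OF *(1)] R.chart(6)[OF *(2)] by (auto simp: points_prod *)
    have im: "k ` (points At \<inter> fst -` W \<inter> S) = ?S" unfolding eq *(4) prod_image ..
    have oS: "open ?S"
      using L.chart_image_open[OF *(1) L.smooth_fun_open[OF f]] R.chart(2)[OF *(2)] by (rule open_Times)
    have "smooth_on ?S (\<lambda>y. (f \<circ> inv_into U c) (fst y))"
      by (intro smooth_on_compose[OF oS _ _ L.smooth_fun_chart[OF f *(1)]] smooth_on_linear oS bounded_linear_fst) auto
    then show "smooth_on (k ` (points At \<inter> fst -` W \<inter> S)) (f \<circ> fst \<circ> inv_into S k)"
      unfolding im
      by (rule smooth_on_imp_eq[OF _ oS]) (use prod_inv[OF *(1,2)] in \<open>auto simp: *\<close>)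
  qed auto
qed

sublocale snd: smooth_mapping At A snd
proof (unfold_locales, unfold smooth_map_def, intro conjI allI impI)
  show "snd ` points At \<subseteq> points A" by (auto simp: points_prod)
  fix W f assume f: "smooth_fun A W f"
  show "smooth_fun At (points At \<inter> snd -` W) (f \<circ> snd)"
  proof (rule P.smooth_fun_chartI)
    have "points At \<inter> snd -` W = points AB \<times> W" using R.smooth_fun_points[OF f] by (auto simp: points_prod)
    then show "open (points At \<inter> snd -` W)" using R.smooth_fun_open[OF f] L.points_open by (simp add: open_Times)
    fix S k assume Sk: "(S, k) \<in> At"
    then obtain U c V d where *: "(U, c) \<in> AB" "(V, d) \<in> A" "S = U \<times> V" "k = (\<lambda>(x, y). (c x, d y))"
      by (rule prod_chartE)
    let ?S = "c ` U \<times> d ` (W \<inter> V)"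
    have eq: "points At \<inter> snd -` W \<inter> S = U \<times> (W \<inter> V)"
      using L.chart(6)[OF *(1)] R.chart(6)[OF *(2)] by (auto simp: points_prod *)
    have im: "k ` (points At \<inter> snd -` W \<inter> S) = ?S" unfolding eq *(4) prod_image ..
    have oS: "open ?S"
      using L.chart(2)[OF *(1)] R.chart_image_open[OF *(2) R.smooth_fun_open[OF f]] by (rule open_Times)
    have "smooth_on ?S (\<lambda>y. (f \<circ> inv_into V d) (snd y))"
      by (intro smooth_on_compose[OF oS _ _ R.smooth_fun_chart[OF f *(2)]] smooth_on_linear oS bounded_linear_snd) auto
    then show "smooth_on (k ` (points At \<inter> snd -` W \<inter> S)) (f \<circ> snd \<circ> inv_into S k)"
      unfolding im
      by (rule smooth_on_imp_eq[OF _ oS]) (use prod_inv[OF *(1,2)] in \<open>auto simp: *\<close>)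
  qed auto
qed

lemma slice_right:
  assumes b: "b \<in> points AB"
  shows "smooth_mapping A At (\<lambda>x. (b, x))"
proof (unfold_locales, unfold smooth_map_def, intro conjI allI impI)
  show "(\<lambda>x. (b, x)) ` points A \<subseteq> points At" using b by (auto simp: points_prod)
  fix W f assume f: "smooth_fun At W f"
  have oW: "open (points A \<inter> (\<lambda>x. (b, x)) -` W)"
    using R.points_open P.smooth_fun_open[OF f] by (intro continuous_open_preimage continuous_intros)
  show "smooth_fun A (points A \<inter> (\<lambda>x. (b, x)) -` W) (f \<circ> (\<lambda>x. (b, x)))"
  proof (rule R.smooth_funI[OF oW])
    fix x assume x: "x \<in> points A \<inter> (\<lambda>x. (b, x)) -` W"
    obtain U c V d where *: "(U, c) \<in> AB" "b \<in> U" "(V, d) \<in> A" "x \<in> V"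
      using b x L.chart_at R.chart_at by (metis IntD1)
    let ?W = "points A \<inter> (\<lambda>x. (b, x)) -` W \<inter> V" and ?k = "\<lambda>(x, y). (c x, d y)"
    have o: "open (d ` ?W)" using R.chart_image_open[OF *(3) oW] .
    have "smooth_on (d ` ?W) (\<lambda>y. (f \<circ> inv_into (U \<times> V) ?k) (c b, y))"
    proof (rule smooth_on_compose[OF o _ _ P.smooth_fun_chart[OF f prod_chartI[OF *(1,3)]]])
      show "smooth_on (d ` ?W) (\<lambda>y. (c b, y))"
        by (intro smooth_on_Pair smooth_on_const smooth_on_linear o bounded_linear_ident)
      show "(\<lambda>y. (c b, y)) ` d ` ?W \<subseteq> ?k ` (W \<inter> U \<times> V)" using *(2) by (auto simp: image_iff)
    qed
    then have "smooth_on (d ` ?W) (f \<circ> (\<lambda>x. (b, x)) \<circ> inv_into V d)"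
      by (rule smooth_on_imp_eq[OF _ o])
        (use prod_inv[OF *(1,3)] L.chart(7)[OF *(1,2)] R.chart(7)[OF *(3)] *(2) in auto)
    then show "\<exists>V d S. (V, d) \<in> A \<and> open S \<and> x \<in> S \<and> S \<subseteq> points A \<inter> (\<lambda>x. (b, x)) -` W \<inter> V \<and>
        smooth_on (d ` S) (f \<circ> (\<lambda>x. (b, x)) \<circ> inv_into V d)"
      using * x oW R.chart(1)[OF *(3)] by (intro exI[of _ V] exI[of _ d] exI[of _ ?W]) auto
  qed auto
qed

lemma slice_left:
  assumes x: "x \<in> points A"
  shows "smooth_mapping AB At (\<lambda>b. (b, x))"
proof (unfold_locales, unfold smooth_map_def, intro conjI allI impI)
  show "(\<lambda>b. (b, x)) ` points AB \<subseteq> points At" using x by (auto simp: points_prod)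
  fix W f assume f: "smooth_fun At W f"
  have oW: "open (points AB \<inter> (\<lambda>b. (b, x)) -` W)"
    using L.points_open P.smooth_fun_open[OF f] by (intro continuous_open_preimage continuous_intros)
  show "smooth_fun AB (points AB \<inter> (\<lambda>b. (b, x)) -` W) (f \<circ> (\<lambda>b. (b, x)))"
  proof (rule L.smooth_funI[OF oW])
    fix b assume b: "b \<in> points AB \<inter> (\<lambda>b. (b, x)) -` W"
    obtain U c V d where *: "(U, c) \<in> AB" "b \<in> U" "(V, d) \<in> A" "x \<in> V"
      using b x L.chart_at R.chart_at by (metis IntD1)
    let ?W = "points AB \<inter> (\<lambda>b. (b, x)) -` W \<inter> U" and ?k = "\<lambda>(x, y). (c x, d y)"
    have o: "open (c ` ?W)" using L.chart_image_open[OF *(1) oW] .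
    have "smooth_on (c ` ?W) (\<lambda>y. (f \<circ> inv_into (U \<times> V) ?k) (y, d x))"
    proof (rule smooth_on_compose[OF o _ _ P.smooth_fun_chart[OF f prod_chartI[OF *(1,3)]]])
      show "smooth_on (c ` ?W) (\<lambda>y. (y, d x))"
        by (intro smooth_on_Pair smooth_on_const smooth_on_linear o bounded_linear_ident)
      show "(\<lambda>y. (y, d x)) ` c ` ?W \<subseteq> ?k ` (W \<inter> U \<times> V)" using *(4) by (auto simp: image_iff)
    qed
    then have "smooth_on (c ` ?W) (f \<circ> (\<lambda>b. (b, x)) \<circ> inv_into U c)"
      by (rule smooth_on_imp_eq[OF _ o])
        (use prod_inv[OF *(1,3)] R.chart(7)[OF *(3,4)] L.chart(7)[OF *(1)] *(4) in auto)
    then show "\<exists>V d S. (V, d) \<in> AB \<and> open S \<and> b \<in> S \<and> S \<subseteq> points AB \<inter> (\<lambda>b. (b, x)) -` W \<inter> V \<and>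
        smooth_on (d ` S) (f \<circ> (\<lambda>b. (b, x)) \<circ> inv_into V d)"
      using * b oW L.chart(1)[OF *(1)] by (intro exI[of _ U] exI[of _ c] exI[of _ ?W]) auto
  qed auto
qed


subsection \<open>Tangent vectors and fields on a product\<close>

abbreviation "dB z \<equiv> differential AB fst z"
abbreviation "dM z \<equiv> differential A snd z"
abbreviation "iB z \<equiv> differential At (\<lambda>b. (b, snd z)) (fst z)"
abbreviation "iM z \<equiv> differential At (\<lambda>x. (fst z, x)) (snd z)"

lemma inclusions:
  assumes z: "z \<in> points At"
  shows "v \<in> tangent_space AB (fst z) \<Longrightarrow> iB z v \<in> tangent_space At z"
    "v \<in> tangent_space AB (fst z) \<Longrightarrow> dB z (iB z v) = v"
    "v \<in> tangent_space AB (fst z) \<Longrightarrow> dM z (iB z v) = 0"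
    "w \<in> tangent_space A (snd z) \<Longrightarrow> iM z w \<in> tangent_space At z"
    "w \<in> tangent_space A (snd z) \<Longrightarrow> dB z (iM z w) = 0"
    "w \<in> tangent_space A (snd z) \<Longrightarrow> dM z (iM z w) = w"
proof -
  have p: "fst z \<in> points AB" "snd z \<in> points A" using z by (auto simp: points_prod)
  interpret l: smooth_mapping AB At "\<lambda>b. (b, snd z)" by (rule slice_left[OF p(2)])
  interpret r: smooth_mapping A At "\<lambda>x. (fst z, x)" by (rule slice_right[OF p(1)])
  interpret cl: smooth_mapping AB A "\<lambda>b. snd z"
    using l.smooth_mapping_compose[OF snd.smooth_mapping_axioms] by simp
  interpret cr: smooth_mapping A AB "\<lambda>x. fst z"
    using r.smooth_mapping_compose[OF fst.smooth_mapping_axioms] by simp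
  note comps = l.differential_comp[OF fst.smooth_mapping_axioms p(1), of "\<lambda>b. b"]
    l.differential_comp[OF snd.smooth_mapping_axioms p(1), of "\<lambda>b. snd z"]
    r.differential_comp[OF fst.smooth_mapping_axioms p(2), of "\<lambda>x. fst z"]
    r.differential_comp[OF snd.smooth_mapping_axioms p(2), of "\<lambda>x. x"]
  show "v \<in> tangent_space AB (fst z) \<Longrightarrow> iB z v \<in> tangent_space At z"
    using l.differential_tangent[OF p(1)] by simp
  show "w \<in> tangent_space A (snd z) \<Longrightarrow> iM z w \<in> tangent_space At z"
    using r.differential_tangent[OF p(2)] by simp
  show "v \<in> tangent_space AB (fst z) \<Longrightarrow> dB z (iB z v) = v"
    using comps(1) L.differential_ident by simp
  show "v \<in> tangent_space AB (fst z) \<Longrightarrow> dM z (iB z v) = 0"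
    using comps(2) cl.differential_const[OF p(1)] by simp
  show "w \<in> tangent_space A (snd z) \<Longrightarrow> dB z (iM z w) = 0"
    using comps(3) cr.differential_const[OF p(2)] by simp
  show "w \<in> tangent_space A (snd z) \<Longrightarrow> dM z (iM z w) = w"
    using comps(4) R.differential_ident by simp
qed

text \<open>The coordinate functions of a product chart factor through one of the projections.\<close>

lemma prod_tangent_eqI:
  assumes u: "u \<in> tangent_space At z" "u' \<in> tangent_space At z" and z: "z \<in> points At"
    and eq: "dB z u = dB z u'" "dM z u = dM z u'"
  shows "u = u'"
proof -
  obtain U c V d where *: "(U, c) \<in> AB" "fst z \<in> U" "(V, d) \<in> A" "snd z \<in> V"
    using z L.chart_at[of "fst z"] R.chart_at[of "snd z"] by (metis mem_Times_iff points_prod)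
  show ?thesis
  proof (rule P.tangent_eqI[OF u prod_chartI[OF *(1,3)]])
    show "z \<in> U \<times> V" using * by (simp add: mem_Times_iff)
    fix b :: "'f \<times> 'e" assume "b \<in> Basis"
    then consider i where "i \<in> Basis" "b = (i, 0)" | j where "j \<in> Basis" "b = (0, j)"
      by (auto simp: Basis_prod_def)
    then show "u (\<lambda>x. (case x of (x, y) \<Rightarrow> (c x, d y)) \<bullet> b) = u' (\<lambda>x. (case x of (x, y) \<Rightarrow> (c x, d y)) \<bullet> b)"
    proof cases
      case 1
      have "(\<lambda>x. (case x of (x, y) \<Rightarrow> (c x, d y)) \<bullet> b) = (\<lambda>x. c x \<bullet> i) \<circ> fst"
        by (auto simp: 1 split: prod.splits)
      moreover have "smooth_near AB (fst z) (\<lambda>x. c x \<bullet> i)"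
        by (rule L.smooth_nearI[OF L.smooth_fun_coord[OF *(1)] *(2)])
      ultimately show ?thesis using eq(1) by (metis fst.differential_apply)
    next
      case 2
      have "(\<lambda>x. (case x of (x, y) \<Rightarrow> (c x, d y)) \<bullet> b) = (\<lambda>x. d x \<bullet> j) \<circ> snd"
        by (auto simp: 2 split: prod.splits)
      moreover have "smooth_near A (snd z) (\<lambda>x. d x \<bullet> j)"
        by (rule R.smooth_nearI[OF R.smooth_fun_coord[OF *(3)] *(4)])
      ultimately show ?thesis using eq(2) by (metis snd.differential_apply)
    qed
  qed
qed

lemma prod_alongI:
  fixes C :: "('c::{t2_space,second_countable_topology}, 'g::euclidean_space) chart set"
  assumes F: "smooth_mapping C At F" and U: "open U" "U \<subseteq> points C"
    and t: "\<And>x. x \<in> U \<Longrightarrow> s x \<in> tangent_space At (F x)"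
    and sB: "smooth_along C AB (\<lambda>x. fst (F x)) U (\<lambda>x. dB (F x) (s x))"
    and sM: "smooth_along C A (\<lambda>x. snd (F x)) U (\<lambda>x. dM (F x) (s x))"
  shows "smooth_along C At F U s"
proof -
  interpret F: smooth_mapping C At F by (rule F)
  interpret fF: smooth_mapping C AB "\<lambda>x. fst (F x)" by (rule F.smooth_mapping_compose[OF fst.smooth_mapping_axioms])
  interpret sF: smooth_mapping C A "\<lambda>x. snd (F x)" by (rule F.smooth_mapping_compose[OF snd.smooth_mapping_axioms])
  show ?thesis
  proof (rule F.alongI[OF U t])
    fix S k and b :: "'f \<times> 'e" assume S: "(S, k) \<in> At" and "b \<in> Basis"
    then consider i where "i \<in> Basis" "b = (i, 0)" | j where "j \<in> Basis" "b = (0, j)"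
      by (auto simp: Basis_prod_def)
    note cases = this
    obtain V c W d where *: "(V, c) \<in> AB" "(W, d) \<in> A" "S = V \<times> W" "k = (\<lambda>(x, y). (c x, d y))"
      using S by (rule prod_chartE)
    have o: "open (U \<inter> F -` S)"
      using F.preimage_open[OF P.chart(1)[OF S] P.chart(6)[OF S] U] .
    from cases show "smooth_fun C (U \<inter> F -` S) (\<lambda>x. s x (\<lambda>y. k y \<bullet> b))"
    proof cases
      case 1
      have eq: "(\<lambda>y. k y \<bullet> b) = (\<lambda>x. c x \<bullet> i) \<circ> fst" by (auto simp: 1 * split: prod.splits)
      have "smooth_fun C (U \<inter> F -` S) (\<lambda>x. dB (F x) (s x) (\<lambda>x. c x \<bullet> i))"
        by (rule F.M.smooth_fun_subset[OF fF.along_smooth[OF sB L.smooth_fun_coord[OF *(1)]] o]) (auto simp: *)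
      then show ?thesis
        unfolding eq
        by (rule F.M.smooth_fun_cong, intro fst.differential_apply L.smooth_nearI[OF L.smooth_fun_coord[OF *(1)]])
          (auto simp: *(3))
    next
      case 2
      have eq: "(\<lambda>y. k y \<bullet> b) = (\<lambda>x. d x \<bullet> j) \<circ> snd" by (auto simp: 2 * split: prod.splits)
      have "smooth_fun C (U \<inter> F -` S) (\<lambda>x. dM (F x) (s x) (\<lambda>x. d x \<bullet> j))"
        by (rule F.M.smooth_fun_subset[OF sF.along_smooth[OF sM R.smooth_fun_coord[OF *(2)]] o]) (auto simp: *)
      then show ?thesis
        unfolding eq
        by (rule F.M.smooth_fun_cong, intro snd.differential_apply R.smooth_nearI[OF R.smooth_fun_coord[OF *(2)]])
          (auto simp: *(3))
    qed
  qed
qed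

definition lift_right :: "('m \<Rightarrow> 'm tvec) \<Rightarrow> 'b \<times> 'm \<Rightarrow> ('b \<times> 'm) tvec" where
  "lift_right X z = iM z (X (snd z))"

lemma lift_left_projections:
  assumes "vector_field AB W X" "z \<in> W \<times> points A"
  shows "lift_field At X z \<in> tangent_space At z" "dB z (lift_field At X z) = X (fst z)" "dM z (lift_field At X z) = 0"
proof -
  have z: "z \<in> points At" using assms L.ident.along_points[OF assms(1)] by (auto simp: points_prod)
  have "X (fst z) \<in> tangent_space AB (fst z)" using L.ident.along_tangent[OF assms(1)] assms(2) by auto
  then show "lift_field At X z \<in> tangent_space At z" "dB z (lift_field At X z) = X (fst z)" "dM z (lift_field At X z) = 0"
    using inclusions[OF z] by (simp_all add: lift_field_def)
qed

lemma lift_right_projections: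
  assumes "vector_field A W X" "z \<in> points AB \<times> W"
  shows "lift_right X z \<in> tangent_space At z" "dB z (lift_right X z) = 0" "dM z (lift_right X z) = X (snd z)"
proof -
  have z: "z \<in> points At" using assms R.ident.along_points[OF assms(1)] by (auto simp: points_prod)
  have "X (snd z) \<in> tangent_space A (snd z)" using R.ident.along_tangent[OF assms(1)] assms(2) by auto
  then show "lift_right X z \<in> tangent_space At z" "dB z (lift_right X z) = 0" "dM z (lift_right X z) = X (snd z)"
    using inclusions[OF z] by (simp_all add: lift_right_def)
qed

lemma lift_left_smooth:
  assumes X: "vector_field AB W X"
  shows "vector_field At (W \<times> points A) (lift_field At X)"
proof (rule prod_alongI[OF P.smooth_mapping_ident])
  show o: "open (W \<times> points A)" using L.ident.along_open[OF X] R.points_open by (rule open_Times)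
  show p: "W \<times> points A \<subseteq> points At" using L.ident.along_points[OF X] by (auto simp: points_prod)
  show "lift_field At X z \<in> tangent_space At z" if "z \<in> W \<times> points A" for z
    using lift_left_projections[OF X that] by simp
  have "smooth_along At AB fst (W \<times> points A) (\<lambda>z. X (fst z))"
    using fst.along_compose[OF L.smooth_mapping_ident X o p] by auto
  then show "smooth_along At AB fst (W \<times> points A) (\<lambda>z. dB z (lift_field At X z))"
    by (rule fst.along_cong) (simp add: lift_left_projections[OF X])
  show "smooth_along At A snd (W \<times> points A) (\<lambda>z. dM z (lift_field At X z))"
    by (rule snd.along_cong[OF snd.along_zero[OF o p]]) (simp add: lift_left_projections[OF X])
qed

lemma lift_right_smooth:
  assumes X: "vector_field A W X"
  shows "vector_field At (points AB \<times> W) (lift_right X)"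
proof (rule prod_alongI[OF P.smooth_mapping_ident])
  show o: "open (points AB \<times> W)" using L.points_open R.ident.along_open[OF X] by (rule open_Times)
  show p: "points AB \<times> W \<subseteq> points At" using R.ident.along_points[OF X] by (auto simp: points_prod)
  show "lift_right X z \<in> tangent_space At z" if "z \<in> points AB \<times> W" for z
    using lift_right_projections[OF X that] by simp
  have "smooth_along At A snd (points AB \<times> W) (\<lambda>z. X (snd z))"
    using snd.along_compose[OF R.smooth_mapping_ident X o p] by auto
  then show "smooth_along At A snd (points AB \<times> W) (\<lambda>z. dM z (lift_right X z))"
    by (rule snd.along_cong) (simp add: lift_right_projections[OF X])
  show "smooth_along At AB fst (points AB \<times> W) (\<lambda>z. dB z (lift_right X z))"
    by (rule fst.along_cong[OF fst.along_zero[OF o p]]) (simp add: lift_right_projections[OF X])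
qed

lemma bracket_right_right:
  assumes X: "vector_field A W X" and Y: "vector_field A W Y" and z: "z \<in> points AB \<times> W"
  shows "dB z (lie_bracket At (lift_right X) (lift_right Y) z) = 0"
    "dM z (lie_bracket At (lift_right X) (lift_right Y) z) = lie_bracket A X Y (snd z)"
proof -
  note l = lift_right_smooth[OF X] lift_right_smooth[OF Y]
  note zero = L.ident.along_zero[OF L.points_open order_refl]
  show "dM z (lie_bracket At (lift_right X) (lift_right Y) z) = lie_bracket A X Y (snd z)"
    by (rule snd.related_bracket[OF l X Y _ _ _ z])
      (auto simp: lift_right_projections[OF X] lift_right_projections[OF Y])
  have "dB z (lie_bracket At (lift_right X) (lift_right Y) z) = lie_bracket AB (\<lambda>_. 0) (\<lambda>_. 0) (fst z)"
    by (rule fst.related_bracket[OF l zero zero _ _ _ z])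
      (auto simp: lift_right_projections[OF X] lift_right_projections[OF Y])
  then show "dB z (lie_bracket At (lift_right X) (lift_right Y) z) = 0"
    using L.lie_bracket_zero[OF zero] z by auto
qed

lemma bracket_mixed:
  assumes X: "vector_field A W X" and Z: "vector_field AB (points AB) Z" and z: "z \<in> points AB \<times> W"
  shows "lie_bracket At (lift_right X) (lift_field At Z) z = 0" "lie_bracket At (lift_field At Z) (lift_right X) z = 0"
proof -
  let ?U = "points AB \<times> W"
  have o: "open ?U" using L.points_open R.ident.along_open[OF X] by (rule open_Times)
  have zp: "z \<in> points At" using z R.ident.along_points[OF X] by (auto simp: points_prod)
  have W: "W \<subseteq> points A" by (rule R.ident.along_points[OF X])
  note lX = lift_right_smooth[OF X]
  have lZ: "vector_field At ?U (lift_field At Z)"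
    by (rule P.ident.along_subset[OF lift_left_smooth[OF Z] o]) (use W in auto)
  note zB = L.ident.along_zero[OF L.points_open order_refl]
    and zM = R.ident.along_zero[OF R.ident.along_open[OF X] R.ident.along_points[OF X]]
  have pX: "dB q (lift_right X q) = 0" "dM q (lift_right X q) = X (snd q)"
    and pZ: "dB q (lift_field At Z q) = Z (fst q)" "dM q (lift_field At Z q) = 0" if "q \<in> ?U" for q
    using that W lift_right_projections[OF X that] lift_left_projections[OF Z, of q] by auto
  have zz: "fst z \<in> points AB" "snd z \<in> W" using z by auto
  show "lie_bracket At (lift_right X) (lift_field At Z) z = 0"
  proof (rule prod_tangent_eqI[OF P.lie_bracket_tangent[OF lX lZ z] subspace_0[OF P.subspace_tangent] zp])
    have "dB z (lie_bracket At (lift_right X) (lift_field At Z) z) = lie_bracket AB (\<lambda>_. 0) Z (fst z)"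
      by (rule fst.related_bracket[OF lX lZ zB Z _ _ _ z]) (auto simp: pX pZ)
    then show "dB z (lie_bracket At (lift_right X) (lift_field At Z) z) = dB z 0"
      using L.lie_bracket_zero[OF Z zz(1)] by (simp add: differential_linear)
    have "dM z (lie_bracket At (lift_right X) (lift_field At Z) z) = lie_bracket A X (\<lambda>_. 0) (snd z)"
      by (rule snd.related_bracket[OF lX lZ X zM _ _ _ z]) (auto simp: pX pZ)
    then show "dM z (lie_bracket At (lift_right X) (lift_field At Z) z) = dM z 0"
      using R.lie_bracket_zero[OF X zz(2)] by (simp add: differential_linear)
  qed
  then show "lie_bracket At (lift_field At Z) (lift_right X) z = 0"
    by (auto simp: lie_bracket_def fun_eq_iff split: if_splits)
qed

lemma bracket_left_left:
  assumes Y: "vector_field AB (points AB) Y" and Z: "vector_field AB (points AB) Z" and z: "z \<in> points At"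
  shows "dM z (lie_bracket At (lift_field At Y) (lift_field At Z) z) = 0"
proof -
  note zM = R.ident.along_zero[OF R.points_open order_refl]
  have z': "z \<in> points AB \<times> points A" using z by (simp add: points_prod)
  have "dM z (lie_bracket At (lift_field At Y) (lift_field At Z) z) = lie_bracket A (\<lambda>_. 0) (\<lambda>_. 0) (snd z)"
    by (rule snd.related_bracket[OF lift_left_smooth[OF Y] lift_left_smooth[OF Z] zM zM _ _ _ z'])
      (auto simp: lift_left_projections[OF Y] lift_left_projections[OF Z])
  then show ?thesis using R.lie_bracket_zero[OF zM] z' by auto
qed

end


section \<open>The Levi-Civita connection of the warped metric along a slice\<close>

lemma smooth_atlas_open:
  fixes B :: "'e::euclidean_space set"
  assumes "open B"
  shows "smooth_atlas (open_atlas B)" "points (open_atlas B) = B"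
proof -
  have inv: "inv_into B (\<lambda>x. x) y = y" if "y \<in> B" for y using inv_into_f_f[of "\<lambda>x. x" B y] that by simp
  have cont: "continuous_on B (inv_into B (\<lambda>x. x))"
    by (rule continuous_on_cong[THEN iffD1, OF refl _ continuous_on_id]) (simp add: inv)
  have "smooth_on B ((\<lambda>x. x) \<circ> inv_into B (\<lambda>x. x))"
    by (rule smooth_on_imp_eq[OF smooth_on_linear[OF bounded_linear_ident assms] assms]) (simp add: inv)
  then show "smooth_atlas (open_atlas B)"
    using assms cont by (auto simp: smooth_atlas_def open_atlas_def homeomorphism_def inv image_iff)
  show "points (open_atlas B) = B" by (simp add: points_def open_atlas_def)
qed

locale warped_slice = product_manifold AB A
  for AB :: "('b::{t2_space,second_countable_topology}, 'f::euclidean_space) chart set"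
    and A :: "('m::{t2_space,second_countable_topology}, 'e::euclidean_space) chart set" +
  fixes g :: "'m \<Rightarrow> 'm tvec \<Rightarrow> 'm tvec \<Rightarrow> real" and gB :: "'b \<Rightarrow> 'b tvec \<Rightarrow> 'b tvec \<Rightarrow> real"
    and \<xi> \<eta> :: "'b \<Rightarrow> 'b tvec" and \<phi> :: "'b \<Rightarrow> real" and b0 :: 'b
    and DM :: "('m, 'm tvec) conn" and DMt :: "('b \<times> 'm, ('b \<times> 'm) tvec) conn"
    and D :: "('m, ('b \<times> 'm) tvec) conn"
  assumes dim_base: "DIM('f) = 2"
    and g: "riemannian_metric A g" and gB: "lorentzian_metric AB gB"
    and null: "lightlike_field AB gB \<xi>" "lightlike_field AB gB \<eta>"
    and pair: "\<And>b. b \<in> points AB \<Longrightarrow> gB b (\<xi> b) (\<eta> b) = -1"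
    and \<phi>: "smooth_fun AB (points AB) \<phi>"
    and base: "b0 \<in> points AB" "\<phi> b0 = 1"
    and LC: "levi_civita A g DM" "levi_civita At (warped_metric AB A gB \<phi> g) DMt"
    and pullback: "pullback_connection A At (\<lambda>x. (b0, x)) DMt D"
begin

text \<open>\<open>J\<close> is the differential of the slice \<open>x \<mapsto> (b0, x)\<close>, and \<open>xi\<close>, \<open>et\<close> are the null normal fields
  along it. The combination \<open>nu\<close> turns out to be the mean curvature vector, and \<open>- nu\<close> to be the lift of
  the gradient of \<open>\<phi>\<close>.\<close>

abbreviation "gt \<equiv> warped_metric AB A gB \<phi> g"
abbreviation "h x \<equiv> gt (b0, x)"
abbreviation "lam \<equiv> \<xi> b0 \<phi>"
abbreviation "mu \<equiv> \<eta> b0 \<phi>"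
abbreviation "J \<equiv> differential At (\<lambda>x. (b0, x))"
abbreviation "xi x \<equiv> lift_field At \<xi> (b0, x)"
abbreviation "et x \<equiv> lift_field At \<eta> (b0, x)"
abbreviation "nu x \<equiv> mu *\<^sub>R xi x + lam *\<^sub>R et x"

lemma g_metric: "bundle_metric A (tangent_bundle A) g DIM('e) 0"
  using g by (simp add: riemannian_metric_def)

lemma gB_metric: "bundle_metric AB (tangent_bundle AB) gB 1 1"
  using gB by (simp add: lorentzian_metric_def dim_base)

lemma g_form: "x \<in> points A \<Longrightarrow> inner_form (tangent_space A x) (g x)"
  by (rule R.tangent_metric_form[OF g_metric])

lemma gB_form: "b \<in> points AB \<Longrightarrow> inner_form (tangent_space AB b) (gB b)"
  by (rule L.tangent_metric_form[OF gB_metric])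

lemma g_signature: "x \<in> points A \<Longrightarrow> has_signature (tangent_space A x) (g x) DIM('e) 0"
  using g_metric by (auto simp: bundle_metric_def pullback_tangent_bundle_def)

lemma null_fields: "vector_field AB (points AB) \<xi>" "vector_field AB (points AB) \<eta>"
  and null_tangent: "b \<in> points AB \<Longrightarrow> \<xi> b \<in> tangent_space AB b" "b \<in> points AB \<Longrightarrow> \<eta> b \<in> tangent_space AB b"
  and null_products: "b \<in> points AB \<Longrightarrow> gB b (\<xi> b) (\<xi> b) = 0" "b \<in> points AB \<Longrightarrow> gB b (\<eta> b) (\<eta> b) = 0"
    "b \<in> points AB \<Longrightarrow> gB b (\<xi> b) (\<eta> b) = -1" "b \<in> points AB \<Longrightarrow> gB b (\<eta> b) (\<xi> b) = -1"
proof -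
  show f: "vector_field AB (points AB) \<xi>" "vector_field AB (points AB) \<eta>"
    using null by (auto simp: lightlike_field_def)
  show t: "b \<in> points AB \<Longrightarrow> \<xi> b \<in> tangent_space AB b" "b \<in> points AB \<Longrightarrow> \<eta> b \<in> tangent_space AB b"
    using L.ident.along_tangent[OF f(1)] L.ident.along_tangent[OF f(2)] by auto
  show "b \<in> points AB \<Longrightarrow> gB b (\<xi> b) (\<xi> b) = 0" "b \<in> points AB \<Longrightarrow> gB b (\<eta> b) (\<eta> b) = 0"
    using null by (auto simp: lightlike_field_def)
  show "b \<in> points AB \<Longrightarrow> gB b (\<xi> b) (\<eta> b) = -1" by (rule pair)
  then show "b \<in> points AB \<Longrightarrow> gB b (\<eta> b) (\<xi> b) = -1" using inner_form.sym[OF gB_form] t by metis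
qed

text \<open>The null fields span: a vector orthogonal to both, if nonzero, would give three independent
  vectors in a plane.\<close>

lemma null_expansion:
  assumes b: "b \<in> points AB" and w: "w \<in> tangent_space AB b"
  shows "w = (- gB b w (\<eta> b)) *\<^sub>R \<xi> b + (- gB b w (\<xi> b)) *\<^sub>R \<eta> b"
proof -
  interpret G: inner_form "tangent_space AB b" "gB b" by (rule gB_form[OF b])
  note t = null_tangent[OF b] and p = null_products[OF b]
  define w' where "w' = w + (gB b w (\<eta> b) *\<^sub>R \<xi> b + gB b w (\<xi> b) *\<^sub>R \<eta> b)"
  have w': "w' \<in> tangent_space AB b" unfolding w'_def by (intro G.E_add G.E_scale t w)
  have o: "gB b w' (\<xi> b) = 0" "gB b w' (\<eta> b) = 0"
    unfolding w'_def by (simp_all add: G.add_left G.scale_left G.E_add G.E_scale t w p)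
  have "w' = 0"
  proof (rule ccontr)
    assume nz: "w' \<noteq> 0"
    define e where "e i = (if i = 0 then \<xi> b else if i = 1 then \<eta> b else w')" for i :: nat
    have sum3: "(\<Sum>i<3. a i *\<^sub>R e i) = a 0 *\<^sub>R \<xi> b + (a 1 *\<^sub>R \<eta> b + a 2 *\<^sub>R w')" for a :: "nat \<Rightarrow> real"
      by (simp add: e_def eval_nat_numeral add.assoc)
    have "a i = 0" if 0: "(\<Sum>i<3. a i *\<^sub>R e i) = 0" and i: "i \<in> {..<3}" for a i
    proof -
      let ?s = "a 0 *\<^sub>R \<xi> b + (a 1 *\<^sub>R \<eta> b + a 2 *\<^sub>R w')"
      have s0: "?s = 0" using 0 unfolding sum3 .
      have "gB b ?s (\<xi> b) = - a 1" "gB b ?s (\<eta> b) = - a 0"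
        by (simp_all add: G.add_left G.scale_left G.E_add G.E_scale t w' p o)
      then have a: "a 0 = 0" "a 1 = 0" using s0 G.zero_left t by auto
      then have "a 2 = 0" using s0 nz by simp
      moreover have "i = 0 \<or> i = 1 \<or> i = 2" using i by auto
      ultimately show ?thesis using a by auto
    qed
    then have ind: "inj_on e {..<3}" "independent (e ` {..<3})"
      using independent_familyI[of "{..<3}" e] by blast+
    have "has_signature (tangent_space AB b) (gB b) 1 1"
      using gB_metric b by (auto simp: bundle_metric_def pullback_tangent_bundle_def)
    then obtain f :: "nat \<Rightarrow> 'b tvec" where f: "span (f ` {..<1+1}) = tangent_space AB b"
      unfolding has_signature_def by blast
    have "e ` {..<3} \<subseteq> span (f ` {..<1+1})" unfolding f using t w' by (auto simp: e_def)
    then have "card (e ` {..<3}) \<le> card (f ` {..<1+1})" using independent_span_bound[OF _ ind(2)] by auto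
    also have "\<dots> \<le> 2" using card_image_le[of "{..<1+1}" f] by simp
    finally show False using card_image[OF ind(1)] by simp
  qed
  then have "w + (gB b w (\<eta> b) *\<^sub>R \<xi> b + gB b w (\<xi> b) *\<^sub>R \<eta> b) = 0" by (simp add: w'_def)
  then have "w = - (gB b w (\<eta> b) *\<^sub>R \<xi> b + gB b w (\<xi> b) *\<^sub>R \<eta> b)" by (rule eq_neg_iff_add_eq_0[THEN iffD2])
  then show ?thesis by simp
qed

lemma gt_apply: "gt z u v = gB (fst z) (dB z u) (dB z v) + (\<phi> (fst z))\<^sup>2 * g (snd z) (dM z u) (dM z v)"
  by (simp add: warped_metric_def pullback_metric_def)

lemma gt_form:
  assumes z: "z \<in> points At"
  shows "inner_form (tangent_space At z) (gt z)"
proof -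
  have p: "fst z \<in> points AB" "snd z \<in> points A" using z by (auto simp: points_prod)
  interpret GB: inner_form "tangent_space AB (fst z)" "gB (fst z)" by (rule gB_form[OF p(1)])
  interpret G: inner_form "tangent_space A (snd z)" "g (snd z)" by (rule g_form[OF p(2)])
  note t = fst.differential_tangent[OF z] snd.differential_tangent[OF z]
  show ?thesis
  proof
    show "gt z u v = gt z v u" if "u \<in> tangent_space At z" "v \<in> tangent_space At z" for u v
      using GB.sym[OF t(1) t(1)] G.sym[OF t(2) t(2)] that by (simp add: gt_apply)
    show "gt z (a *\<^sub>R u + v) w = a * gt z u w + gt z v w"
      if "u \<in> tangent_space At z" "v \<in> tangent_space At z" "w \<in> tangent_space At z" for u v w a
      using GB.lin[OF t(1) t(1) t(1)] G.lin[OF t(2) t(2) t(2)] that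
      by (simp add: gt_apply differential_linear algebra_simps)
  qed (rule P.subspace_tangent)
qed

lemma slice_point: "x \<in> points A \<Longrightarrow> (b0, x) \<in> points At"
  using base(1) by (simp add: points_prod)

sublocale slice: smooth_mapping A At "\<lambda>x. (b0, x)"
  by (rule slice_right[OF base(1)])

lemma J_projections:
  assumes "x \<in> points A" "v \<in> tangent_space A x"
  shows "J x v \<in> tangent_space At (b0, x)" "dB (b0, x) (J x v) = 0" "dM (b0, x) (J x v) = v"
  using inclusions[OF slice_point[OF assms(1)]] assms(2) by simp_all

lemma lift_right_slice: "lift_right X (b0, x) = J x (X x)"
  by (simp add: lift_right_def)

lemma xi_projections:
  assumes "x \<in> points A"
  shows "xi x \<in> tangent_space At (b0, x)" "dB (b0, x) (xi x) = \<xi> b0" "dM (b0, x) (xi x) = 0"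
    "et x \<in> tangent_space At (b0, x)" "dB (b0, x) (et x) = \<eta> b0" "dM (b0, x) (et x) = 0"
  using lift_left_projections[OF null_fields(1), of "(b0, x)"] lift_left_projections[OF null_fields(2), of "(b0, x)"]
    base(1) assms by simp_all


subsection \<open>Derivatives of the metric coefficients of lifted fields\<close>

lemma deriv_right_right:
  assumes X: "vector_field A U X" and Z: "vector_field A U Z" and x: "x \<in> U" and u: "u \<in> tangent_space At (b0, x)"
  shows "u (\<lambda>q. gt q (lift_right X q) (lift_right Z q)) =
    2 * dB (b0, x) u \<phi> * g x (X x) (Z x) + dM (b0, x) u (\<lambda>y. g y (X y) (Z y))"
proof -
  let ?\<gamma> = "\<lambda>y. g y (X y) (Z y)" and ?\<Phi> = "\<lambda>b. \<phi> b * \<phi> b" and ?z = "(b0, x)"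
  have U: "open U" "U \<subseteq> points A" using X by (auto simp: smooth_along_def)
  have z: "?z \<in> points At" using x U slice_point by auto
  have s\<phi>: "smooth_near AB (fst ?z) \<phi>" using L.smooth_nearI[OF \<phi> base(1)] by simp
  have s\<Phi>: "smooth_near AB (fst ?z) ?\<Phi>" by (intro L.smooth_near_mult s\<phi>)
  have s\<gamma>: "smooth_near A (snd ?z) ?\<gamma>" using R.smooth_nearI[OF R.metric_smooth[OF g_metric X Z] x] by simp
  note sp = fst.pullback_smooth_near[OF z s\<Phi>] snd.pullback_smooth_near[OF z s\<gamma>]
  have o: "open (points AB \<times> U)" using L.points_open U(1) by (rule open_Times)
  have uB: "dB ?z u \<in> tangent_space AB b0" using fst.differential_tangent[OF z u] by simp
  have "u (\<lambda>q. gt q (lift_right X q) (lift_right Z q)) = u (\<lambda>q. (?\<Phi> \<circ> fst) q * (?\<gamma> \<circ> snd) q)"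
  proof (rule P.tangent_germ[OF u _ o, symmetric])
    show "smooth_near At ?z (\<lambda>q. (?\<Phi> \<circ> fst) q * (?\<gamma> \<circ> snd) q)" using sp by (rule P.smooth_near_mult)
    show "?z \<in> points AB \<times> U" using base(1) x by simp
    fix q assume q: "q \<in> points AB \<times> U"
    interpret G: inner_form "tangent_space AB (fst q)" "gB (fst q)" using gB_form q by auto
    show "(?\<Phi> \<circ> fst) q * (?\<gamma> \<circ> snd) q = gt q (lift_right X q) (lift_right Z q)"
      using lift_right_projections[OF X q] lift_right_projections[OF Z q]
      by (simp add: gt_apply power2_eq_square G.zero_left G.E_zero)
  qed
  also have "\<dots> = (?\<Phi> \<circ> fst) ?z * u (?\<gamma> \<circ> snd) + (?\<gamma> \<circ> snd) ?z * u (?\<Phi> \<circ> fst)"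
    by (rule P.tangent_mult[OF u sp])
  also have "u (?\<gamma> \<circ> snd) = dM ?z u ?\<gamma>" using snd.differential_apply[OF s\<gamma>] by simp
  also have "u (?\<Phi> \<circ> fst) = dB ?z u ?\<Phi>" using fst.differential_apply[OF s\<Phi>] by simp
  also have "dB ?z u ?\<Phi> = \<phi> b0 * dB ?z u \<phi> + \<phi> b0 * dB ?z u \<phi>"
    using L.tangent_mult[OF uB] s\<phi> by simp
  finally show ?thesis by (simp add: base(2))
qed

lemma deriv_right_left:
  assumes X: "vector_field A U X" and \<zeta>: "vector_field AB (points AB) \<zeta>" and x: "x \<in> U" and u: "u \<in> tangent_space At (b0, x)"
  shows "u (\<lambda>q. gt q (lift_right X q) (lift_field At \<zeta> q)) = 0"
    "u (\<lambda>q. gt q (lift_field At \<zeta> q) (lift_right X q)) = 0"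
proof -
  have U: "open U" "U \<subseteq> points A" using X by (auto simp: smooth_along_def)
  have z: "(b0, x) \<in> points At" using x U slice_point by auto
  have o: "open (points AB \<times> U)" "(b0, x) \<in> points AB \<times> U"
    using L.points_open U(1) base(1) x by (auto intro: open_Times)
  have eq: "gt q (lift_right X q) (lift_field At \<zeta> q) = 0" "gt q (lift_field At \<zeta> q) (lift_right X q) = 0"
    if q: "q \<in> points AB \<times> U" for q
  proof -
    have q': "q \<in> points AB \<times> points A" using q U by auto
    interpret GB: inner_form "tangent_space AB (fst q)" "gB (fst q)" using gB_form q by auto
    interpret G: inner_form "tangent_space A (snd q)" "g (snd q)" using g_form q' by auto
    have "\<zeta> (fst q) \<in> tangent_space AB (fst q)" "X (snd q) \<in> tangent_space A (snd q)"
      using L.ident.along_tangent[OF \<zeta>] R.ident.along_tangent[OF X] q by auto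
    then show "gt q (lift_right X q) (lift_field At \<zeta> q) = 0" "gt q (lift_field At \<zeta> q) (lift_right X q) = 0"
      using lift_right_projections[OF X q] lift_left_projections[OF \<zeta> q']
      by (simp_all add: gt_apply GB.bilinear G.bilinear)
  qed
  note 0 = P.tangent_germ[OF u P.smooth_near_const[OF z, of 0] o, symmetric]
  show "u (\<lambda>q. gt q (lift_right X q) (lift_field At \<zeta> q)) = 0" "u (\<lambda>q. gt q (lift_field At \<zeta> q) (lift_right X q)) = 0"
    using 0[of "\<lambda>q. gt q (lift_right X q) (lift_field At \<zeta> q)"] 0[of "\<lambda>q. gt q (lift_field At \<zeta> q) (lift_right X q)"]
      eq P.tangent_const[OF u z] by auto
qed

lemma deriv_left_left:
  assumes \<zeta>: "vector_field AB (points AB) \<zeta>" "vector_field AB (points AB) \<zeta>'"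
    and x: "x \<in> points A" and u: "u \<in> tangent_space At (b0, x)" "dB (b0, x) u = 0"
  shows "u (\<lambda>q. gt q (lift_field At \<zeta> q) (lift_field At \<zeta>' q)) = 0"
proof -
  let ?\<gamma> = "\<lambda>b. gB b (\<zeta> b) (\<zeta>' b)"
  have z: "(b0, x) \<in> points At" by (rule slice_point[OF x])
  have s: "smooth_near AB (fst (b0, x)) ?\<gamma>" using L.smooth_nearI[OF L.metric_smooth[OF gB_metric \<zeta>] base(1)] by simp
  have "u (\<lambda>q. gt q (lift_field At \<zeta> q) (lift_field At \<zeta>' q)) = u (?\<gamma> \<circ> fst)"
  proof (rule P.tangent_germ[OF u(1) fst.pullback_smooth_near[OF z s] P.points_open z, symmetric])
    fix q assume "q \<in> points At"
    then have q: "q \<in> points AB \<times> points A" by (simp add: points_prod)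
    then interpret G: inner_form "tangent_space A (snd q)" "g (snd q)" using g_form by auto
    show "(?\<gamma> \<circ> fst) q = gt q (lift_field At \<zeta> q) (lift_field At \<zeta>' q)"
      using lift_left_projections[OF \<zeta>(1) q] lift_left_projections[OF \<zeta>(2) q]
      by (simp add: gt_apply G.zero_left G.E_zero)
  qed
  also have "\<dots> = dB (b0, x) u ?\<gamma>" using fst.differential_apply[OF s] by simp
  finally show ?thesis using u(2) by simp
qed


subsection \<open>Covariant derivatives of lifted fields\<close>

lemma tangent_eq_by_metric:
  assumes x: "x \<in> points A" and w: "w \<in> tangent_space A x" "w' \<in> tangent_space A x"
    and eq: "\<And>u. u \<in> tangent_space A x \<Longrightarrow> g x w u = g x w' u"
  shows "w = w'"
proof (rule ccontr)
  interpret G: inner_form "tangent_space A x" "g x" by (rule g_form[OF x])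
  assume "w \<noteq> w'"
  then have "w - w' \<in> tangent_space A x" "w - w' \<noteq> 0" using w G.E_diff by auto
  from G.pos_def[OF g_signature[OF x] this] show False
    using eq[OF \<open>w - w' \<in> _\<close>] G.diff_left[OF w \<open>w - w' \<in> _\<close>] by simp
qed

lemma fields_at:
  assumes X: "vector_field A U X" and x: "x \<in> U" and u: "u \<in> tangent_space A x"
  obtains W Z where "x \<in> W" "W \<subseteq> U" "vector_field A W X" "vector_field A W Z" "Z x = u"
proof -
  obtain U' Z where Z: "x \<in> U'" "vector_field A U' Z" "Z x = u"
    using R.vector_field_at[OF _ u] R.ident.along_points[OF X] x by blast
  have o: "open (U \<inter> U')" using R.ident.along_open X Z(2) by auto
  show ?thesis
    by (rule that[of "U \<inter> U'" Z])
      (use Z x in \<open>auto intro: R.ident.along_subset[OF X o] R.ident.along_subset[OF Z(2) o]\<close>)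
qed

lemma lift_left_on:
  assumes \<zeta>: "vector_field AB (points AB) \<zeta>" and X: "vector_field A U X"
  shows "vector_field At (points AB \<times> U) (lift_field At \<zeta>)"
proof (rule P.ident.along_subset[OF lift_left_smooth[OF \<zeta>]])
  show "open (points AB \<times> U)" using L.points_open R.ident.along_open[OF X] by (rule open_Times)
qed (use R.ident.along_points[OF X] in auto)

lemma ambient_connection: "connection_along At At (\<lambda>z. z) DMt"
  by (rule P.connection_along_ident[OF P.levi_civita_connection[OF LC(2)]])

lemma base_connection: "connection_along A A (\<lambda>x. x) DM"
  by (rule R.connection_along_ident[OF R.levi_civita_connection[OF LC(1)]])

text \<open>In the Koszul formula for \<open>\<nabla>\<^sub>X \<zeta>\<close> all brackets vanish or are orthogonal to the remaining
  argument, and the only derivative of a metric coefficient that survives is that of \<open>\<phi>\<^sup>2 g(X, Z)\<close>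
  along \<open>\<zeta>\<close>.\<close>

lemma ambient_derivative_left:
  assumes X: "vector_field A U X" and x: "x \<in> U" and \<zeta>: "vector_field AB (points AB) \<zeta>"
  shows "DMt (b0, x) (J x (X x)) (lift_field At \<zeta>) = \<zeta> b0 \<phi> *\<^sub>R J x (X x)"
proof -
  let ?z = "(b0, x)" and ?w = "DMt (b0, x) (J x (X x)) (lift_field At \<zeta>)"
  interpret C: connection_along At At "\<lambda>z. z" DMt by (rule ambient_connection)
  have xA: "x \<in> points A" using R.ident.along_points[OF X] x by auto
  have z: "?z \<in> points At" by (rule slice_point[OF xA])
  interpret GT: inner_form "tangent_space At ?z" "gt ?z" by (rule gt_form[OF z])
  interpret GB: inner_form "tangent_space AB b0" "gB b0" by (rule gB_form[OF base(1)])
  interpret G: inner_form "tangent_space A x" "g x" by (rule g_form[OF xA])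
  have Xx: "X x \<in> tangent_space A x" by (rule R.ident.along_tangent[OF X x])
  note Jp = J_projections[OF xA]
  have zU: "?z \<in> points AB \<times> U" using base(1) x by simp
  have w: "?w \<in> tangent_space At ?z"
    by (rule C.conn_fibre[OF lift_left_on[OF \<zeta> X] zU]) (rule Jp[OF Xx])
  have wB: "dB ?z ?w \<in> tangent_space AB b0" and wM: "dM ?z ?w \<in> tangent_space A x"
    using fst.differential_tangent[OF z w] snd.differential_tangent[OF z w] by simp_all
  have left: "gB b0 (dB ?z ?w) (\<zeta>' b0) = 0" if \<zeta>': "vector_field AB (points AB) \<zeta>'" for \<zeta>'
  proof -
    have z': "?z \<in> points AB \<times> points A" using base(1) xA by simp
    have t: "\<zeta> b0 \<in> tangent_space AB b0" "\<zeta>' b0 \<in> tangent_space AB b0"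
      using L.ident.along_tangent[OF \<zeta> base(1)] L.ident.along_tangent[OF \<zeta>' base(1)] .
    note pr = lift_left_projections[OF \<zeta> z'] lift_left_projections[OF \<zeta>' z']
    have br: "lie_bracket At (lift_field At \<zeta>) (lift_field At \<zeta>') ?z \<in> tangent_space At ?z"
      by (rule P.lie_bracket_tangent[OF lift_left_on[OF \<zeta> X] lift_left_on[OF \<zeta>' X] zU])
    have "2 * gt ?z ?w (lift_field At \<zeta>' ?z) = 0"
      unfolding lift_right_slice[symmetric]
      by (subst P.Koszul[OF LC(2) GT.inner_form_axioms lift_right_smooth[OF X] lift_left_on[OF \<zeta> X] lift_left_on[OF \<zeta>' X] zU])
        (use fst.differential_tangent[OF z br] in \<open>simp add: lift_right_slice deriv_left_left[OF \<zeta> \<zeta>' xA] Jp[OF Xx]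
          deriv_right_left[OF X \<zeta> x] deriv_right_left[OF X \<zeta>' x] pr
          bracket_mixed[OF X \<zeta> zU] bracket_mixed[OF X \<zeta>' zU] GT.zero_left
          gt_apply[of ?z "lie_bracket At (lift_field At \<zeta>) (lift_field At \<zeta>') ?z"]
          bracket_left_left[OF \<zeta> \<zeta>' z] GB.bilinear G.bilinear Xx\<close>)
    then show ?thesis
      using pr wM by (simp add: gt_apply G.zero_right)
  qed
  have "dB ?z ?w = 0"
    using null_expansion[OF base(1) wB] left[OF null_fields(1)] left[OF null_fields(2)] by simp
  moreover have "dM ?z ?w = \<zeta> b0 \<phi> *\<^sub>R X x"
  proof (rule tangent_eq_by_metric[OF xA wM G.E_scale[OF Xx]])
    fix u assume u: "u \<in> tangent_space A x"
    obtain W Z where W: "x \<in> W" "W \<subseteq> U" and X': "vector_field A W X" and Z: "vector_field A W Z" and Zx: "Z x = u"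
      using fields_at[OF X x u] by blast
    have zW: "?z \<in> points AB \<times> W" using base(1) W by simp
    have z': "?z \<in> points AB \<times> points A" using base(1) xA by simp
    note pr = lift_left_projections[OF \<zeta> z']
    have br: "lie_bracket At (lift_right X) (lift_right Z) ?z \<in> tangent_space At ?z"
      by (rule P.lie_bracket_tangent[OF lift_right_smooth[OF X'] lift_right_smooth[OF Z] zW])
    have tB: "\<zeta> b0 \<in> tangent_space AB b0" by (rule L.ident.along_tangent[OF \<zeta> base(1)])
    have "2 * gt ?z ?w (lift_right Z ?z) = 2 * (\<zeta> b0 \<phi> * g x (X x) u)"
      unfolding lift_right_slice[of X x, symmetric]
      by (subst P.Koszul[OF LC(2) GT.inner_form_axioms lift_right_smooth[OF X'] lift_left_on[OF \<zeta> X'] lift_right_smooth[OF Z] zW])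
        (use snd.differential_tangent[OF z br] in \<open>simp add: lift_right_slice Jp[OF Xx] Jp[OF u] Zx
          deriv_right_left[OF X' \<zeta> W(1)] deriv_right_left[OF Z \<zeta> W(1)] deriv_right_right[OF X' Z W(1)] pr
          bracket_mixed[OF X' \<zeta> zW] bracket_mixed[OF Z \<zeta> zW] GT.zero_left
          gt_apply[of ?z "lie_bracket At (lift_right X) (lift_right Z) ?z"]
          bracket_right_right[OF X' Z zW] GB.bilinear G.bilinear tB\<close>)
    then show "g x (dM ?z ?w) u = g x (\<zeta> b0 \<phi> *\<^sub>R X x) u"
      using wB by (simp add: lift_right_slice gt_apply Jp[OF u] Zx GB.zero_right base(2) G.scale_left Xx u)
  qed
  ultimately show ?thesis
    by (intro prod_tangent_eqI[OF w GT.E_scale[OF Jp(1)[OF Xx]] z]) (simp_all add: differential_linear Jp Xx)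
qed

text \<open>The slice component of \<open>\<nabla>\<^sub>X Y\<close> has the same Koszul formula as \<open>g\<close>, since \<open>\<phi> = 1\<close> on
  the slice; the normal component is dual to the derivatives of \<open>\<xi>\<close> and \<open>\<eta>\<close> by metricity.\<close>

lemma ambient_derivative_right:
  assumes X: "vector_field A U X" and Y: "vector_field A U Y" and x: "x \<in> U"
  shows "DMt (b0, x) (J x (X x)) (lift_right Y) = J x (DM x (X x) Y) + g x (X x) (Y x) *\<^sub>R nu x"
proof -
  let ?z = "(b0, x)" and ?w = "DMt (b0, x) (J x (X x)) (lift_right Y)"
  interpret C: connection_along At At "\<lambda>z. z" DMt by (rule ambient_connection)
  interpret CM: connection_along A A "\<lambda>x. x" DM by (rule base_connection)
  have xA: "x \<in> points A" using R.ident.along_points[OF X] x by auto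
  have z: "?z \<in> points At" by (rule slice_point[OF xA])
  interpret GT: inner_form "tangent_space At ?z" "gt ?z" by (rule gt_form[OF z])
  interpret GB: inner_form "tangent_space AB b0" "gB b0" by (rule gB_form[OF base(1)])
  interpret G: inner_form "tangent_space A x" "g x" by (rule g_form[OF xA])
  have t: "X x \<in> tangent_space A x" "Y x \<in> tangent_space A x"
    using R.ident.along_tangent[OF X x] R.ident.along_tangent[OF Y x] .
  have DY: "DM x (X x) Y \<in> tangent_space A x" by (rule CM.conn_fibre[OF Y x t(1)])
  note Jp = J_projections[OF xA] and xp = xi_projections[OF xA]
  have zU: "?z \<in> points AB \<times> U" using base(1) x by simp
  have w: "?w \<in> tangent_space At ?z"
    by (rule C.conn_fibre[OF lift_right_smooth[OF Y] zU]) (rule Jp[OF t(1)])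
  have wB: "dB ?z ?w \<in> tangent_space AB b0" and wM: "dM ?z ?w \<in> tangent_space A x"
    using fst.differential_tangent[OF z w] snd.differential_tangent[OF z w] by simp_all
  have left: "gB b0 (dB ?z ?w) (\<zeta> b0) = - (\<zeta> b0 \<phi>) * g x (X x) (Y x)" if \<zeta>: "vector_field AB (points AB) \<zeta>" for \<zeta>
  proof -
    have z': "?z \<in> points AB \<times> points A" using base(1) xA by simp
    note pr = lift_left_projections[OF \<zeta> z']
    have "0 = gt ?z ?w (lift_field At \<zeta> ?z) + gt ?z (lift_right Y ?z) (DMt ?z (J x (X x)) (lift_field At \<zeta>))"
      using P.levi_civita_metric[OF LC(2) lift_right_smooth[OF Y] lift_left_on[OF \<zeta> Y] zU Jp(1)[OF t(1)]]
        deriv_right_left[OF Y \<zeta> x Jp(1)[OF t(1)]] by simp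
    also have "\<dots> = gB b0 (dB ?z ?w) (\<zeta> b0) + \<zeta> b0 \<phi> * g x (X x) (Y x)"
      unfolding ambient_derivative_left[OF X x \<zeta>] lift_right_slice gt_apply
      using t wM by (simp add: pr Jp differential_linear GB.zero_right GB.E_zero G.bilinear base(2) G.sym[of "Y x"])
    finally show ?thesis by simp
  qed
  have "dB ?z ?w = g x (X x) (Y x) *\<^sub>R (mu *\<^sub>R \<xi> b0 + lam *\<^sub>R \<eta> b0)"
    by (subst null_expansion[OF base(1) wB]) (simp add: left null_fields scaleR_add_right mult.commute)
  moreover have "dM ?z ?w = DM x (X x) Y"
  proof (rule tangent_eq_by_metric[OF xA wM DY])
    fix u assume u: "u \<in> tangent_space A x"
    obtain W Z where W: "x \<in> W" "W \<subseteq> U" and X': "vector_field A W X" and Z: "vector_field A W Z" and Zx: "Z x = u"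
      using fields_at[OF X x u] by blast
    have Y': "vector_field A W Y"
      by (rule R.ident.along_subset[OF Y R.ident.along_open[OF X'] W(2)])
    have zW: "?z \<in> points AB \<times> W" using base(1) W by simp
    have gtB: "gt ?z (lie_bracket At (lift_right V) (lift_right V') ?z) (J x v) = g x (lie_bracket A V V' x) v"
      if V: "vector_field A W V" "vector_field A W V'" and v: "v \<in> tangent_space A x" for V V' v
      using bracket_right_right[OF V zW] v by (simp add: gt_apply Jp GB.zero_right GB.E_zero base(2))
    have "2 * gt ?z ?w (lift_right Z ?z) = 2 * g x (DM x (X x) Y) (Z x)"
      unfolding lift_right_slice[of X x, symmetric]
      by (subst P.Koszul[OF LC(2) GT.inner_form_axioms lift_right_smooth[OF X'] lift_right_smooth[OF Y'] lift_right_smooth[OF Z] zW],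
          subst R.Koszul[OF LC(1) G.inner_form_axioms X' Y' Z W(1)])
        (simp add: lift_right_slice Jp t u Zx gtB[OF X' Y'] gtB[OF X' Z] gtB[OF Y' Z]
          deriv_right_right[OF X' Y' W(1)] deriv_right_right[OF X' Z W(1)] deriv_right_right[OF Y' Z W(1)])
    then show "g x (dM ?z ?w) u = g x (DM x (X x) Y) u"
      using wB by (simp add: lift_right_slice gt_apply Jp[OF u] Zx GB.zero_right base(2))
  qed
  moreover have "J x (DM x (X x) Y) + g x (X x) (Y x) *\<^sub>R nu x \<in> tangent_space At ?z"
    by (intro GT.E_add GT.E_scale Jp DY xp)
  ultimately show ?thesis
    by (intro prod_tangent_eqI[OF w _ z]) (simp_all add: differential_linear Jp DY xp)
qed

sublocale tractor: connection_along A At "\<lambda>x. (b0, x)" D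
  using pullback by unfold_locales (simp add: pullback_connection_def)

lemma pullback_derivative:
  assumes "vector_field At W Z" "x \<in> points A" "(b0, x) \<in> W" "v \<in> tangent_space A x"
  shows "D x v (\<lambda>y. Z (b0, y)) = DMt (b0, x) (J x v) Z"
proof -
  have "D x v (Z \<circ> (\<lambda>x. (b0, x))) = DMt (b0, x) (J x v) Z"
    using pullback assms unfolding pullback_connection_def by blast
  then show ?thesis by (simp add: o_def)
qed

text \<open>The Weingarten formulas: both null normal fields have umbilical shape operators and vanishing
  normal derivative.\<close>

lemma derivative_null:
  assumes x: "x \<in> points A" and v: "v \<in> tangent_space A x"
  shows "D x v xi = lam *\<^sub>R J x v" "D x v et = mu *\<^sub>R J x v"
proof -
  obtain U X where X: "x \<in> U" "vector_field A U X" "X x = v" using R.vector_field_at[OF x v] by blast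
  have z: "(b0, x) \<in> points AB \<times> points A" using x base(1) by simp
  show "D x v xi = lam *\<^sub>R J x v"
    using pullback_derivative[OF lift_left_smooth[OF null_fields(1)] x z v]
      ambient_derivative_left[OF X(2,1) null_fields(1)] X(3) by simp
  show "D x v et = mu *\<^sub>R J x v"
    using pullback_derivative[OF lift_left_smooth[OF null_fields(2)] x z v]
      ambient_derivative_left[OF X(2,1) null_fields(2)] X(3) by simp
qed

text \<open>The Gauss formula of a totally umbilical submanifold.\<close>

lemma derivative_tangential:
  assumes Y: "vector_field A U Y" and x: "x \<in> U" and v: "v \<in> tangent_space A x"
  shows "D x v (\<lambda>y. J y (Y y)) = J x (DM x v Y) + g x v (Y x) *\<^sub>R nu x"
proof -
  obtain W X where X: "x \<in> W" "W \<subseteq> U" "vector_field A W Y" "vector_field A W X" "X x = v"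
    using fields_at[OF Y x v] by blast
  have xA: "x \<in> points A" using R.ident.along_points[OF Y] x by auto
  have z: "(b0, x) \<in> points AB \<times> W" using X(1) base(1) by simp
  show ?thesis
    using pullback_derivative[OF lift_right_smooth[OF X(3)] xA z v]
      ambient_derivative_right[OF X(4,3,1)] X(5) by (simp add: lift_right_slice)
qed

end


section \<open>The tractor bundle of the slice\<close>

context smooth_mapping
begin

lemma along_push:
  fixes A'' :: "('c::{t2_space,second_countable_topology}, 'g::euclidean_space) chart set"
  assumes G: "smooth_mapping A' A'' G" and s: "smooth_along A A' F U s"
  shows "smooth_along A A'' (\<lambda>x. G (F x)) U (\<lambda>x. differential A'' G (F x) (s x))"
proof -
  interpret G: smooth_mapping A' A'' G by (rule G)
  interpret GF: smooth_mapping A A'' "\<lambda>x. G (F x)" by (rule smooth_mapping_compose[OF G])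
  have U: "open U" "U \<subseteq> points A" using s by (auto simp: smooth_along_def)
  show ?thesis
  proof (rule GF.alongI[OF U])
    show "differential A'' G (F x) (s x) \<in> tangent_space A'' (G (F x))" if "x \<in> U" for x
      using that U map_points along_tangent[OF s] by (intro G.differential_tangent) auto
    fix V d and b :: 'g assume V: "(V, d) \<in> A''"
    let ?c = "\<lambda>y. d y \<bullet> b"
    have "smooth_fun A (U \<inter> F -` (points A' \<inter> G -` V)) (\<lambda>x. s x (?c \<circ> G))"
      by (rule along_smooth[OF s G.pullback_smooth[OF G.N.smooth_fun_coord[OF V] N.points_open order_refl]])
    moreover have "U \<inter> F -` (points A' \<inter> G -` V) = U \<inter> (\<lambda>x. G (F x)) -` V" using U map_points by auto
    ultimately have "smooth_fun A (U \<inter> (\<lambda>x. G (F x)) -` V) (\<lambda>x. s x (?c \<circ> G))" by simp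
    then show "smooth_fun A (U \<inter> (\<lambda>x. G (F x)) -` V) (\<lambda>x. differential A'' G (F x) (s x) ?c)"
      by (rule M.smooth_fun_cong, intro G.differential_apply[symmetric] G.N.smooth_nearI[OF G.N.smooth_fun_coord[OF V]]) auto
  qed
qed

lemma metric_smooth_along:
  assumes g: "bundle_metric A' (tangent_bundle A') g p q" and s: "smooth_along A A' F U s" and t: "smooth_along A A' F U t"
  shows "smooth_fun A U (\<lambda>x. g (F x) (s x) (t x))"
proof (rule M.smooth_fun_local)
  fix x assume x: "x \<in> U"
  have U: "open U" "U \<subseteq> points A" using s by (auto simp: smooth_along_def)
  then obtain V d where V: "(V, d) \<in> A'" "F x \<in> V" using map_points N.chart_at x by (metis subsetD)
  let ?U = "U \<inter> F -` V" and ?e = "\<lambda>b y. N.coord_vec V d b (F y)"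
  have o: "open ?U" by (rule preimage_open[OF N.chart(1,6)[OF V(1)] U])
  have c: "vector_field A' V (N.coord_vec V d b)" for b
    using N.ident.along_coord_vec[OF V(1), of b] N.chart(6)[OF V(1)] by (simp add: inf_absorb2)
  have sm: "smooth_fun A ?U (\<lambda>y. \<Sum>b\<in>Basis. \<Sum>b'\<in>Basis.
      s y (\<lambda>z. d z \<bullet> b) * (t y (\<lambda>z. d z \<bullet> b') * g (F y) (?e b y) (?e b' y)))"
  proof (intro M.smooth_fun_sum M.smooth_fun_mult o)
    show "smooth_fun A ?U (\<lambda>y. s y (\<lambda>z. d z \<bullet> b))" for b by (rule along_smooth[OF s N.smooth_fun_coord[OF V(1)]])
    show "smooth_fun A ?U (\<lambda>y. t y (\<lambda>z. d z \<bullet> b))" for b by (rule along_smooth[OF t N.smooth_fun_coord[OF V(1)]])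
    show "smooth_fun A ?U (\<lambda>y. g (F y) (?e b y) (?e b' y))" for b b'
      using pullback_smooth[OF N.metric_smooth[OF g c c] U] by (simp add: o_def)
  qed (use U in auto)
  have "smooth_fun A ?U (\<lambda>y. g (F y) (s y) (t y))"
  proof (rule M.smooth_fun_cong[OF sm])
    fix y assume y: "y \<in> ?U"
    then have Fy: "F y \<in> V" "F y \<in> points A'" and yU: "y \<in> U" using N.chart(6)[OF V(1)] by auto
    interpret G: inner_form "tangent_space A' (F y)" "g (F y)" by (rule N.tangent_metric_form[OF g Fy(2)])
    have e: "?e b y \<in> tangent_space A' (F y)" for b by (rule N.coord_vec_tangent[OF V(1) Fy(1)])
    have left: "g (F y) (\<Sum>b\<in>Basis. \<alpha> b *\<^sub>R ?e b y) w = (\<Sum>b\<in>Basis. \<alpha> b * g (F y) (?e b y) w)"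
      and right: "g (F y) w (\<Sum>b\<in>Basis. \<alpha> b *\<^sub>R ?e b y) = (\<Sum>b\<in>Basis. \<alpha> b * g (F y) w (?e b y))"
      if "w \<in> tangent_space A' (F y)" for \<alpha> w
      using that e by (simp_all add: G.sum_left G.sum_right G.scale_left G.scale_right G.E_scale)
    have "g (F y) (\<Sum>b\<in>Basis. s y (\<lambda>z. d z \<bullet> b) *\<^sub>R ?e b y) (\<Sum>b\<in>Basis. t y (\<lambda>z. d z \<bullet> b) *\<^sub>R ?e b y) =
        (\<Sum>b\<in>Basis. \<Sum>b'\<in>Basis. s y (\<lambda>z. d z \<bullet> b) * (t y (\<lambda>z. d z \<bullet> b') * g (F y) (?e b y) (?e b' y)))"
      by (subst left) (simp_all only: right[OF e] sum_distrib_left subspace_sum[OF G.E G.E_scale[OF e]])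
    then show "(\<Sum>b\<in>Basis. \<Sum>b'\<in>Basis. s y (\<lambda>z. d z \<bullet> b) * (t y (\<lambda>z. d z \<bullet> b') * g (F y) (?e b y) (?e b' y)))
        = g (F y) (s y) (t y)"
      using N.tangent_coord_sum[OF along_tangent[OF s yU] V(1) Fy(1), symmetric]
        N.tangent_coord_sum[OF along_tangent[OF t yU] V(1) Fy(1), symmetric] by (simp only:)
  qed
  then show "\<exists>W. x \<in> W \<and> W \<subseteq> U \<and> smooth_fun A W (\<lambda>x. g (F x) (s x) (t x))"
    using x V by (intro exI[of _ ?U]) auto
qed

end

context warped_slice
begin

abbreviation "T \<equiv> pullback_tangent_bundle A At (\<lambda>x. (b0, x))"
abbreviation "T1 \<equiv> \<lambda>x. span {xi x}"

lemma h_form: "x \<in> points A \<Longrightarrow> inner_form (tangent_space At (b0, x)) (h x)"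
  by (rule gt_form[OF slice_point])

lemma h_table:
  assumes x: "x \<in> points A"
  shows "h x (xi x) (xi x) = 0" "h x (et x) (et x) = 0" "h x (xi x) (et x) = -1" "h x (et x) (xi x) = -1"
    "u \<in> tangent_space A x \<Longrightarrow> h x (J x u) (xi x) = 0" "u \<in> tangent_space A x \<Longrightarrow> h x (J x u) (et x) = 0"
    "u \<in> tangent_space A x \<Longrightarrow> h x (xi x) (J x u) = 0" "u \<in> tangent_space A x \<Longrightarrow> h x (et x) (J x u) = 0"
    "u \<in> tangent_space A x \<Longrightarrow> v \<in> tangent_space A x \<Longrightarrow> h x (J x u) (J x v) = g x u v"
proof -
  interpret GB: inner_form "tangent_space AB b0" "gB b0" by (rule gB_form[OF base(1)])
  interpret G: inner_form "tangent_space A x" "g x" by (rule g_form[OF x])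
  note simps = gt_apply xi_projections[OF x] J_projections[OF x] GB.bilinear G.bilinear base(2) G.E_zero GB.E_zero
    null_products[OF base(1)] null_tangent[OF base(1)]
  show "h x (xi x) (xi x) = 0" "h x (et x) (et x) = 0" "h x (xi x) (et x) = -1" "h x (et x) (xi x) = -1"
    "u \<in> tangent_space A x \<Longrightarrow> h x (J x u) (xi x) = 0" "u \<in> tangent_space A x \<Longrightarrow> h x (J x u) (et x) = 0"
    "u \<in> tangent_space A x \<Longrightarrow> h x (xi x) (J x u) = 0" "u \<in> tangent_space A x \<Longrightarrow> h x (et x) (J x u) = 0"
    "u \<in> tangent_space A x \<Longrightarrow> v \<in> tangent_space A x \<Longrightarrow> h x (J x u) (J x v) = g x u v"
    by (simp_all add: simps)
qed

text \<open>The coefficients look crossed because the null pair has product \<open>-1\<close>.\<close>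

lemma fibre_decomposition:
  assumes x: "x \<in> points A" and u: "u \<in> tangent_space At (b0, x)"
  shows "u = J x (dM (b0, x) u) + ((- h x u (et x)) *\<^sub>R xi x + (- h x u (xi x)) *\<^sub>R et x)"
proof -
  note z = slice_point[OF x] and xp = xi_projections[OF x]
  interpret GT: inner_form "tangent_space At (b0, x)" "h x" by (rule h_form[OF x])
  interpret G: inner_form "tangent_space A x" "g x" by (rule g_form[OF x])
  have t: "dB (b0, x) u \<in> tangent_space AB b0" "dM (b0, x) u \<in> tangent_space A x"
    using fst.differential_tangent[OF z u] snd.differential_tangent[OF z u] by simp_all
  have hB: "h x u (et x) = gB b0 (dB (b0, x) u) (\<eta> b0)" "h x u (xi x) = gB b0 (dB (b0, x) u) (\<xi> b0)"
    by (simp_all add: gt_apply xp G.zero_right t)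
  show ?thesis
  proof (rule prod_tangent_eqI[OF u _ z])
    show "J x (dM (b0, x) u) + ((- h x u (et x)) *\<^sub>R xi x + (- h x u (xi x)) *\<^sub>R et x) \<in> tangent_space At (b0, x)"
      by (intro GT.E_add GT.E_scale xp J_projections[OF x] t)
    show "dB (b0, x) u = dB (b0, x) (J x (dM (b0, x) u) + ((- h x u (et x)) *\<^sub>R xi x + (- h x u (xi x)) *\<^sub>R et x))"
      unfolding differential_linear xp J_projections[OF x t(2)] hB using null_expansion[OF base(1) t(1)] by simp
    show "dM (b0, x) u = dM (b0, x) (J x (dM (b0, x) u) + ((- h x u (et x)) *\<^sub>R xi x + (- h x u (xi x)) *\<^sub>R et x))"
      unfolding differential_linear xp J_projections[OF x t(2)] by simp
  qed
qed

lemma null_sections: "smooth_along A At (\<lambda>x. (b0, x)) (points A) xi" "smooth_along A At (\<lambda>x. (b0, x)) (points A) et"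
proof -
  have "smooth_along A At (\<lambda>x. (b0, x)) (points A) (\<lambda>x. lift_field At \<zeta> (b0, x))"
    if "vector_field AB (points AB) \<zeta>" for \<zeta>
    using base(1)
    by (intro slice.along_compose[OF P.smooth_mapping_ident lift_left_smooth[OF that]] R.points_open) auto
  then show "smooth_along A At (\<lambda>x. (b0, x)) (points A) xi" "smooth_along A At (\<lambda>x. (b0, x)) (points A) et"
    using null_fields by blast+
qed

lemma null_sections_on:
  assumes "open U" "U \<subseteq> points A"
  shows "smooth_along A At (\<lambda>x. (b0, x)) U xi" "smooth_along A At (\<lambda>x. (b0, x)) U et"
  using slice.along_subset[OF null_sections(1) assms] slice.along_subset[OF null_sections(2) assms] .

lemma xi_nonzero: "x \<in> points A \<Longrightarrow> xi x \<noteq> 0"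
  using h_table(3)[of x] inner_form.zero_left[OF h_form, of x "et x"] xi_projections(4)[of x] by auto

lemma xi_nonvanishing:
  assumes "open U" "U \<subseteq> points A"
  shows "nonvanishing_section T T1 U xi"
  using null_sections_on(1)[OF assms] xi_nonzero assms(2)
  by (auto simp: nonvanishing_section_def pullback_tangent_bundle_def intro: span_base)

lemma h_smooth:
  assumes s: "smooth_along A At (\<lambda>x. (b0, x)) U s" and t: "smooth_along A At (\<lambda>x. (b0, x)) U t"
  shows "smooth_fun A U (\<lambda>x. h x (s x) (t x))"
proof -
  interpret c: smooth_mapping A AB "\<lambda>x. b0"
    using slice.smooth_mapping_compose[OF fst.smooth_mapping_axioms] by simp
  have B: "smooth_along A AB (\<lambda>x. b0) U (\<lambda>x. dB (b0, x) (w x))" and M: "vector_field A U (\<lambda>x. dM (b0, x) (w x))"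
    if "smooth_along A At (\<lambda>x. (b0, x)) U w" for w
    using slice.along_push[OF fst.smooth_mapping_axioms that] slice.along_push[OF snd.smooth_mapping_axioms that] by simp_all
  have "smooth_fun A U (\<lambda>x. gB b0 (dB (b0, x) (s x)) (dB (b0, x) (t x)) + g x (dM (b0, x) (s x)) (dM (b0, x) (t x)))"
    by (intro R.smooth_fun_add c.metric_smooth_along[OF gB_metric] R.metric_smooth[OF g_metric] B M s t)
  then show ?thesis by (simp add: gt_apply base(2))
qed

text \<open>Identities of an abstract real vector space: on spaces of functions, such as the fibres here, the
  pointwise ring structure would interfere with collecting terms.\<close>

lemma scaleR_cross_add: "a *\<^sub>R (b *\<^sub>R v) + b *\<^sub>R (a *\<^sub>R v) = (2 * b * a) *\<^sub>R v" for v :: "'v::real_vector"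
  by (simp only: scaleR_scaleR scaleR_add_left[symmetric]) (simp add: mult.commute)

lemma gauss_collect:
  fixes N :: "'v::real_vector"
  shows "(r1 + p1 *\<^sub>R N + (q1 *\<^sub>R (k *\<^sub>R jx) + d1 *\<^sub>R N)) - (r2 + p2 *\<^sub>R N + (q2 *\<^sub>R (k *\<^sub>R jy) + d2 *\<^sub>R N)) - (r3 + p3 *\<^sub>R N)
    = (r1 - r2 - r3) + k *\<^sub>R (q1 *\<^sub>R jx - q2 *\<^sub>R jy) + (p1 + d1 - (p2 + d2) - p3) *\<^sub>R N"
  by (simp add: algebra_simps)

lemma half_sum: "v = ((1/2) *\<^sub>R v - w) + ((1/2) *\<^sub>R v + w)" for v w :: "'v::real_vector"
  using scaleR_add_left[of "1/2" "1/2" v] by simp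

lemma half_difference: "w = (1/2) *\<^sub>R (((1/2) *\<^sub>R v + w) - ((1/2) *\<^sub>R v - w))" for v w :: "'v::real_vector"
  by simp

lemma h_signature:
  assumes x: "x \<in> points A"
  shows "has_signature (tangent_space At (b0, x)) (h x) (DIM('e) + 1) 1"
proof -
  let ?n = "DIM('e)"
  interpret GT: inner_form "tangent_space At (b0, x)" "h x" by (rule h_form[OF x])
  obtain e :: "nat \<Rightarrow> 'm tvec" where "\<forall>i<?n. e i \<in> tangent_space A x" "span (e ` {..<?n}) = tangent_space A x"
    "\<forall>i<?n. \<forall>j<?n. g x (e i) (e j) = (if i \<noteq> j then 0 else if i < ?n then 1 else -1)"
    using g_signature[OF x] unfolding has_signature_def add_0_right by blast
  then have e: "\<And>i. i < ?n \<Longrightarrow> e i \<in> tangent_space A x" "span (e ` {..<?n}) = tangent_space A x"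
    "\<And>i j. i < ?n \<Longrightarrow> j < ?n \<Longrightarrow> g x (e i) (e j) = (if i \<noteq> j then 0 else 1)"
    by simp_all
  note tab = h_table[OF x] and xp = xi_projections[OF x] and Jp = J_projections[OF x]
  \<comment> \<open>A null pair with product \<open>-1\<close> yields a unit spacelike and a unit timelike vector.\<close>
  define p where "p = (1/2) *\<^sub>R xi x - et x"
  define q where "q = (1/2) *\<^sub>R xi x + et x"
  define E where "E i = (if i < ?n then J x (e i) else if i = ?n then p else q)" for i
  have pq: "p \<in> tangent_space At (b0, x)" "q \<in> tangent_space At (b0, x)"
    unfolding p_def q_def by (intro GT.E_add GT.E_diff GT.E_scale xp)+
  have hpq: "h x p p = 1" "h x q q = -1" "h x p q = 0" "h x q p = 0"
    unfolding p_def q_def by (simp_all add: GT.bilinear GT.E_add GT.E_diff GT.E_scale xp tab)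
  have hJ: "h x (J x u) p = 0" "h x (J x u) q = 0" "h x p (J x u) = 0" "h x q (J x u) = 0"
    if "u \<in> tangent_space A x" for u
    unfolding p_def q_def using that
    by (simp_all add: GT.bilinear GT.E_add GT.E_diff GT.E_scale xp Jp tab)
  have Et: "E i \<in> tangent_space At (b0, x)" for i using pq Jp(1)[OF e(1)] by (simp add: E_def)
  have "u \<in> span (E ` {..<?n + 1 + 1})" if u: "u \<in> tangent_space At (b0, x)" for u
  proof -
    let ?S = "span (E ` {..<?n + 1 + 1})"
    have "p = E ?n" "q = E (?n + 1)" by (simp_all add: E_def)
    then have S: "p \<in> ?S" "q \<in> ?S" by (auto intro!: span_base)
    have "xi x = p + q" "et x = (1/2) *\<^sub>R (q - p)"
      unfolding p_def q_def by (rule half_sum half_difference)+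
    then have N: "xi x \<in> ?S" "et x \<in> ?S" using S by (auto intro: span_add span_diff span_scale)
    have "dM (b0, x) u \<in> span (e ` {..<?n})"
      using snd.differential_tangent[OF slice_point[OF x] u] e(2) by simp
    then obtain a where a: "dM (b0, x) u = (\<Sum>i<?n. a i *\<^sub>R e i)" unfolding span_family[OF finite_lessThan] by blast
    have "J x (e i) \<in> ?S" if "i < ?n" for i
    proof -
      have "J x (e i) = E i" using that by (simp add: E_def)
      then show ?thesis using that by (auto intro!: span_base)
    qed
    then have "J x (dM (b0, x) u) \<in> ?S"
      unfolding a differential_sum differential_linear by (intro span_sum span_scale) auto
    then show ?thesis
      using N by (subst fibre_decomposition[OF x u]) (intro span_add span_scale)
  qed
  moreover have "span (E ` {..<?n + 1 + 1}) \<subseteq> tangent_space At (b0, x)"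
    by (rule span_minimal[OF _ P.subspace_tangent]) (use Et in auto)
  moreover have "h x (E i) (E j) = (if i \<noteq> j then 0 else if i < ?n + 1 then 1 else -1)"
    if "i < ?n + 1 + 1" "j < ?n + 1 + 1" for i j
  proof -
    have "i < ?n \<or> i = ?n \<or> i = Suc ?n" "j < ?n \<or> j = ?n \<or> j = Suc ?n" using that by auto
    then show ?thesis
      by (elim disjE) (simp_all add: E_def tab e hpq hJ)
  qed
  ultimately show ?thesis unfolding has_signature_def using Et by (intro exI[of _ E]) auto
qed

theorem tractor_conformal: "tractor_conformal_bundle A T T1 h"
  unfolding tractor_conformal_bundle_def
proof (intro conjI)
  show "vector_bundle A (DIM('e) + 2) T"
    using slice.vector_bundle_pullback by (simp add: dim_base add.commute)
  show "bundle_metric A T h (DIM('e) + 1) 1"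
    unfolding bundle_metric_def
  proof (intro conjI ballI allI impI)
    fix x assume x: "x \<in> points A"
    interpret GT: inner_form "tangent_space At (b0, x)" "h x" by (rule h_form[OF x])
    show "h x u v = h x v u" if "u \<in> fib T x" "v \<in> fib T x" for u v
      using that GT.sym by (simp add: pullback_tangent_bundle_def)
    show "h x (a *\<^sub>R u + v) w = a * h x u w + h x v w" if "u \<in> fib T x" "v \<in> fib T x" "w \<in> fib T x" for u v w a
      using that GT.lin by (simp add: pullback_tangent_bundle_def)
    show "has_signature (fib T x) (h x) (DIM('e) + 1) 1"
      using h_signature[OF x] by (simp add: pullback_tangent_bundle_def)
  next
    show "smooth_fun A U (\<lambda>x. h x (s x) (t x))" if "sec T U s" "sec T U t" for U s t
      using that h_smooth by (simp add: pullback_tangent_bundle_def)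
  qed
  show "lightlike_line_subbundle A T h T1"
    unfolding lightlike_line_subbundle_def
  proof (intro conjI ballI)
    fix x assume x: "x \<in> points A"
    interpret GT: inner_form "tangent_space At (b0, x)" "h x" by (rule h_form[OF x])
    have nz: "xi x \<noteq> 0" by (rule xi_nonzero[OF x])
    show "subspace (T1 x)" by simp
    show "dim (T1 x) = 1" using nz dim_eq_card_independent[of "{xi x}"] by simp
    show "T1 x \<subseteq> fib T x"
      using xi_projections(1)[OF x] P.subspace_tangent
      by (simp add: pullback_tangent_bundle_def span_minimal)
    show "h x u u = 0" if u: "u \<in> T1 x" for u
    proof -
      obtain k where "u = k *\<^sub>R xi x" using u by (auto simp: span_singleton)
      then show ?thesis using xi_projections[OF x] by (simp add: GT.bilinear GT.E_scale h_table[OF x])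
    qed
    show "\<exists>U \<sigma>. x \<in> U \<and> nonvanishing_section T T1 U \<sigma>"
      using x xi_nonvanishing[OF R.points_open order_refl] by blast
  qed
qed


subsection \<open>The induced connection\<close>

lemma tangential_section:
  "vector_field A U Y \<Longrightarrow> smooth_along A At (\<lambda>x. (b0, x)) U (\<lambda>y. J y (Y y))"
  by (rule slice.along_differential)

lemma section_parts:
  assumes s: "smooth_along A At (\<lambda>x. (b0, x)) U s"
  obtains Y a b where "vector_field A U Y" "smooth_fun A U a" "smooth_fun A U b"
    "\<And>y. y \<in> U \<Longrightarrow> s y = J y (Y y) + (a y *\<^sub>R xi y + b y *\<^sub>R et y)"
proof -
  have U: "open U" "U \<subseteq> points A" using s by (auto simp: smooth_along_def)
  show ?thesis
  proof (rule that)
    show "vector_field A U (\<lambda>x. dM (b0, x) (s x))"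
      using slice.along_push[OF snd.smooth_mapping_axioms s] by simp
    show "smooth_fun A U (\<lambda>x. - h x (s x) (et x))" "smooth_fun A U (\<lambda>x. - h x (s x) (xi x))"
      by (intro R.smooth_fun_uminus h_smooth s null_sections_on[OF U])+
    show "s y = J y (dM (b0, y) (s y)) + ((- h y (s y) (et y)) *\<^sub>R xi y + (- h y (s y) (xi y)) *\<^sub>R et y)"
      if "y \<in> U" for y
      using that U slice.along_tangent[OF s] by (intro fibre_decomposition) auto
  qed
qed

lemma derivative_section:
  assumes Y: "vector_field A U Y" and a: "smooth_fun A U a" and b: "smooth_fun A U b"
    and s: "smooth_along A At (\<lambda>x. (b0, x)) U s"
    and eq: "\<And>y. y \<in> U \<Longrightarrow> s y = J y (Y y) + (a y *\<^sub>R xi y + b y *\<^sub>R et y)"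
    and x: "x \<in> U" and v: "v \<in> tangent_space A x"
  shows "D x v s = J x (DM x v Y + (a x * lam + b x * mu) *\<^sub>R v)
    + ((g x v (Y x) * mu + v a) *\<^sub>R xi x + (g x v (Y x) * lam + v b) *\<^sub>R et x)"
proof -
  have U: "open U" "U \<subseteq> points A" using s by (auto simp: smooth_along_def)
  note n = null_sections_on[OF U] and na = slice.along_scale[OF a null_sections_on(1)[OF U]]
    and nb = slice.along_scale[OF b null_sections_on(2)[OF U]]
  have xA: "x \<in> points A" using x U by auto
  have "D x v s = D x v (\<lambda>y. J y (Y y) + (a y *\<^sub>R xi y + b y *\<^sub>R et y))"
    by (rule tractor.conn_cong[OF s x eq v])
  also have "\<dots> = D x v (\<lambda>y. J y (Y y)) + (D x v (\<lambda>y. a y *\<^sub>R xi y) + D x v (\<lambda>y. b y *\<^sub>R et y))"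
    by (simp only: tractor.conn_add[OF tangential_section[OF Y] slice.along_add[OF na nb] x v]
        tractor.conn_add[OF na nb x v])
  also have "\<dots> = J x (DM x v Y) + g x v (Y x) *\<^sub>R nu x
      + ((a x *\<^sub>R (lam *\<^sub>R J x v) + v a *\<^sub>R xi x) + (b x *\<^sub>R (mu *\<^sub>R J x v) + v b *\<^sub>R et x))"
    by (simp only: derivative_tangential[OF Y x v] tractor.conn_leibniz[OF n(1) a x v]
        tractor.conn_leibniz[OF n(2) b x v] derivative_null[OF xA v])
  finally show ?thesis
    by (simp only: differential_linear) (simp add: algebra_simps)
qed

text \<open>By the Gauss and Weingarten formulas the derivative of \<open>h(s, t)\<close> splits into a tangential part,
  where \<open>g\<close> is parallel, products of coefficients, and cross terms; the cross terms from \<open>nu\<close>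
  cancel those from \<open>J v\<close>.\<close>

lemma metric_connection_D: "metric_connection A T h D"
  unfolding metric_connection_def
proof (intro conjI allI impI ballI)
  show "connection A T D" using pullback by (simp add: pullback_connection_def)
  fix U s t x v
  assume "sec T U s" "sec T U t" and x: "x \<in> U" and v: "v \<in> tangent_space A x"
  then have s: "smooth_along A At (\<lambda>x. (b0, x)) U s" and t: "smooth_along A At (\<lambda>x. (b0, x)) U t"
    by (simp_all add: pullback_tangent_bundle_def)
  have U: "open U" "U \<subseteq> points A" using s by (auto simp: smooth_along_def)
  have xA: "x \<in> points A" using x U by auto
  obtain Y a b where Y: "vector_field A U Y" and ab: "smooth_fun A U a" "smooth_fun A U b"
    and s': "\<And>y. y \<in> U \<Longrightarrow> s y = J y (Y y) + (a y *\<^sub>R xi y + b y *\<^sub>R et y)" using section_parts[OF s] by metis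
  obtain Z c d where Z: "vector_field A U Z" and cd: "smooth_fun A U c" "smooth_fun A U d"
    and t': "\<And>y. y \<in> U \<Longrightarrow> t y = J y (Z y) + (c y *\<^sub>R xi y + d y *\<^sub>R et y)" using section_parts[OF t] by metis
  have prod: "h y (J y u + (\<alpha> *\<^sub>R xi y + \<beta> *\<^sub>R et y)) (J y w + (\<gamma> *\<^sub>R xi y + \<delta> *\<^sub>R et y)) = g y u w - (\<alpha> * \<delta> + \<beta> * \<gamma>)"
    if y: "y \<in> points A" and uw: "u \<in> tangent_space A y" "w \<in> tangent_space A y" for y u w \<alpha> \<beta> \<gamma> \<delta>
  proof -
    interpret GT: inner_form "tangent_space At (b0, y)" "h y" by (rule h_form[OF y])
    show ?thesis
      using uw by (simp add: GT.bilinear GT.E_add GT.E_scale xi_projections[OF y] J_projections[OF y] h_table[OF y])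
  qed
  interpret CM: connection_along A A "\<lambda>x. x" DM by (rule base_connection)
  interpret G: inner_form "tangent_space A x" "g x" by (rule g_form[OF xA])
  have YZ: "Y x \<in> tangent_space A x" "Z x \<in> tangent_space A x"
    using R.ident.along_tangent[OF Y x] R.ident.along_tangent[OF Z x] .
  have DYZ: "DM x v Y \<in> tangent_space A x" "DM x v Z \<in> tangent_space A x"
    using CM.conn_fibre[OF Y x v] CM.conn_fibre[OF Z x v] .
  let ?f = "\<lambda>y. g y (Y y) (Z y) + (-1) * (a y * d y + b y * c y)"
  note n = R.smooth_nearI[OF ab(1) x] R.smooth_nearI[OF ab(2) x] R.smooth_nearI[OF cd(1) x] R.smooth_nearI[OF cd(2) x]
    R.smooth_nearI[OF R.metric_smooth[OF g_metric Y Z] x]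
  have nn: "smooth_near A x (\<lambda>y. a y * d y)" "smooth_near A x (\<lambda>y. b y * c y)"
    by (intro R.smooth_near_mult n)+
  note nnn = R.smooth_near_add[OF nn]
  have "v (\<lambda>y. h y (s y) (t y)) = v ?f"
  proof (rule R.tangent_germ[OF v _ U(1) x, symmetric])
    show "smooth_near A x ?f" by (intro R.smooth_near_add R.smooth_near_cmult n nnn)
    fix y assume y: "y \<in> U"
    then show "?f y = h y (s y) (t y)"
      unfolding s'[OF y] t'[OF y]
      using U R.ident.along_tangent[OF Y y] R.ident.along_tangent[OF Z y] by (subst prod) auto
  qed
  also have "\<dots> = v (\<lambda>y. g y (Y y) (Z y)) - (a x * v d + d x * v a + (b x * v c + c x * v b))"
    by (simp only: R.tangent_add[OF v n(5) R.smooth_near_cmult[OF nnn]] R.tangent_cmult[OF v nnn]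
        R.tangent_add[OF v nn] R.tangent_mult[OF v n(1,4)] R.tangent_mult[OF v n(2,3)]) simp
  also have "v (\<lambda>y. g y (Y y) (Z y)) = g x (DM x v Y) (Z x) + g x (Y x) (DM x v Z)"
    by (rule R.levi_civita_metric[OF LC(1) Y Z x v])
  finally have lhs: "v (\<lambda>y. h y (s y) (t y)) = g x (DM x v Y) (Z x) + g x (Y x) (DM x v Z)
      - (a x * v d + d x * v a + (b x * v c + c x * v b))" .
  have ds: "D x v s = J x (DM x v Y + (a x * lam + b x * mu) *\<^sub>R v)
      + ((g x v (Y x) * mu + v a) *\<^sub>R xi x + (g x v (Y x) * lam + v b) *\<^sub>R et x)"
    by (rule derivative_section[OF Y ab s s' x v])
  have dt: "D x v t = J x (DM x v Z + (c x * lam + d x * mu) *\<^sub>R v)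
      + ((g x v (Z x) * mu + v c) *\<^sub>R xi x + (g x v (Z x) * lam + v d) *\<^sub>R et x)"
    by (rule derivative_section[OF Z cd t t' x v])
  have hs: "h x (D x v s) (t x) = g x (DM x v Y + (a x * lam + b x * mu) *\<^sub>R v) (Z x)
      - ((g x v (Y x) * mu + v a) * d x + (g x v (Y x) * lam + v b) * c x)"
    unfolding ds t'[OF x]
    by (rule prod[OF xA]) (intro G.E_add G.E_scale DYZ v YZ)+
  have ht: "h x (s x) (D x v t) = g x (Y x) (DM x v Z + (c x * lam + d x * mu) *\<^sub>R v)
      - (a x * (g x v (Z x) * lam + v d) + b x * (g x v (Z x) * mu + v c))"
    unfolding dt s'[OF x]
    by (rule prod[OF xA]) (intro G.E_add G.E_scale DYZ v YZ)+
  show "v (\<lambda>y. h y (s y) (t y)) = h x (D x v s) (t x) + h x (s x) (D x v t)"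
    unfolding lhs hs ht using YZ DYZ v
    by (simp add: G.bilinear G.E_scale G.sym[of "Y x" v] distrib_right distrib_left right_diff_distrib left_diff_distrib)
qed

lemma line_section:
  assumes \<sigma>: "smooth_along A At (\<lambda>x. (b0, x)) U \<sigma>" and line: "\<And>y. y \<in> U \<Longrightarrow> \<sigma> y \<in> T1 y"
  obtains f where "smooth_fun A U f" "\<And>y. y \<in> U \<Longrightarrow> \<sigma> y = f y *\<^sub>R xi y"
    "\<And>x v. x \<in> U \<Longrightarrow> v \<in> tangent_space A x \<Longrightarrow> D x v \<sigma> = (f x * lam) *\<^sub>R J x v + v f *\<^sub>R xi x"
proof -
  have U: "open U" "U \<subseteq> points A" using \<sigma> by (auto simp: smooth_along_def)
  define f where "f x = - h x (\<sigma> x) (et x)" for x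
  have f: "smooth_fun A U f"
    unfolding f_def by (intro R.smooth_fun_uminus h_smooth \<sigma> null_sections_on[OF U])
  have eq: "\<sigma> y = f y *\<^sub>R xi y" if y: "y \<in> U" for y
  proof -
    have yA: "y \<in> points A" using y U by auto
    interpret GT: inner_form "tangent_space At (b0, y)" "h y" by (rule h_form[OF yA])
    obtain k where k: "\<sigma> y = k *\<^sub>R xi y" using line[OF y] by (auto simp: span_singleton)
    show ?thesis unfolding f_def k using xi_projections[OF yA] by (simp add: GT.scale_left h_table[OF yA])
  qed
  have "D x v \<sigma> = (f x * lam) *\<^sub>R J x v + v f *\<^sub>R xi x" if x: "x \<in> U" and v: "v \<in> tangent_space A x" for x v
  proof -
    have "D x v \<sigma> = D x v (\<lambda>y. f y *\<^sub>R xi y)" by (rule tractor.conn_cong[OF \<sigma> x eq v])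
    also have "\<dots> = f x *\<^sub>R D x v xi + v f *\<^sub>R xi x"
      by (rule tractor.conn_leibniz[OF null_sections_on(1)[OF U] f x v])
    finally show ?thesis using derivative_null(1)[OF _ v] x U by auto
  qed
  with f eq show ?thesis using that by blast
qed

lemma coset_eq_iff:
  assumes "subspace K"
  shows "coset K u = coset K (w :: 'v::real_vector) \<longleftrightarrow> u - w \<in> K"
proof
  assume "coset K u = coset K w"
  moreover have "u \<in> coset K u" using subspace_0[OF assms] by (auto simp: coset_def intro!: image_eqI[of _ _ 0])
  ultimately obtain k where "k \<in> K" "u = w + k" by (auto simp: coset_def)
  then show "u - w \<in> K" by simp
next
  assume uw: "u - w \<in> K"
  have sub: "coset K a \<subseteq> coset K b" if ab: "a - b \<in> K" for a b :: 'v
  proof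
    fix y assume "y \<in> coset K a"
    then obtain k where k: "k \<in> K" "y = a + k" by (auto simp: coset_def)
    have "y = b + ((a - b) + k)" using k by simp
    then show "y \<in> coset K b" unfolding coset_def using subspace_add[OF assms ab k(1)] by blast
  qed
  have "w - u \<in> K" using subspace_neg[OF assms uw] by simp
  then show "coset K u = coset K w" using sub[OF uw] sub by blast
qed

text \<open>Up to the nonzero factor \<open>f x * lam\<close> and modulo the null line, \<open>\<beta>\<^sub>\<sigma>\<close> is \<open>J\<close>, and the image of \<open>J\<close>
  is a complement of the null line in its orthogonal space.\<close>

lemma beta_bijective:
  assumes nonzero: "lam \<noteq> 0" and \<sigma>: "nonvanishing_section T T1 U \<sigma>" and x: "x \<in> U"
  shows "bij_betw (beta T1 D \<sigma> x) (tangent_space A x) (coset (T1 x) ` perp T h T1 x)"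
proof -
  have s: "smooth_along A At (\<lambda>x. (b0, x)) U \<sigma>" and line: "\<And>y. y \<in> U \<Longrightarrow> \<sigma> y \<in> T1 y" "\<sigma> x \<noteq> 0"
    using \<sigma> x by (auto simp: nonvanishing_section_def pullback_tangent_bundle_def)
  obtain f where f: "smooth_fun A U f" "\<And>y. y \<in> U \<Longrightarrow> \<sigma> y = f y *\<^sub>R xi y"
    "\<And>x v. x \<in> U \<Longrightarrow> v \<in> tangent_space A x \<Longrightarrow> D x v \<sigma> = (f x * lam) *\<^sub>R J x v + v f *\<^sub>R xi x"
    using line_section[OF s line(1)] by metis
  have xA: "x \<in> points A" using x R.smooth_fun_points[OF f(1)] by auto
  have k: "f x * lam \<noteq> 0" using f(2)[OF x] line(2) nonzero by auto
  interpret GT: inner_form "tangent_space At (b0, x)" "h x" by (rule h_form[OF xA])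
  note Jp = J_projections[OF xA] and xp = xi_projections[OF xA] and tab = h_table[OF xA]
  show ?thesis
    unfolding bij_betw_def
  proof
    show "inj_on (beta T1 D \<sigma> x) (tangent_space A x)"
    proof (rule inj_onI)
      fix v w assume vw: "v \<in> tangent_space A x" "w \<in> tangent_space A x" and "beta T1 D \<sigma> x v = beta T1 D \<sigma> x w"
      then have "D x v \<sigma> - D x w \<sigma> \<in> T1 x" by (simp add: beta_def coset_eq_iff)
      then obtain r where "D x v \<sigma> - D x w \<sigma> = r *\<^sub>R xi x" by (auto simp: span_singleton)
      then have "dM (b0, x) (D x v \<sigma> - D x w \<sigma>) = dM (b0, x) (r *\<^sub>R xi x)" by simp
      then have "(f x * lam) *\<^sub>R (v - w) = 0"
        using vw by (simp add: f(3)[OF x] differential_linear Jp xp scaleR_diff_right)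
      then show "v = w" using k by simp
    qed
    show "beta T1 D \<sigma> x ` tangent_space A x = coset (T1 x) ` perp T h T1 x"
    proof (intro equalityI image_subsetI)
      fix v assume v: "v \<in> tangent_space A x"
      have "D x v \<sigma> \<in> tangent_space At (b0, x)" by (rule tractor.conn_fibre[OF s x v])
      moreover have "h x (D x v \<sigma>) (r *\<^sub>R xi x) = 0" for r
        using v by (simp add: f(3)[OF x] GT.bilinear GT.E_add GT.E_scale Jp xp tab)
      ultimately have "D x v \<sigma> \<in> perp T h T1 x"
        by (auto simp: perp_def pullback_tangent_bundle_def span_singleton)
      then show "beta T1 D \<sigma> x v \<in> coset (T1 x) ` perp T h T1 x" by (auto simp: beta_def)
    next
      fix u assume u: "u \<in> perp T h T1 x"
      then have ut: "u \<in> tangent_space At (b0, x)" and uxi: "h x u (xi x) = 0"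
        by (auto simp: perp_def pullback_tangent_bundle_def span_base)
      define w where "w = dM (b0, x) u"
      have w: "w \<in> tangent_space A x" using snd.differential_tangent[OF slice_point[OF xA] ut] by (simp add: w_def)
      have uw: "u = J x w - h x u (et x) *\<^sub>R xi x" using fibre_decomposition[OF xA ut] uxi by (simp add: w_def)
      let ?v = "(1 / (f x * lam)) *\<^sub>R w"
      have v: "?v \<in> tangent_space A x" by (rule subspace_scale[OF R.subspace_tangent w])
      have "(f x * lam) *\<^sub>R J x ?v = J x w" using k by (simp add: differential_linear)
      then have Dv: "D x ?v \<sigma> = J x w + ?v f *\<^sub>R xi x" unfolding f(3)[OF x v] by simp
      have "D x ?v \<sigma> - u = (J x w + ?v f *\<^sub>R xi x) - (J x w - h x u (et x) *\<^sub>R xi x)"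
        by (rule arg_cong2[of _ _ _ _ minus, OF Dv uw])
      then have "D x ?v \<sigma> - u = (?v f + h x u (et x)) *\<^sub>R xi x" by (simp add: scaleR_add_left)
      then have "D x ?v \<sigma> - u \<in> T1 x" by (auto simp: span_singleton)
      then have "beta T1 D \<sigma> x ?v = coset (T1 x) u" by (simp add: beta_def coset_eq_iff)
      then show "coset (T1 x) u \<in> beta T1 D \<sigma> x ` tangent_space A x" by (rule image_eqI[OF sym v])
    qed
  qed
qed

lemma sigma_metric_line:
  assumes x: "x \<in> points A" and uv: "u \<in> tangent_space A x" "v \<in> tangent_space A x"
    and D: "\<And>v. v \<in> tangent_space A x \<Longrightarrow> D x v \<sigma> = k *\<^sub>R J x v + r v *\<^sub>R xi x"
  shows "sigma_metric h D \<sigma> x u v = k\<^sup>2 * g x u v"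
proof -
  interpret GT: inner_form "tangent_space At (b0, x)" "h x" by (rule h_form[OF x])
  show ?thesis
    using uv
    by (simp add: sigma_metric_def D GT.bilinear GT.E_add GT.E_scale J_projections[OF x] xi_projections[OF x]
        h_table[OF x] power2_eq_square)
qed

theorem standard:
  assumes nonzero: "lam \<noteq> 0"
  shows "standard_tractor A T T1 h D g"
  unfolding standard_tractor_def tractor_connection_def
proof (intro conjI allI impI ballI)
  show "tractor_conformal_bundle A T T1 h" by (rule tractor_conformal)
  show "metric_connection A T h D" by (rule metric_connection_D)
  show "bij_betw (beta T1 D \<sigma> x) (tangent_space A x) (coset (T1 x) ` perp T h T1 x)"
    if "nonvanishing_section T T1 U \<sigma>" "x \<in> U" for U \<sigma> x
    by (rule beta_bijective[OF nonzero that])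
  fix U \<sigma> assume \<sigma>: "nonvanishing_section T T1 U \<sigma>"
  then have s: "smooth_along A At (\<lambda>x. (b0, x)) U \<sigma>" and line: "\<And>y. y \<in> U \<Longrightarrow> \<sigma> y \<in> T1 y" "\<And>y. y \<in> U \<Longrightarrow> \<sigma> y \<noteq> 0"
    by (auto simp: nonvanishing_section_def pullback_tangent_bundle_def)
  obtain f where f: "smooth_fun A U f" "\<And>y. y \<in> U \<Longrightarrow> \<sigma> y = f y *\<^sub>R xi y"
    "\<And>x v. x \<in> U \<Longrightarrow> v \<in> tangent_space A x \<Longrightarrow> D x v \<sigma> = (f x * lam) *\<^sub>R J x v + v f *\<^sub>R xi x"
    using line_section[OF s line(1)] by metis
  note UA = R.smooth_fun_points[OF f(1)]
  let ?k = "\<lambda>x. (f x * lam) * (f x * lam)"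
  show "conformal_on A U (sigma_metric h D \<sigma>) g"
    unfolding conformal_on_def
  proof (intro exI[of _ ?k] conjI ballI)
    have "smooth_fun A U (\<lambda>x. f x * lam)" using R.smooth_fun_cmult[OF f(1), of lam] by (simp add: mult.commute)
    from R.smooth_fun_mult[OF this this] show "smooth_fun A U ?k" .
    fix x assume x: "x \<in> U"
    have "f x * lam \<noteq> 0" using f(2)[OF x] line(2)[OF x] nonzero by auto
    then show "?k x > 0" using not_real_square_gt_zero[of "f x * lam"] by blast
    show "sigma_metric h D \<sigma> x u v = ?k x * g x u v" if "u \<in> tangent_space A x" "v \<in> tangent_space A x" for u v
      using sigma_metric_line[OF _ that, of \<sigma> "f x * lam" "\<lambda>v. v f"] f(3)[OF x] x UA
      by (auto simp: power2_eq_square)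
  qed
qed


section \<open>Curvature, normality and the Einstein condition\<close>

lemma derivative_nu:
  assumes x: "x \<in> points A" and v: "v \<in> tangent_space A x"
  shows "D x v nu = (2 * lam * mu) *\<^sub>R J x v"
proof -
  note n = null_sections and A = R.points_open order_refl[of "points A"]
  have "D x v nu = D x v (\<lambda>y. mu *\<^sub>R xi y) + D x v (\<lambda>y. lam *\<^sub>R et y)"
    by (rule tractor.conn_add[OF slice.along_scale[OF R.smooth_fun_const[OF A] n(1)]
          slice.along_scale[OF R.smooth_fun_const[OF A] n(2)] x v])
  also have "\<dots> = mu *\<^sub>R (lam *\<^sub>R J x v) + lam *\<^sub>R (mu *\<^sub>R J x v)"
    by (simp only: tractor.conn_cmult[OF n(1) x v] tractor.conn_cmult[OF n(2) x v] derivative_null[OF x v])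
  also have "\<dots> = (2 * lam * mu) *\<^sub>R J x v" by (rule scaleR_cross_add)
  finally show ?thesis .
qed

lemma nu_section: "open U \<Longrightarrow> U \<subseteq> points A \<Longrightarrow> smooth_along A At (\<lambda>x. (b0, x)) U nu"
  using null_sections_on R.smooth_fun_const by (intro slice.along_add slice.along_scale) auto

text \<open>The section \<open>xi\<close> is flat: its derivative is a multiple of the inclusion \<open>J\<close>, whose exterior
  derivative vanishes because the Gauss formula is symmetric and torsion-free.\<close>

lemma curvature_xi:
  assumes X: "vector_field A U X" and Y: "vector_field A U Y" and x: "x \<in> U"
  shows "curvature A D X Y xi x = 0"
proof -
  have U: "open U" "U \<subseteq> points A" using X by (auto simp: smooth_along_def)
  have xA: "x \<in> points A" using x U by auto
  interpret G: inner_form "tangent_space A x" "g x" by (rule g_form[OF xA])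
  note xi = null_sections_on(1)[OF U]
  have c: "D x v (cov D Z xi) = lam *\<^sub>R (J x (DM x v Z) + g x v (Z x) *\<^sub>R nu x)"
    if Z: "vector_field A U Z" and v: "v \<in> tangent_space A x" for Z v
  proof -
    have "D x v (cov D Z xi) = D x v (\<lambda>y. lam *\<^sub>R J y (Z y))"
      by (rule tractor.conn_cong[OF tractor.conn_smooth[OF xi Z] x _ v])
        (use U R.ident.along_tangent[OF Z] in \<open>auto simp: cov_def derivative_null\<close>)
    also have "\<dots> = lam *\<^sub>R D x v (\<lambda>y. J y (Z y))"
      by (rule tractor.conn_cmult[OF tangential_section[OF Z] x v])
    finally show ?thesis unfolding derivative_tangential[OF Z x v] .
  qed
  have t: "X x \<in> tangent_space A x" "Y x \<in> tangent_space A x"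
    using R.ident.along_tangent[OF X x] R.ident.along_tangent[OF Y x] .
  have "J x (lie_bracket A X Y x) = J x (DM x (X x) Y) - J x (DM x (Y x) X)"
    unfolding R.levi_civita_torsion[OF LC(1) X Y x, symmetric] differential_linear ..
  then show ?thesis
    unfolding tractor.curvature_expand c[OF X t(2)] c[OF Y t(1)]
      derivative_null(1)[OF xA R.lie_bracket_tangent[OF X Y x]]
    by (simp add: G.sym[OF t] scaleR_add_right scaleR_diff_right)
qed

text \<open>The Gauss equation; its normal component vanishes because \<open>g\<close> is parallel.\<close>

lemma curvature_tangential:
  assumes X: "vector_field A U X" and Y: "vector_field A U Y" and Z: "vector_field A U Z" and x: "x \<in> U"
  shows "curvature A D X Y (\<lambda>y. J y (Z y)) x = J x (curvature A DM X Y Z x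
    + (2 * lam * mu) *\<^sub>R (g x (Y x) (Z x) *\<^sub>R X x - g x (X x) (Z x) *\<^sub>R Y x))"
proof -
  have U: "open U" "U \<subseteq> points A" using X by (auto simp: smooth_along_def)
  have xA: "x \<in> points A" using x U by auto
  interpret G: inner_form "tangent_space A x" "g x" by (rule g_form[OF xA])
  interpret CM: connection_along A A "\<lambda>x. x" DM by (rule base_connection)
  note JZ = tangential_section[OF Z]
  have c: "D x v (cov D W (\<lambda>y. J y (Z y))) = J x (DM x v (cov DM W Z)) + g x v (DM x (W x) Z) *\<^sub>R nu x
      + (g x (W x) (Z x) *\<^sub>R ((2 * lam * mu) *\<^sub>R J x v) + v (\<lambda>y. g y (W y) (Z y)) *\<^sub>R nu x)"
    if W: "vector_field A U W" and v: "v \<in> tangent_space A x" for W v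
  proof -
    note DW = CM.conn_smooth[OF Z W] and gW = R.metric_smooth[OF g_metric W Z]
    have "D x v (cov D W (\<lambda>y. J y (Z y))) = D x v (\<lambda>y. J y (cov DM W Z y) + g y (W y) (Z y) *\<^sub>R nu y)"
      by (rule tractor.conn_cong[OF tractor.conn_smooth[OF JZ W] x _ v])
        (simp only: cov_def derivative_tangential[OF Z _ R.ident.along_tangent[OF W]])
    also have "\<dots> = D x v (\<lambda>y. J y (cov DM W Z y)) + D x v (\<lambda>y. g y (W y) (Z y) *\<^sub>R nu y)"
      by (rule tractor.conn_add[OF tangential_section[OF DW] slice.along_scale[OF gW nu_section[OF U]] x v])
    also have "\<dots> = J x (DM x v (cov DM W Z)) + g x v (cov DM W Z x) *\<^sub>R nu x
        + (g x (W x) (Z x) *\<^sub>R D x v nu + v (\<lambda>y. g y (W y) (Z y)) *\<^sub>R nu x)"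
      by (simp only: derivative_tangential[OF DW x v] tractor.conn_leibniz[OF nu_section[OF U] gW x v])
    finally show ?thesis by (simp only: derivative_nu[OF xA v] cov_def)
  qed
  have t: "X x \<in> tangent_space A x" "Y x \<in> tangent_space A x" "Z x \<in> tangent_space A x"
    using R.ident.along_tangent X Y Z x by auto
  note f = CM.conn_fibre[OF _ x]
  have br: "lie_bracket A X Y x \<in> tangent_space A x" by (rule R.lie_bracket_tangent[OF X Y x])
  have "g x (lie_bracket A X Y x) (Z x) = g x (DM x (X x) Y) (Z x) - g x (DM x (Y x) X) (Z x)"
    unfolding R.levi_civita_torsion[OF LC(1) X Y x, symmetric] by (rule G.diff_left) (intro f X Y t)+
  then have normal: "g x (X x) (DM x (Y x) Z) + X x (\<lambda>y. g y (Y y) (Z y))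
      - (g x (Y x) (DM x (X x) Z) + Y x (\<lambda>y. g y (X y) (Z y))) - g x (lie_bracket A X Y x) (Z x) = 0"
    by (simp add: R.levi_civita_metric[OF LC(1) Y Z x t(1)] R.levi_civita_metric[OF LC(1) X Z x t(2)])
  have "curvature A D X Y (\<lambda>y. J y (Z y)) x = J x (curvature A DM X Y Z x
    + (2 * lam * mu) *\<^sub>R (g x (Y x) (Z x) *\<^sub>R X x - g x (X x) (Z x) *\<^sub>R Y x))
    + (g x (X x) (DM x (Y x) Z) + X x (\<lambda>y. g y (Y y) (Z y))
      - (g x (Y x) (DM x (X x) Z) + Y x (\<lambda>y. g y (X y) (Z y))) - g x (lie_bracket A X Y x) (Z x)) *\<^sub>R nu x"
    unfolding tractor.curvature_expand CM.curvature_expand c[OF X t(2)] c[OF Y t(1)]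
      derivative_tangential[OF Z x br] differential_linear
    by (rule gauss_collect)
  then show ?thesis unfolding normal by simp
qed

text \<open>Where \<open>\<sigma> = f xi\<close>, the metric of \<open>\<sigma>\<close> is \<open>k\<^sup>2 g\<close> with \<open>k = f lam\<close>, so the fields \<open>k E i\<close> are
  \<open>g\<close>-orthonormal. As \<open>xi\<close> is flat, only tangential parts enter, and the Gauss equation gives the Ricci
  curvature plus the trace of its constant curvature term.\<close>

lemma trace_formula:
  assumes \<sigma>: "nonvanishing_section T T1 U \<sigma>" and E: "orthonormal_frame A (sigma_metric h D \<sigma>) U E"
    and X: "vector_field A U X" and Y: "vector_field A U Y" and x: "x \<in> U"
  shows "(\<Sum>i<DIM('e). h x (curvature A D (E i) X (cov D Y \<sigma>) x) (D x (E i x) \<sigma>)) =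
    ricci A g DM X Y x + 2 * lam * mu * (real DIM('e) - 1) * g x (X x) (Y x)"
proof -
  let ?n = "DIM('e)"
  have s: "smooth_along A At (\<lambda>x. (b0, x)) U \<sigma>" and line: "\<And>y. y \<in> U \<Longrightarrow> \<sigma> y \<in> T1 y"
    using \<sigma> by (auto simp: nonvanishing_section_def pullback_tangent_bundle_def)
  obtain f where f: "smooth_fun A U f" "\<And>y. y \<in> U \<Longrightarrow> \<sigma> y = f y *\<^sub>R xi y"
    "\<And>x v. x \<in> U \<Longrightarrow> v \<in> tangent_space A x \<Longrightarrow> D x v \<sigma> = (f x * lam) *\<^sub>R J x v + v f *\<^sub>R xi x"
    using line_section[OF s line] by metis
  have U: "open U" "U \<subseteq> points A" using X by (auto simp: smooth_along_def)
  have xA: "x \<in> points A" using x U by auto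
  define k where "k y = f y * lam" for y
  have k: "smooth_fun A U k" unfolding k_def using R.smooth_fun_cmult[OF f(1), of lam] by (simp add: mult.commute)
  have Ei: "vector_field A U (E i)" if "i < ?n" for i using E that by (simp add: orthonormal_frame_def)
  define E' where "E' i y = k y *\<^sub>R E i y" for i y
  have Ei': "vector_field A U (E' i)" if "i < ?n" for i
    unfolding E'_def by (rule R.ident.along_scale[OF k Ei[OF that]])
  have frame: "orthonormal_frame A g U E'"
    unfolding orthonormal_frame_def
  proof (intro conjI ballI allI impI Ei')
    fix y i j assume y: "y \<in> U" and ij: "i < ?n" "j < ?n"
    interpret G: inner_form "tangent_space A y" "g y" using g_form y U by auto
    have t: "E i y \<in> tangent_space A y" "E j y \<in> tangent_space A y"
      using R.ident.along_tangent[OF Ei y] ij by auto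
    have "g y (E' i y) (E' j y) = (k y)\<^sup>2 * g y (E i y) (E j y)"
      unfolding E'_def using t by (simp add: G.bilinear G.E_scale power2_eq_square)
    also have "\<dots> = sigma_metric h D \<sigma> y (E i y) (E j y)"
      using sigma_metric_line[OF _ t, of \<sigma> "k y" "\<lambda>v. v f"] f(3)[OF y] y U by (auto simp: k_def)
    also have "\<dots> = (if i = j then 1 else 0)" using E y ij by (simp add: orthonormal_frame_def)
    finally show "g y (E' i y) (E' j y) = (if i = j then 1 else 0)" .
  qed
  interpret G: inner_form "tangent_space A x" "g x" by (rule g_form[OF xA])
  interpret GT: inner_form "tangent_space At (b0, x)" "h x" by (rule h_form[OF xA])
  interpret CM: connection_along A A "\<lambda>x. x" DM by (rule base_connection)
  note Jp = J_projections[OF xA] and xp = xi_projections[OF xA] and tab = h_table[OF xA]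
  have t: "X x \<in> tangent_space A x" "Y x \<in> tangent_space A x"
    using R.ident.along_tangent[OF X x] R.ident.along_tangent[OF Y x] .
  have E't: "E' i x \<in> tangent_space A x" if "i < ?n" for i by (rule R.ident.along_tangent[OF Ei'[OF that] x])
  have E'on: "g x (E' i x) (E' j x) = (if i = j then 1 else 0)" if "i < ?n" "j < ?n" for i j
    using frame x that by (simp add: orthonormal_frame_def)
  note JY = tangential_section[OF Y] and Yf = R.field_smooth[OF Y f(1)] and xi = null_sections_on(1)[OF U]
  have "h x (curvature A D (E i) X (cov D Y \<sigma>) x) (D x (E i x) \<sigma>) =
      g x (curvature A DM (E' i) X Y x) (E' i x)
      + 2 * lam * mu * (g x (X x) (Y x) - g x (X x) (g x (Y x) (E' i x) *\<^sub>R E' i x))" if i: "i < ?n" for i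
  proof -
    have Et: "E i x \<in> tangent_space A x" by (rule R.ident.along_tangent[OF Ei[OF i] x])
    have "curvature A D (E i) X (cov D Y \<sigma>) x =
        curvature A D (E i) X (\<lambda>y. k y *\<^sub>R J y (Y y) + Y y f *\<^sub>R xi y) x"
      by (rule tractor.curvature_cong[OF Ei[OF i] X tractor.conn_smooth[OF s Y] _ x])
        (simp only: cov_def k_def f(3)[OF _ R.ident.along_tangent[OF Y]])
    also have "\<dots> = curvature A D (E i) X (\<lambda>y. k y *\<^sub>R J y (Y y)) x + curvature A D (E i) X (\<lambda>y. Y y f *\<^sub>R xi y) x"
      by (rule tractor.curvature_add[OF Ei[OF i] X slice.along_scale[OF k JY] slice.along_scale[OF Yf xi] x])
    also have "\<dots> = k x *\<^sub>R curvature A D (E i) X (\<lambda>y. J y (Y y)) x + Y x f *\<^sub>R curvature A D (E i) X xi x"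
      by (simp only: tractor.curvature_scale[OF Ei[OF i] X JY k x] tractor.curvature_scale[OF Ei[OF i] X xi Yf x])
    also have "\<dots> = k x *\<^sub>R J x (curvature A DM (E i) X Y x
        + (2 * lam * mu) *\<^sub>R (g x (X x) (Y x) *\<^sub>R E i x - g x (E i x) (Y x) *\<^sub>R X x))"
      by (simp only: curvature_xi[OF Ei[OF i] X x] curvature_tangential[OF Ei[OF i] X Y x]) simp
    finally have curv: "curvature A D (E i) X (cov D Y \<sigma>) x = k x *\<^sub>R J x (curvature A DM (E i) X Y x
        + (2 * lam * mu) *\<^sub>R (g x (X x) (Y x) *\<^sub>R E i x - g x (E i x) (Y x) *\<^sub>R X x))" .
    have "curvature A DM (E' i) X Y x = (\<Sum>j\<in>{0::nat}. k x *\<^sub>R curvature A DM (E i) X Y x)"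
      by (rule CM.curvature_sum_left[OF Ei'[OF i] X Y _ Ei[OF i] k _ x]) (simp_all add: E'_def)
    then have RE: "curvature A DM (E' i) X Y x = k x *\<^sub>R curvature A DM (E i) X Y x" by simp
    have Rt: "curvature A DM (E i) X Y x \<in> tangent_space A x"
      by (rule CM.curvature_fibre[OF Ei[OF i] X Y x])
    have one: "k x * (k x * g x (E i x) (E i x)) = 1"
      using E'on[OF i i] Et by (simp add: E'_def G.bilinear G.E_scale)
    show ?thesis
      unfolding curv RE f(3)[OF x Et] k_def[symmetric]
      using Et t Rt one
      by (simp add: E'_def GT.bilinear GT.E_add GT.E_scale Jp xp tab G.bilinear G.E_add G.E_diff G.E_scale
          G.sym[of "E i x" "Y x"] algebra_simps)
  qed
  then have "(\<Sum>i<?n. h x (curvature A D (E i) X (cov D Y \<sigma>) x) (D x (E i x) \<sigma>)) =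
      (\<Sum>i<?n. g x (curvature A DM (E' i) X Y x) (E' i x)) +
      2 * lam * mu * (\<Sum>i<?n. g x (X x) (Y x) - g x (X x) (g x (Y x) (E' i x) *\<^sub>R E' i x))"
    by (simp add: sum.distrib sum_distrib_left)
  also have "(\<Sum>i<?n. g x (curvature A DM (E' i) X Y x) (E' i x)) = ricci A g DM X Y x"
    by (rule R.ricci_orthonormal[OF g R.levi_civita_connection[OF LC(1)] frame x X Y, symmetric])
  also have "(\<Sum>i<?n. g x (X x) (Y x) - g x (X x) (g x (Y x) (E' i x) *\<^sub>R E' i x)) =
      real ?n * g x (X x) (Y x) - g x (X x) (\<Sum>i<?n. g x (Y x) (E' i x) *\<^sub>R E' i x)"
  proof -
    have "g x (X x) (\<Sum>i<?n. g x (Y x) (E' i x) *\<^sub>R E' i x) = (\<Sum>i<?n. g x (X x) (g x (Y x) (E' i x) *\<^sub>R E' i x))"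
      by (rule G.sum_right[OF G.E_scale[OF E't] t(1)]) simp
    then show ?thesis by (simp only: sum_subtractf sum_constant card_lessThan)
  qed
  also have "(\<Sum>i<?n. g x (Y x) (E' i x) *\<^sub>R E' i x) = Y x"
    by (rule G.orthonormal_expansion[OF g_signature[OF xA] E't E'on t(2), symmetric])
  finally show ?thesis by (simp add: algebra_simps)
qed

text \<open>The first normality condition holds since \<open>xi\<close> is flat; the second is the vanishing of the right
  hand side of the trace formula. For the converse direction it is applied to \<open>\<sigma> = xi\<close> and a rescaled
  \<open>g\<close>-orthonormal frame.\<close>

lemma normal_iff_ricci:
  assumes nonzero: "lam \<noteq> 0"
  shows "normal_tractor A T T1 h D \<longleftrightarrow> einstein A g DM (- 2 * lam * mu * (real DIM('e) - 1))"
proof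
  let ?n = "DIM('e)"
  assume normal: "normal_tractor A T T1 h D"
  show "einstein A g DM (- 2 * lam * mu * (real ?n - 1))"
    unfolding einstein_def
  proof (intro allI impI ballI)
    fix X Y x assume X: "vector_field A (points A) X" and Y: "vector_field A (points A) Y" and x: "x \<in> points A"
    obtain U F where U: "x \<in> U" and F: "orthonormal_frame A g U F" using R.local_orthonormal_frame[OF g x] .
    have Fi: "vector_field A U (F i)" if "i < ?n" for i using F that by (simp add: orthonormal_frame_def)
    have oU: "open U" "U \<subseteq> points A" using Fi[OF DIM_positive] by (auto simp: smooth_along_def)
    have \<sigma>: "nonvanishing_section T T1 U xi" by (rule xi_nonvanishing[OF oU])
    define E where "E i y = (1 / lam) *\<^sub>R F i y" for i y
    have E: "orthonormal_frame A (sigma_metric h D xi) U E"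
      unfolding orthonormal_frame_def
    proof (intro conjI ballI allI impI)
      show "vector_field A U (E i)" if "i < ?n" for i
        unfolding E_def by (intro R.ident.along_scale R.smooth_fun_const oU Fi that)
      fix y i j assume y: "y \<in> U" and ij: "i < ?n" "j < ?n"
      have yA: "y \<in> points A" using y oU by auto
      interpret G: inner_form "tangent_space A y" "g y" by (rule g_form[OF yA])
      have t: "F i y \<in> tangent_space A y" "F j y \<in> tangent_space A y"
        using R.ident.along_tangent[OF Fi y] ij by auto
      have "sigma_metric h D xi y (E i y) (E j y) = lam\<^sup>2 * g y (E i y) (E j y)"
        by (rule sigma_metric_line[OF yA, of _ _ _ _ "\<lambda>_. 0"])
          (auto simp: E_def derivative_null[OF yA] intro: G.E_scale t)
      also have "\<dots> = g y (F i y) (F j y)"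
        unfolding E_def using t nonzero by (simp add: G.bilinear G.E_scale power2_eq_square)
      also have "\<dots> = (if i = j then 1 else 0)" using F y ij by (simp add: orthonormal_frame_def)
      finally show "sigma_metric h D xi y (E i y) (E j y) = (if i = j then 1 else 0)" .
    qed
    have "0 = (\<Sum>i<?n. h x (curvature A D (E i) X (cov D Y xi) x) (D x (E i x) xi))"
      using bspec[OF mp[OF mp[OF spec[OF spec[OF spec[OF conjunct2[OF mp[OF mp[OF spec[OF spec[OF
        normal[unfolded normal_tractor_def]]] X] Y]]]]] \<sigma>] E] U] by (rule sym)
    also have "\<dots> = ricci A g DM X Y x + 2 * lam * mu * (real ?n - 1) * g x (X x) (Y x)"
      by (rule trace_formula[OF \<sigma> E R.ident.along_subset[OF X oU] R.ident.along_subset[OF Y oU] U])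
    finally show "ricci A g DM X Y x = - 2 * lam * mu * (real ?n - 1) * g x (X x) (Y x)" by simp
  qed
next
  let ?n = "DIM('e)"
  assume einstein: "einstein A g DM (- 2 * lam * mu * (real ?n - 1))"
  show "normal_tractor A T T1 h D"
    unfolding normal_tractor_def
  proof (intro allI impI conjI ballI)
    fix X Y assume X: "vector_field A (points A) X" and Y: "vector_field A (points A) Y"
    {
      fix \<sigma> x assume "sec T (points A) \<sigma>" and line: "\<forall>x\<in>points A. \<sigma> x \<in> T1 x" and x: "x \<in> points A"
      then have s: "smooth_along A At (\<lambda>x. (b0, x)) (points A) \<sigma>" by (simp add: pullback_tangent_bundle_def)
      obtain f where f: "smooth_fun A (points A) f" "\<And>y. y \<in> points A \<Longrightarrow> \<sigma> y = f y *\<^sub>R xi y"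
        using line_section[OF s] line by metis
      have "curvature A D X Y \<sigma> x = f x *\<^sub>R curvature A D X Y xi x"
        using tractor.curvature_cong[OF X Y s f(2) x] tractor.curvature_scale[OF X Y null_sections(1) f(1) x] by simp
      then show "curvature A D X Y \<sigma> x \<in> T1 x"
        using curvature_xi[OF X Y x] span_zero by simp
    }
    {
      fix U \<sigma> E x
      assume \<sigma>: "nonvanishing_section T T1 U \<sigma>" and E: "orthonormal_frame A (sigma_metric h D \<sigma>) U E" and x: "x \<in> U"
      have "vector_field A U (E 0)" using E DIM_positive by (simp add: orthonormal_frame_def)
      then have oU: "open U" "U \<subseteq> points A" by (auto simp: smooth_along_def)
      have "ricci A g DM X Y x = - 2 * lam * mu * (real ?n - 1) * g x (X x) (Y x)"
        using einstein X Y x oU by (auto simp: einstein_def)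
      then show "(\<Sum>i<?n. h x (curvature A D (E i) X (cov D Y \<sigma>) x) (D x (E i x) \<sigma>)) = 0"
        using trace_formula[OF \<sigma> E R.ident.along_subset[OF X oU] R.ident.along_subset[OF Y oU] x] by simp
    }
  qed
qed

text \<open>The Einstein condition is evaluated on global vector fields, so a global field that does not
  vanish at some point is what determines the constant.\<close>

lemma einstein_constant_unique:
  assumes "points A \<noteq> {}" "einstein A g DM \<Lambda>" "einstein A g DM \<Lambda>'"
  shows "\<Lambda> = \<Lambda>'"
proof -
  obtain p where p: "p \<in> points A" using assms(1) by auto
  obtain X where X: "vector_field A (points A) X" "X p \<noteq> 0" using R.global_vector_field[OF p] .
  have "\<Lambda> * g p (X p) (X p) = \<Lambda>' * g p (X p) (X p)"
    using assms(2,3) X p unfolding einstein_def by metis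
  moreover have "g p (X p) (X p) > 0"
    by (rule inner_form.pos_def[OF g_form[OF p] g_signature[OF p] R.ident.along_tangent[OF X(1) p] X(2)])
  ultimately show ?thesis by simp
qed

lemma mean_curvature_slice:
  assumes x: "x \<in> points A"
  shows "mean_curvature A At gt (\<lambda>x. (b0, x)) DM D x = nu x"
proof -
  let ?n = "DIM('e)"
  define E where "E = frame_near A (pullback_metric At (\<lambda>x. (b0, x)) gt) x"
  have "pullback_metric At (\<lambda>x. (b0, x)) gt y u v = g y u v"
    if "y \<in> points A" "u \<in> tangent_space A y" "v \<in> tangent_space A y" for y u v
    using h_table(9)[OF that] by (simp add: pullback_metric_def)
  then obtain U where U: "x \<in> U" and E: "orthonormal_frame A g U E"
    using R.frame_near_orthonormal[OF g x, of "pullback_metric At (\<lambda>x. (b0, x)) gt"] unfolding E_def by blast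
  have "second_fundamental_form At (\<lambda>x. (b0, x)) DM D (E i) (E i) x = nu x" if i: "i < ?n" for i
  proof -
    have Ei: "vector_field A U (E i)" and one: "g x (E i x) (E i x) = 1"
      using E U i by (simp_all add: orthonormal_frame_def)
    show ?thesis
      unfolding second_fundamental_form_def cov_def
        derivative_tangential[OF Ei U R.ident.along_tangent[OF Ei U]] one by simp
  qed
  then have "mean_curvature A At gt (\<lambda>x. (b0, x)) DM D x = (1 / real ?n) *\<^sub>R (\<Sum>i<?n. nu x)"
    unfolding mean_curvature_def Let_def E_def[symmetric] by simp
  then show ?thesis by (simp only: sum_constant_scaleR card_lessThan) simp
qed

lemma mean_curvature_norm:
  assumes x: "x \<in> points A"
  shows "h x (nu x) (nu x) = - 2 * lam * mu"
proof -
  interpret GT: inner_form "tangent_space At (b0, x)" "h x" by (rule h_form[OF x])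
  show ?thesis
    using xi_projections[OF x] by (simp add: GT.bilinear GT.E_add GT.E_scale h_table[OF x])
qed

text \<open>The gradient is \<open>- mu \<xi> - lam \<eta>\<close>: pairing with a null pair of product \<open>-1\<close> exchanges the two
  coefficients and changes their signs.\<close>

lemma gradient_norm:
  "gB b0 (gradient AB gB \<phi> b0) (gradient AB gB \<phi> b0) = - 2 * lam * mu"
proof -
  interpret G: inner_form "tangent_space AB b0" "gB b0" by (rule gB_form[OF base(1)])
  note t = null_tangent[OF base(1)] and p = null_products[OF base(1)]
  let ?v = "(- mu) *\<^sub>R \<xi> b0 + (- lam) *\<^sub>R \<eta> b0"
  have v: "?v \<in> tangent_space AB b0" by (intro G.E_add G.E_scale t)
  have "gradient AB gB \<phi> b0 = ?v"
    unfolding gradient_def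
  proof (rule the_equality)
    show "?v \<in> tangent_space AB b0 \<and> (\<forall>w\<in>tangent_space AB b0. gB b0 ?v w = w \<phi>)"
    proof (intro conjI ballI v)
      fix w assume w: "w \<in> tangent_space AB b0"
      have "w \<phi> = ((- gB b0 w (\<eta> b0)) *\<^sub>R \<xi> b0 + (- gB b0 w (\<xi> b0)) *\<^sub>R \<eta> b0) \<phi>"
        using null_expansion[OF base(1) w] by simp
      also have "\<dots> = - gB b0 w (\<eta> b0) * lam - gB b0 w (\<xi> b0) * mu" by (simp add: scaleR_fun_def)
      finally have "w \<phi> = (- mu) * gB b0 (\<xi> b0) w + (- lam) * gB b0 (\<eta> b0) w"
        using t by (simp add: G.sym[OF w])
      then show "gB b0 ?v w = w \<phi>"
        by (simp only: G.add_left[OF G.E_scale[OF t(1)] G.E_scale[OF t(2)] w] G.scale_left[OF t(1) w] G.scale_left[OF t(2) w])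
    qed
    fix v' assume v': "v' \<in> tangent_space AB b0 \<and> (\<forall>w\<in>tangent_space AB b0. gB b0 v' w = w \<phi>)"
    then show "v' = ?v" using null_expansion[OF base(1), of v'] t by simp
  qed
  moreover have "gB b0 ?v ?v = - 2 * lam * mu"
    by (simp only: G.add_left G.add_right G.scale_left G.scale_right G.E_add G.E_scale t p) simp
  ultimately show ?thesis by simp
qed

end


theorem proposition4p1:
  fixes n :: nat
    and A :: "('m::{t2_space,second_countable_topology}, 'e::euclidean_space) chart set"
    and g :: "'m \<Rightarrow> 'm tvec \<Rightarrow> 'm tvec \<Rightarrow> real"
    and B :: "(real \<times> real) set"
    and AB :: "(real \<times> real, real \<times> real) chart set"
    and gB :: "real \<times> real \<Rightarrow> (real \<times> real) tvec \<Rightarrow> (real \<times> real) tvec \<Rightarrow> real"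
    and \<xi> \<eta> :: "real \<times> real \<Rightarrow> (real \<times> real) tvec"
    and \<phi> :: "real \<times> real \<Rightarrow> real"
    and \<rho>0 s0 :: real
    and At :: "((real \<times> real) \<times> 'm, (real \<times> real) \<times> 'e) chart set"
    and gt :: "(real \<times> real) \<times> 'm \<Rightarrow> ((real \<times> real) \<times> 'm) tvec \<Rightarrow> ((real \<times> real) \<times> 'm) tvec \<Rightarrow> real"
    and \<Psi> :: "'m \<Rightarrow> (real \<times> real) \<times> 'm"
    and DM :: "('m, 'm tvec) conn"
    and DMt :: "((real \<times> real) \<times> 'm, ((real \<times> real) \<times> 'm) tvec) conn"
    and D :: "('m, ((real \<times> real) \<times> 'm) tvec) conn"
    and T :: "('m, ((real \<times> real) \<times> 'm) tvec) vbundle"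
    and T1 :: "'m \<Rightarrow> ((real \<times> real) \<times> 'm) tvec set"
    and h :: "'m \<Rightarrow> ((real \<times> real) \<times> 'm) tvec \<Rightarrow> ((real \<times> real) \<times> 'm) tvec \<Rightarrow> real"
    and H :: "'m \<Rightarrow> ((real \<times> real) \<times> 'm) tvec"
    and grad\<phi> :: "(real \<times> real) tvec"
  assumes dim: "DIM('e) = n" "n \<ge> 2"
    and M: "smooth_atlas A" "points A \<noteq> {}" "connected (points A)" "riemannian_metric A g"
    and B: "open B" "AB = open_atlas B" "lorentzian_metric AB gB"
    and lightlike: "lightlike_field AB gB \<xi>" "lightlike_field AB gB \<eta>"
      "\<And>b. b \<in> B \<Longrightarrow> gB b (\<xi> b) (\<eta> b) = -1"
    and \<phi>: "smooth_fun AB B \<phi>" "\<And>b. b \<in> B \<Longrightarrow> \<phi> b > 0"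
    and Mt: "At = prod_atlas AB A" "gt = warped_metric AB A gB \<phi> g"
    and base: "(\<rho>0, s0) \<in> B" "\<phi> (\<rho>0, s0) = 1" "\<xi> (\<rho>0, s0) \<phi> \<noteq> 0"
    and \<Psi>: "\<Psi> = (\<lambda>x. ((\<rho>0, s0), x))"
    and LC: "levi_civita A g DM" "levi_civita At gt DMt"
    and tractor: "T = pullback_tangent_bundle A At \<Psi>"
      "T1 = (\<lambda>x. span {lift_field At \<xi> (\<Psi> x)})"
      "h = (\<lambda>x. gt (\<Psi> x))"
      "pullback_connection A At \<Psi> DMt D"
    and H: "H = mean_curvature A At gt \<Psi> DM D"
    and grad\<phi>: "grad\<phi> = gradient AB gB \<phi> (\<rho>0, s0)"
  shows "standard_tractor A T T1 h D g \<and>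
    (normal_tractor A T T1 h D \<longleftrightarrow>
       (\<exists>\<Lambda>. einstein A g DM \<Lambda> \<and>
          (\<forall>x\<in>points A. \<Lambda> = (real n - 1) * gt (\<Psi> x) (H x) (H x)) \<and>
          \<Lambda> = (real n - 1) * gB (\<rho>0, s0) grad\<phi> grad\<phi>)) \<and>
    (normal_tractor A T T1 h D \<longrightarrow>
       (\<forall>\<Lambda>. einstein A g DM \<Lambda> \<longrightarrow>
          (\<forall>x\<in>points A. \<Lambda> = (real n - 1) * gt (\<Psi> x) (H x) (H x)) \<and>
          \<Lambda> = (real n - 1) * gB (\<rho>0, s0) grad\<phi> grad\<phi>))"
proof -
  have B': "smooth_atlas AB" "points AB = B" using smooth_atlas_open[OF B(1)] B(2) by simp_all
  interpret W: warped_slice AB A g gB \<xi> \<eta> \<phi> "(\<rho>0, s0)" DM DMt D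
  proof unfold_locales
    show "levi_civita (prod_atlas AB A) (warped_metric AB A gB \<phi> g) DMt" using LC(2) Mt by simp
    show "pullback_connection A (prod_atlas AB A) (\<lambda>x. ((\<rho>0, s0), x)) DMt D" using tractor(4) Mt \<Psi> by simp
  qed (use assms B' in simp_all)
  have T: "T = W.T" and T1: "T1 = W.T1" and h: "h = (\<lambda>x. W.gt ((\<rho>0, s0), x))"
    using tractor Mt \<Psi> by simp_all
  let ?c = "- 2 * \<xi> (\<rho>0, s0) \<phi> * \<eta> (\<rho>0, s0) \<phi>"
  have Hc: "gt (\<Psi> x) (H x) (H x) = ?c" if "x \<in> points A" for x
    using W.mean_curvature_norm[OF that] W.mean_curvature_slice[OF that] H Mt \<Psi> by simp
  have gradc: "gB (\<rho>0, s0) grad\<phi> grad\<phi> = ?c" using W.gradient_norm grad\<phi> by simp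
  have normal: "normal_tractor A T T1 h D \<longleftrightarrow> einstein A g DM ((real n - 1) * ?c)"
    unfolding T T1 h using W.normal_iff_ricci[OF base(3)] dim(1) by (simp add: mult.commute)
  show ?thesis
  proof (intro conjI)
    show "standard_tractor A T T1 h D g" unfolding T T1 h by (rule W.standard[OF base(3)])
    show "normal_tractor A T T1 h D \<longleftrightarrow> (\<exists>\<Lambda>. einstein A g DM \<Lambda> \<and>
        (\<forall>x\<in>points A. \<Lambda> = (real n - 1) * gt (\<Psi> x) (H x) (H x)) \<and> \<Lambda> = (real n - 1) * gB (\<rho>0, s0) grad\<phi> grad\<phi>)"
      using normal Hc gradc by auto
    show "normal_tractor A T T1 h D \<longrightarrow> (\<forall>\<Lambda>. einstein A g DM \<Lambda> \<longrightarrow>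
        (\<forall>x\<in>points A. \<Lambda> = (real n - 1) * gt (\<Psi> x) (H x) (H x)) \<and> \<Lambda> = (real n - 1) * gB (\<rho>0, s0) grad\<phi> grad\<phi>)"
      using normal Hc gradc W.einstein_constant_unique[OF M(2)] by auto
  qed
qed

end
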